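(* Let $n\ge1$ and let $\alpha\in(0,n+2)$, $\lambda$, $\sigma$ be constants with $\frac{n+2-\alpha}{n}\le\lambda<\frac{n+2}{n}$ and $0\le\sigma<\frac{2(n+2)-\alpha}{n}-\lambda$. Suppose $u$ is a nonnegative function with $u\in C^{2,1}(\mathbb{R}^n\times(0,16))\cap L^\lambda(\mathbb{R}^n\times(0,16))$ satisfying $$0\le u_t-\Delta u\le \Big(\iint_{\mathbb{R}^n\times(0,16)}\Phi(x-y,t-s)^{\alpha/n}u(y,s)^\lambda\,dy\,ds\Big)\,u(x,t)^\sigma\quad\text{in }B_4(0)\times(0,16).$$ Then $\max_{|x|\le1}u(x,t)=O(t^{-n/2})$ as $t\to0^+$.
   Context: $\Phi$ is the heat kernel: $\Phi(x,t)=(4\pi t)^{-n/2}e^{-|x|^2/(4t)}$ for $t>0$ and $\Phi(x,t)=0$ for $t\le0$. $B_r(0)$ is the open ball of radius $r$ centered at the origin of $\mathbb{R}^n$. *)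

theory Defs
  imports "HOL-Analysis.Analysis" "HOL-Library.Landau_Symbols"
begin

definition heat_kernel :: "'a::euclidean_space \<Rightarrow> real \<Rightarrow> real" where
  "heat_kernel x t = (if t > 0
     then (4 * pi * t) powr (- real DIM('a) / 2) * exp (- (norm x * norm x) / (4 * t))
     else 0)"

text \<open>Real power of a nonnegative base with the convention a^0 = 1
  (Isabelle's powr has 0 powr 0 = 0).\<close>
definition rpow :: "real \<Rightarrow> real \<Rightarrow> real" where
  "rpow a b = (if b = 0 then 1 else a powr b)"

definition C21_on ::
  "('a::euclidean_space \<times> real) set \<Rightarrow> ('a \<Rightarrow> real \<Rightarrow> real) \<Rightarrow> ('a \<Rightarrow> real \<Rightarrow> real)
    \<Rightarrow> ('a \<Rightarrow> real \<Rightarrow> 'a) \<Rightarrow> ('a \<Rightarrow> real \<Rightarrow> 'a \<Rightarrow> 'a) \<Rightarrow> bool" where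
  "C21_on S u ut g H \<longleftrightarrow>
     (\<forall>x t. (x, t) \<in> S \<longrightarrow>
        ((\<lambda>s. u x s) has_real_derivative ut x t) (at t) \<and>
        ((\<lambda>y. u y t) has_derivative (\<lambda>h. g x t \<bullet> h)) (at x) \<and>
        ((\<lambda>y. g y t) has_derivative H x t) (at x)) \<and>
     continuous_on S (\<lambda>p. u (fst p) (snd p)) \<and>
     continuous_on S (\<lambda>p. ut (fst p) (snd p)) \<and>
     continuous_on S (\<lambda>p. g (fst p) (snd p)) \<and>
     (\<forall>i\<in>Basis. \<forall>j\<in>Basis. continuous_on S (\<lambda>p. H (fst p) (snd p) i \<bullet> j))"

definition laplacian :: "('a::euclidean_space \<Rightarrow> real \<Rightarrow> 'a \<Rightarrow> 'a) \<Rightarrow> 'a \<Rightarrow> real \<Rightarrow> real" where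
  "laplacian H x t = (\<Sum>b\<in>Basis. H x t b \<bullet> b)"

end

theory Submission
  imports Defs
begin

text \<open>Write \<open>f\<close> for \<open>u\<^sub>t - \<Delta> u\<close> and \<open>pnorm (x, t) = max |x| (sqrt |t|)\<close>. Testing the equation with a cutoff gives
  bounds, uniform as \<open>t \<rightarrow> 0\<close>, for the mass of \<open>u(\<sqdot>, t)\<close> and of \<open>f\<close> near the origin. Testing with the backward
  heat kernel times a cutoff bounds \<open>u\<close> by a constant plus \<open>pnorm\<^bsup>-n\<^esup>\<close>-potentials of these finite measures,
  so \<open>pnorm\<^bsup>-\<theta>\<^esup> u\<^bsup>\<lambda>\<^esup>\<close> is locally integrable uniformly in the pole whenever \<open>\<theta> + n \<lambda> < n + 2\<close>. Hence the
  part of the nonlocal factor at parabolic distance at least \<open>r\<close> is \<open>O(r\<^bsup>-\<gamma>-\<epsilon>\<^esup>)\<close> with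
  \<open>\<gamma> = \<alpha> + n \<lambda> - n - 2\<close>.

  Let \<open>u \<rho>\<^bsup>n\<^esup>\<close> be maximal at a point where \<open>u = m\<close>, with \<open>\<rho>\<close> the parabolic distance to the lateral and lower
  boundary of a cylinder. At scale \<open>r = \<Lambda> m\<^bsup>-1/n\<^esup>\<close>, unless \<open>r\<close> is comparable to \<open>\<rho>\<close>, \<open>u \<le> 2\<^bsup>n\<^esup> m\<close> nearby, so
  \<open>f = O(r\<^bsup>-\<gamma>-\<epsilon>-n \<sigma>\<^esup>)\<close> there, and the potential bound yields
  \<open>\<Lambda>\<^bsup>n\<^esup> \<le> C + C' r\<^bsup>n+2-\<gamma>-\<epsilon>-n \<sigma>\<^esup>\<close>. The exponent is positive by the hypothesis on \<open>\<sigma>\<close>, so for large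
  \<open>\<Lambda>\<close> this bounds \<open>m\<close>.\<close>

subsection \<open>Parabolic norm and heat kernel\<close>

text \<open>Nothing is assumed about \<open>u\<close> as time tends to 0, so every estimate starts
  at a time \<open>d > 0\<close> with constants free of \<open>d\<close>; the slice at time
  \<open>d\<close> plays the role of an initial measure, and no trace at time 0 is ever taken.
  Finite measures have potentials that just miss the critical integrability theta + n lambda = n +
  2. This is the origin of the loss epsilon. The loss is affordable because the hypothesis on sigma
  is strict: multiplied by n, it says gamma + n sigma < n + 2, so a small epsilon keeps the final
  exponent positive. The lower bound on lambda says gamma >= 0, so at scales r <= 1 the bounded
  contribution of distant points, controlled by the global integrability of u^lambda, is dominated
  by the singular one. Two regimes of lambda occur. For lambda >= 1 the potential bound is raised to
  the power lambda by a convexity argument on finite measures. For lambda < 1, possible once alpha >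
  2, convexity fails, and u is compared pointwise with the -n-th power of the distance to the
  pole.\<close>

definition pnorm :: "'a::euclidean_space \<times> real \<Rightarrow> real" where
  "pnorm p = max (norm (fst p)) (sqrt \<bar>snd p\<bar>)"

lemma pnorm_nonneg [simp]: "0 \<le> pnorm p"
  unfolding pnorm_def by (simp add: le_max_iff_disj)

lemma pnorm_minus_commute: "pnorm (p - q) = pnorm (q - p)"
  unfolding pnorm_def by (simp add: norm_minus_commute abs_minus_commute)

lemma continuous_on_pnorm [continuous_intros]:
  "continuous_on S f \<Longrightarrow> continuous_on S (\<lambda>x. pnorm (f x))"
  unfolding pnorm_def by (intro continuous_intros)

lemma borel_measurable_pnorm [measurable]: "pnorm \<in> borel_measurable borel"
  by (intro borel_measurable_continuous_onI continuous_intros)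

lemma pnorm_pos_time: "snd p \<noteq> 0 \<Longrightarrow> 0 < pnorm p"
  unfolding pnorm_def by (simp add: less_max_iff_disj)

text \<open>Lets a Gaussian absorb a power of \<open>z\<close>, later |x|^2/t. The exponent is
  enlarged to the integer \<open>N\<close>, harmless for \<open>1 \<le> z\<close>, and
  \<open>w \<le> exp w\<close> is raised to the power \<open>N\<close> at
  \<open>w = z / (4 * N)\<close>, which produces exactly \<open>exp (z / 4)\<close>.\<close>

lemma powr_le_exp:
  fixes z :: real and N :: nat
  assumes "1 \<le> z" "1 \<le> N"
  shows "z powr (real N / 2) \<le> (4 * real N) ^ N * exp (z / 4)"
proof -
  have "z powr (real N / 2) \<le> z powr real N"
    using assms by (intro powr_mono) auto
  also have "\<dots> = z ^ N" using assms by (simp add: powr_realpow)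
  also have "\<dots> = (4 * real N) ^ N * (z / (4 * real N)) ^ N"
    using assms by (subst power_mult_distrib[symmetric]) simp
  also have "\<dots> \<le> (4 * real N) ^ N * exp (z / (4 * real N)) ^ N"
  proof -
    have "z / (4 * real N) \<le> exp (z / (4 * real N))"
      using exp_ge_add_one_self[of "z / (4 * real N)"] by linarith
    thus ?thesis using assms by (intro mult_left_mono power_mono) auto
  qed
  also have "exp (z / (4 * real N)) ^ N = exp (z / 4)"
    using assms by (subst exp_of_nat_mult[symmetric]) simp
  finally show ?thesis .
qed

lemma heat_kernel_nonneg [simp]: "0 \<le> heat_kernel x t"
  unfolding heat_kernel_def by simp

text \<open>Parabolic homogeneity of degree -n. Where \<open>norm x \<le> sqrt t\<close> the
  exponential is dropped; elsewhere the power of \<open>t\<close> is traded for the same power of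
  |x|^2 times \<open>z powr (N / 2)\<close>, and the Gaussian absorbs the latter.\<close>

lemma heat_kernel_le_pnorm:
  obtains C where "0 < C"
    "\<And>x t. heat_kernel (x::'a::euclidean_space) t \<le> C * pnorm (x, t) powr (- real DIM('a))"
proof -
  define N where "N = DIM('a)"
  have N: "1 \<le> N" unfolding N_def by (simp add: Suc_leI)
  define C where "C = (4 * pi) powr (- real N / 2) * (4 * real N) ^ N"
  have big: "1 \<le> (4 * real N) ^ N" using N by (intro one_le_power) auto
  have "0 < C" unfolding C_def using N by simp
  moreover have "heat_kernel x t \<le> C * pnorm (x, t) powr (- real DIM('a))" for x :: 'a and t
  proof (cases "t > 0")
    case False
    thus ?thesis using \<open>0 < C\<close> by (simp add: heat_kernel_def)
  next
    case t: True
    have hk: "heat_kernel x t = (4 * pi) powr (- real N / 2) * (t powr (- real N / 2) * exp (- (norm x)\<^sup>2 / (4 * t)))"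
      using t by (simp add: heat_kernel_def N_def powr_mult power2_eq_square)
    have st: "t powr (- real N / 2) = sqrt t powr (- real N)"
      using t by (simp add: powr_half_sqrt[symmetric] powr_powr)
    have "t powr (- real N / 2) * exp (- (norm x)\<^sup>2 / (4 * t))
        \<le> (4 * real N) ^ N * pnorm (x, t) powr (- real N)"
    proof (cases "norm x \<le> sqrt t")
      case True
      hence D: "pnorm (x, t) = sqrt t" using t by (simp add: pnorm_def)
      have "t powr (- real N / 2) * exp (- (norm x)\<^sup>2 / (4 * t)) \<le> 1 * t powr (- real N / 2)"
        using t by (simp add: mult_left_le)
      also have "\<dots> \<le> (4 * real N) ^ N * t powr (- real N / 2)"
        using big by (intro mult_right_mono) auto
      finally show ?thesis unfolding D st .
    next
      case False
      hence D: "pnorm (x, t) = norm x" and x: "norm x > 0" "sqrt t < norm x"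
        using t less_le_trans[of 0 "sqrt t" "norm x"] by (auto simp: pnorm_def)
      define z where "z = (norm x)\<^sup>2 / t"
      have "t < (norm x)\<^sup>2" using x t using real_less_rsqrt[of "norm x" t] real_sqrt_less_iff[of t "(norm x)\<^sup>2"] by simp
      hence z: "1 \<le> z" using t by (simp add: z_def)
      have "t powr (- real N / 2) = norm x powr (- real N) * z powr (real N / 2)"
      proof -
        have "(norm x)\<^sup>2 powr (real N / 2) = norm x powr real N"
          using x powr_powr[of "norm x" 2 "real N / 2"] by simp
        thus ?thesis using t x by (simp add: z_def powr_divide powr_minus field_simps)
      qed
      hence "t powr (- real N / 2) * exp (- (norm x)\<^sup>2 / (4 * t))
           = norm x powr (- real N) * (z powr (real N / 2) * exp (- (z / 4)))"
        using t by (simp add: z_def field_simps)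
      also have "\<dots> \<le> norm x powr (- real N) * ((4 * real N) ^ N * exp (z / 4) * exp (- (z / 4)))"
        using powr_le_exp[OF z N] by (intro mult_left_mono mult_right_mono) auto
      also have "\<dots> = (4 * real N) ^ N * norm x powr (- real N)"
        by (simp add: exp_minus)
      finally show ?thesis unfolding D .
    qed
    thus ?thesis unfolding hk C_def by (simp add: N_def[symmetric] mult.assoc)
  qed
  ultimately show ?thesis using that by blast
qed

section \<open>Volume and integrability in the homogeneous dimension n + 2\<close>

lemma emeasure_pnorm_less_le:
  obtains V where "0 < V"
    "\<And>R. 0 < R \<Longrightarrow> emeasure lborel {p :: 'a::euclidean_space \<times> real. pnorm p < R}
       \<le> ennreal (V * R powr (real DIM('a) + 2))"
proof -
  define V where "V = 2 * unit_ball_vol (real DIM('a))"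
  have "emeasure lborel {p :: 'a \<times> real. pnorm p < R} \<le> ennreal (V * R powr (real DIM('a) + 2))"
    if R: "0 < R" for R
  proof -
    have "sqrt \<bar>s\<bar> < R \<Longrightarrow> \<bar>s\<bar> \<le> R\<^sup>2" for s
      using R by (metis less_eq_real_def real_sqrt_abs real_sqrt_less_iff abs_of_pos)
    hence "{p :: 'a \<times> real. pnorm p < R} \<subseteq> ball 0 R \<times> {- R\<^sup>2 .. R\<^sup>2}"
      by (force simp: pnorm_def)
    hence "emeasure lborel {p :: 'a \<times> real. pnorm p < R}
        \<le> emeasure (lborel \<Otimes>\<^sub>M lborel) (ball (0::'a) R \<times> {- R\<^sup>2 .. R\<^sup>2})"
      unfolding lborel_prod by (intro emeasure_mono) (auto intro!: borel_Times)
    also have "\<dots> = emeasure lborel (ball (0::'a) R) * emeasure lborel {- R\<^sup>2 .. R\<^sup>2}"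
      by (intro lborel.emeasure_pair_measure_Times) auto
    also have "\<dots> = ennreal (unit_ball_vol (real DIM('a)) * R ^ DIM('a)) * ennreal (2 * R\<^sup>2)"
      using R by (simp add: emeasure_ball)
    also have "\<dots> = ennreal (V * R powr (real DIM('a) + 2))"
      using R by (subst ennreal_mult[symmetric])
        (auto simp: V_def powr_add powr_realpow unit_ball_vol_nonneg)
    finally show ?thesis .
  qed
  thus ?thesis using that[of V] unfolding V_def by (simp add: unit_ball_vol_pos)
qed

lemma ex_dyadic_scale:
  fixes x R :: real
  assumes "0 < x" "x < R"
  shows "\<exists>k. R / 2 ^ Suc k \<le> x \<and> x < R / 2 ^ k"
proof -
  obtain k0 where k0: "(1/2) ^ k0 < x / R"
    using assms real_arch_pow_inv[of "x / R" "1/2"] by auto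
  define P where "P k \<longleftrightarrow> R / 2 ^ Suc k \<le> x" for k
  have "R / 2 ^ k0 \<le> x" using k0 assms by (simp add: field_simps)
  moreover have "R / 2 ^ Suc k0 \<le> R / 2 ^ k0" using assms by (intro divide_left_mono) auto
  ultimately have "P k0" unfolding P_def by linarith
  define k where "k = (LEAST k. P k)"
  have "P k" unfolding k_def using \<open>P k0\<close> by (rule LeastI)
  moreover have "x < R / 2 ^ k"
  proof (cases k)
    case 0 thus ?thesis using assms by simp
  next
    case (Suc j)
    hence "\<not> P j" using not_less_Least[of j P] by (simp add: k_def)
    thus ?thesis by (simp add: P_def Suc)
  qed
  ultimately show ?thesis unfolding P_def by blast
qed

text \<open>Dyadic summation: the shell at radius \<open>R / 2 ^ k\<close>, enlarged to a full
  parabolic ball, contributes a multiple of its radius to the power n + 2 - b. The resulting series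
  is geometric because \<open>b\<close> stays below the homogeneous dimension.\<close>

lemma nn_integral_pnorm_powr_le:
  fixes b :: real
  assumes b: "0 < b" "b < real DIM('a::euclidean_space) + 2"
  obtains C where "0 < C"
    "\<And>R. 0 < R \<Longrightarrow> (\<integral>\<^sup>+ p. indicator {p :: 'a \<times> real. pnorm p < R} p * ennreal (pnorm p powr (- b)) \<partial>lborel)
       \<le> ennreal (C * R powr (real DIM('a) + 2 - b))"
proof -
  define Q where "Q = real DIM('a) + 2"
  obtain V where V: "0 < V"
    "\<And>R. 0 < R \<Longrightarrow> emeasure lborel {p :: 'a \<times> real. pnorm p < R} \<le> ennreal (V * R powr Q)"
    unfolding Q_def using emeasure_pnorm_less_le[where 'a='a] by blast
  define q where "q = 2 powr (- (Q - b))"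
  have q: "0 < q" "q < 1" using b by (auto simp: q_def Q_def powr_less_one)
  define C where "C = V * 2 powr b / (1 - q)"
  have "0 < C" using V q by (simp add: C_def)
  moreover have "(\<integral>\<^sup>+ p. indicator {p :: 'a \<times> real. pnorm p < R} p * ennreal (pnorm p powr (- b)) \<partial>lborel)
       \<le> ennreal (C * R powr (Q - b))" if R: "0 < R" for R
  proof -
    let ?A = "\<lambda>k::nat. {p :: 'a \<times> real. pnorm p < R / 2 ^ k}"
    let ?c = "\<lambda>k::nat. (R / 2 ^ Suc k) powr (- b)"
    have pw: "indicator {p :: 'a \<times> real. pnorm p < R} p * ennreal (pnorm p powr (- b))
        \<le> (\<Sum>k. ennreal (?c k) * indicator (?A k) p)" for p
    proof (cases "0 < pnorm p \<and> pnorm p < R")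
      case False
      \<comment> \<open>At the pole itself \<open>0 powr (- b) = 0\<close>, so the singular point
        contributes nothing to the left side.\<close>
      hence "pnorm p = 0 \<or> \<not> pnorm p < R" using pnorm_nonneg[of p] by linarith
      thus ?thesis by auto
    next
      case True
      then obtain k where k: "R / 2 ^ Suc k \<le> pnorm p" "pnorm p < R / 2 ^ k"
        using ex_dyadic_scale by blast
      have "pnorm p powr (- b) \<le> ?c k"
        using k R b by (intro powr_mono2') auto
      hence "indicator {p :: 'a \<times> real. pnorm p < R} p * ennreal (pnorm p powr (- b))
          \<le> ennreal (?c k) * indicator (?A k) p"
        using True k by (simp add: ennreal_leI)
      also have "\<dots> \<le> (\<Sum>k. ennreal (?c k) * indicator (?A k) p)"
        using sum_le_suminf[of "\<lambda>k. ennreal (?c k) * indicator (?A k) p" "{k}", OF summableI finite.insertI[OF finite.emptyI] zero_le]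
        by (simp only: sum.insert sum.empty finite.emptyI empty_iff add_0_right not_False_eq_True zero_le)
      finally show ?thesis .
    qed
    have "(\<integral>\<^sup>+ p. indicator {p :: 'a \<times> real. pnorm p < R} p * ennreal (pnorm p powr (- b)) \<partial>lborel)
        \<le> (\<integral>\<^sup>+ p. (\<Sum>k. ennreal (?c k) * indicator (?A k) p) \<partial>lborel)"
      by (intro nn_integral_mono pw)
    also have "\<dots> = (\<Sum>k. \<integral>\<^sup>+ p. ennreal (?c k) * indicator (?A k) p \<partial>lborel)"
      by (intro nn_integral_suminf) measurable
    also have "\<dots> = (\<Sum>k. ennreal (?c k) * emeasure lborel (?A k))"
      by (intro suminf_cong nn_integral_cmult_indicator) measurable
    also have "\<dots> \<le> (\<Sum>k. ennreal (V * 2 powr b * R powr (Q - b) * q ^ k))"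
    proof (intro suminf_le)
      fix k
      have "ennreal (?c k) * emeasure lborel (?A k) \<le> ennreal (?c k) * ennreal (V * (R / 2 ^ k) powr Q)"
        using R by (intro mult_left_mono V) auto
      also have "\<dots> = ennreal (?c k * (V * (R / 2 ^ k) powr Q))"
        using V by (simp add: ennreal_mult)
      also have "?c k * (V * (R / 2 ^ k) powr Q) = V * 2 powr b * R powr (Q - b) * q ^ k"
      proof -
        have e1: "R / 2 ^ Suc k = (R / 2 ^ k) / 2" by simp
        have "?c k = 2 powr b * (R / 2 ^ k) powr (- b)"
          unfolding e1 using R by (subst powr_divide) (auto simp: powr_minus field_simps)
        moreover have "(R / 2 ^ k) powr (- b) * (R / 2 ^ k) powr Q = (R / 2 ^ k) powr (Q - b)"
          by (simp flip: powr_add)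
        moreover have "(R / 2 ^ k) powr (Q - b) = R powr (Q - b) * q ^ k"
        proof -
          have "q ^ k = (2 ^ k) powr (- (Q - b))"
            unfolding q_def
            by (simp add: powr_powr mult.commute flip: powr_realpow)
          hence "q ^ k = inverse ((2 ^ k) powr (Q - b))" by (simp only: powr_minus)
          moreover have "(R / 2 ^ k) powr (Q - b) = R powr (Q - b) / (2 ^ k) powr (Q - b)"
            using R by (simp add: powr_divide)
          ultimately show ?thesis by (simp add: divide_inverse)
        qed
        ultimately show ?thesis by (simp add: mult.assoc mult.left_commute)
      qed
      finally show "ennreal (?c k) * emeasure lborel (?A k) \<le> ennreal (V * 2 powr b * R powr (Q - b) * q ^ k)" .
    qed auto
    also have "\<dots> = ennreal (\<Sum>k. V * 2 powr b * R powr (Q - b) * q ^ k)"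
      using V q by (intro suminf_ennreal2 summable_mult summable_geometric) auto
    also have "(\<Sum>k. V * 2 powr b * R powr (Q - b) * q ^ k) = C * R powr (Q - b)"
      using q by (subst suminf_mult) (auto simp: suminf_geometric C_def)
    finally show ?thesis .
  qed
  ultimately show ?thesis using that unfolding Q_def by blast
qed

lemma nn_integral_pnorm_shift:
  fixes z :: "'a::euclidean_space \<times> real"
  shows "(\<integral>\<^sup>+ q. indicator {q. pnorm (z - q) < R} q * ennreal (pnorm (z - q) powr (- b)) \<partial>lborel)
       = (\<integral>\<^sup>+ p. indicator {p :: 'a \<times> real. pnorm p < R} p * ennreal (pnorm p powr (- b)) \<partial>lborel)"
proof -
  have "(\<integral>\<^sup>+ p. indicator {p :: 'a \<times> real. pnorm p < R} p * ennreal (pnorm p powr (- b)) \<partial>lborel)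
     = (\<integral>\<^sup>+ p. indicator {p :: 'a \<times> real. pnorm p < R} p * ennreal (pnorm p powr (- b))
          \<partial>distr lborel borel (\<lambda>q. - z + q))"
    by (subst lborel_distr_plus) simp
  also have "\<dots> = (\<integral>\<^sup>+ q. indicator {p. pnorm p < R} (- z + q) * ennreal (pnorm (- z + q) powr (- b)) \<partial>lborel)"
    by (subst nn_integral_distr) measurable
  also have "\<dots> = (\<integral>\<^sup>+ q. indicator {q. pnorm (z - q) < R} q * ennreal (pnorm (z - q) powr (- b)) \<partial>lborel)"
    by (intro nn_integral_cong) (simp add: indicator_def pnorm_minus_commute[of z])
  finally show ?thesis ..
qed

subsection \<open>Green's identity\<close>

text \<open>Translation invariance of Lebesgue measure makes every difference quotient of a
  compactly supported function integrate to zero, and dominated convergence carries this over to the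
  derivative.\<close>

lemma set_integral_directional_derivative_zero:
  fixes w :: "'a::euclidean_space \<Rightarrow> real"
  assumes der: "\<And>x. (w has_derivative W x) (at x)"
    and cont: "continuous_on UNIV (\<lambda>x. W x b)"
    and supp: "\<And>x. R < norm x \<Longrightarrow> w x = 0"
    and supp': "\<And>x. R < norm x \<Longrightarrow> W x b = 0"
  shows "(LINT x:cball 0 R|lborel. W x b) = 0"
proof -
  have wcont: "continuous_on UNIV w"
    using der has_derivative_continuous continuous_at_imp_continuous_on by blast
  have [measurable]: "w \<in> borel_measurable borel" "(\<lambda>x. W x b) \<in> borel_measurable borel"
    using wcont cont by (auto intro: borel_measurable_continuous_onI)
  have "bounded ((\<lambda>x. W x b) ` cball 0 R)"
    by (intro compact_imp_bounded compact_continuous_image continuous_on_subset[OF cont]) auto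
  then obtain M0 where M0: "\<And>x. x \<in> cball 0 R \<Longrightarrow> \<bar>W x b\<bar> \<le> M0"
    unfolding bounded_iff by force
  define M where "M = max M0 0"
  have M: "\<bar>W x b\<bar> \<le> M" for x
    using M0[of x] supp'[of x] by (cases "R < norm x") (auto simp: M_def)
  have "0 \<le> M" by (simp add: M_def)
  have line: "((\<lambda>s. w (x + s *\<^sub>R b)) has_real_derivative W (x + s *\<^sub>R b) b) (at s)" for x s
  proof -
    have "((\<lambda>s. w (x + s *\<^sub>R b)) has_derivative (\<lambda>h. W (x + s *\<^sub>R b) (h *\<^sub>R b))) (at s)"
      by (rule has_derivative_compose[where f="\<lambda>s. x + s *\<^sub>R b" and g=w])
         (auto intro!: derivative_eq_intros der)
    moreover have "W (x + s *\<^sub>R b) (h *\<^sub>R b) = W (x + s *\<^sub>R b) b * h" for h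
      using linear_scale[OF has_derivative_linear[OF der]] by simp
    ultimately show ?thesis by (simp add: has_field_derivative_def)
  qed
  define h where "h k = inverse (real (Suc k))" for k
  have h: "0 < h k" "h k \<le> 1" for k
    unfolding h_def by (auto simp: inverse_le_1_iff)
  have hlim: "h \<longlonglongrightarrow> 0" unfolding h_def by (rule LIMSEQ_inverse_real_of_nat)
  define d where "d k x = (w (x + h k *\<^sub>R b) - w x) / h k" for k x
  have lim: "(\<lambda>k. d k x) \<longlonglongrightarrow> W x b" for x
  proof -
    have "((\<lambda>s. (w (x + s *\<^sub>R b) - w x) / s) \<longlongrightarrow> W x b) (at 0)"
      using line[of x 0] by (simp add: has_field_derivative_iff)
    moreover have "filterlim h (at 0) sequentially"
      using hlim h by (auto simp: filterlim_at intro!: always_eventually) (metis less_irrefl)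
    ultimately show ?thesis unfolding d_def by (rule filterlim_compose)
  qed
  \<comment> \<open>Since \<open>h k \<le> 1\<close>, all quotients vanish outside one common ball
    of radius \<open>R + norm b\<close>; inside it the mean value theorem supplies the bound
    \<open>M\<close>.\<close>
  have bd: "norm (d k x) \<le> M * indicator (cball 0 (R + norm b)) x" for k x
  proof (cases "R + norm b < norm x")
    case True
    have "norm x \<le> norm (x + h k *\<^sub>R b) + norm (h k *\<^sub>R b)"
      by (metis add_diff_cancel_right' norm_triangle_ineq4)
    moreover have "norm (h k *\<^sub>R b) \<le> norm b" using h[of k] by (simp add: mult_left_le_one_le)
    ultimately have "R < norm (x + h k *\<^sub>R b)" using True by linarith
    moreover have "R < norm x" using True norm_ge_zero[of b] by linarith
    ultimately have "d k x = 0" by (simp add: d_def supp)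
    thus ?thesis using \<open>0 \<le> M\<close> by simp
  next
    case False
    obtain z where z: "w (x + h k *\<^sub>R b) - w (x + 0 *\<^sub>R b) = (h k - 0) * W (x + z *\<^sub>R b) b"
      using MVT2[of 0 "h k" "\<lambda>s. w (x + s *\<^sub>R b)" "\<lambda>s. W (x + s *\<^sub>R b) b"] line h[of k] by blast
    hence "d k x = W (x + z *\<^sub>R b) b" using h[of k] by (simp add: d_def)
    thus ?thesis using M False by (simp add: indicator_def)
  qed
  have wint: "integrable lborel w"
  proof -
    have "integrable lborel (\<lambda>x. indicator (cball 0 R) x *\<^sub>R w x)"
      by (intro borel_integrable_compact continuous_on_subset[OF wcont]) auto
    moreover have "(\<lambda>x. indicator (cball 0 R) x *\<^sub>R w x) = w"
      using supp by (fastforce simp: indicator_def)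
    ultimately show ?thesis by simp
  qed
  have dzero: "integral\<^sup>L lborel (d k) = 0" for k
  proof -
    have i: "integrable lborel (\<lambda>x. w (h k *\<^sub>R b + x))"
      using wint integrable_distr_eq[of "\<lambda>x. h k *\<^sub>R b + x" lborel borel w] by (simp add: lborel_distr_plus)
    have e: "integral\<^sup>L lborel (\<lambda>x. w (h k *\<^sub>R b + x)) = integral\<^sup>L lborel w"
      using integral_distr[of "\<lambda>x. h k *\<^sub>R b + x" lborel borel w] by (simp add: lborel_distr_plus)
    have "integral\<^sup>L lborel (d k) = integral\<^sup>L lborel (\<lambda>x. (w (h k *\<^sub>R b + x) - w x) / h k)"
      by (intro Bochner_Integration.integral_cong) (simp_all add: d_def add.commute)
    also have "\<dots> = (integral\<^sup>L lborel (\<lambda>x. w (h k *\<^sub>R b + x)) - integral\<^sup>L lborel w) / h k"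
      using i wint by simp
    finally show ?thesis by (simp add: e)
  qed
  have "(\<lambda>k. integral\<^sup>L lborel (d k)) \<longlonglongrightarrow> integral\<^sup>L lborel (\<lambda>x. W x b)"
  proof (rule integral_dominated_convergence)
    show "integrable lborel (\<lambda>x. M * indicator (cball (0::'a) (R + norm b)) x :: real)"
      by (intro integrable_mult_right integrable_real_indicator) (use emeasure_lborel_cball_finite[of "0::'a" "R + norm b"] in \<open>simp_all add: less_top\<close>)
    show "d k \<in> borel_measurable lborel" for k unfolding d_def by measurable
  qed (use bd lim in auto)
  hence "integral\<^sup>L lborel (\<lambda>x. W x b) = 0"
    by (simp add: dzero LIMSEQ_const_iff)
  moreover have "(\<lambda>x. indicator (cball 0 R) x *\<^sub>R W x b) = (\<lambda>x. W x b)"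
    using supp' by (fastforce simp: indicator_def)
  ultimately show ?thesis by (simp add: set_lebesgue_integral_def)
qed

lemma C21_onD:
  assumes "C21_on S u ut g H" "(x, t) \<in> S"
  shows "((\<lambda>s. u x s) has_real_derivative ut x t) (at t)"
    "((\<lambda>y. u y t) has_derivative (\<lambda>h. g x t \<bullet> h)) (at x)"
    "((\<lambda>y. g y t) has_derivative H x t) (at x)"
  using assms unfolding C21_on_def by blast+

lemma C21_on_continuous:
  assumes "C21_on S u ut g H"
  shows "continuous_on S (\<lambda>p. u (fst p) (snd p))"
    "continuous_on S (\<lambda>p. ut (fst p) (snd p))"
    "continuous_on S (\<lambda>p. g (fst p) (snd p))"
    "continuous_on S (\<lambda>p. laplacian H (fst p) (snd p))"
    "\<And>i j. i \<in> Basis \<Longrightarrow> j \<in> Basis \<Longrightarrow> continuous_on S (\<lambda>p. H (fst p) (snd p) i \<bullet> j)"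
  using assms unfolding C21_on_def laplacian_def by (auto intro!: continuous_on_sum)

lemma continuous_on_slice:
  assumes "continuous_on (UNIV \<times> T) (\<lambda>p. f (fst p) (snd p))" "t \<in> T"
  shows "continuous_on UNIV (\<lambda>y. f y t)"
proof -
  have "continuous_on UNIV (\<lambda>y. (\<lambda>p. f (fst p) (snd p)) (y, t))"
    using assms by (intro continuous_on_compose2[OF assms(1)] continuous_intros) auto
  thus ?thesis by simp
qed

text \<open>The integrand is the divergence of the field \<open>u * gphi - phi * g\<close>, whose
  components are compactly supported, so each summand of the divergence integrates to zero by
  \<open>set_integral_directional_derivative_zero\<close>.\<close>

lemma green_space:
  fixes u ut phi phit :: "'a::euclidean_space \<Rightarrow> real \<Rightarrow> real"
  assumes u: "C21_on (UNIV \<times> T) u ut g H"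
    and phi: "C21_on (UNIV \<times> T) phi phit gphi Hphi"
    and t: "t \<in> T"
    and supp: "\<And>y. R < norm y \<Longrightarrow> phi y t = 0 \<and> gphi y t = 0 \<and> Hphi y t = (\<lambda>_. 0)"
  shows "(LINT y:cball 0 R|lborel. u y t * laplacian Hphi y t - phi y t * laplacian H y t) = 0"
proof -
  have uD: "((\<lambda>y. u y t) has_derivative (\<lambda>h. g x t \<bullet> h)) (at x)"
       "((\<lambda>y. g y t) has_derivative H x t) (at x)"
       "((\<lambda>y. phi y t) has_derivative (\<lambda>h. gphi x t \<bullet> h)) (at x)"
       "((\<lambda>y. gphi y t) has_derivative Hphi x t) (at x)" for x
    using C21_onD[OF u] C21_onD[OF phi] t by auto
  \<comment> \<open>\<open>W b y\<close> is the full derivative at \<open>y\<close> of the component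
    of that field along \<open>b\<close>. In the direction \<open>b\<close> itself the two products
    of gradients cancel, which leaves the second derivatives recorded in \<open>Wb\<close>.\<close>
  define W where "W b y k = ((g y t \<bullet> k) * (gphi y t \<bullet> b) + u y t * (Hphi y t k \<bullet> b))
       - ((gphi y t \<bullet> k) * (g y t \<bullet> b) + phi y t * (H y t k \<bullet> b))" for b y k
  have Wb: "W b y b = u y t * (Hphi y t b \<bullet> b) - phi y t * (H y t b \<bullet> b)" for b y
    by (simp add: W_def)
  have c1: "continuous_on UNIV (\<lambda>y. u y t)" "continuous_on UNIV (\<lambda>y. phi y t)"
    using C21_on_continuous(1)[OF u, THEN continuous_on_slice] C21_on_continuous(1)[OF phi, THEN continuous_on_slice] t
    by auto
  have c2: "continuous_on UNIV (\<lambda>y. H y t b \<bullet> b)" "continuous_on UNIV (\<lambda>y. Hphi y t b \<bullet> b)" if "b \<in> Basis" for b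
    using continuous_on_slice[of T "\<lambda>y t. H y t b \<bullet> b" t, OF C21_on_continuous(5)[OF u that that] t]
      continuous_on_slice[of T "\<lambda>y t. Hphi y t b \<bullet> b" t, OF C21_on_continuous(5)[OF phi that that] t] .
  have cW: "continuous_on UNIV (\<lambda>y. W b y b)" if "b \<in> Basis" for b
    unfolding Wb by (intro continuous_on_diff continuous_on_mult c1 c2[OF that])
  have z: "(LINT y:cball 0 R|lborel. W b y b) = 0" if b: "b \<in> Basis" for b
  proof (rule set_integral_directional_derivative_zero[where w="\<lambda>y. u y t * (gphi y t \<bullet> b) - phi y t * (g y t \<bullet> b)" and W="W b" and b=b])
    show "((\<lambda>y. u y t * (gphi y t \<bullet> b) - phi y t * (g y t \<bullet> b)) has_derivative W b x) (at x)" for x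
      unfolding W_def
      by (rule has_derivative_eq_rhs, (rule derivative_intros uD)+) (auto simp: fun_eq_iff algebra_simps)
    show "continuous_on UNIV (\<lambda>x. W b x b)" by (rule cW[OF b])
    show "R < norm x \<Longrightarrow> u x t * (gphi x t \<bullet> b) - phi x t * (g x t \<bullet> b) = 0" for x
      using supp by simp
    show "R < norm x \<Longrightarrow> W b x b = 0" for x
      using supp by (simp add: Wb)
  qed
  have "(LINT y:cball 0 R|lborel. u y t * laplacian Hphi y t - phi y t * laplacian H y t)
      = (LINT y:cball 0 R|lborel. \<Sum>b\<in>Basis. W b y b)"
    by (simp add: laplacian_def Wb sum_distrib_left sum_subtractf)
  also have "\<dots> = (\<Sum>b\<in>Basis. LINT y:cball 0 R|lborel. W b y b)"
    unfolding set_lebesgue_integral_def scaleR_sum_right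
    by (intro Bochner_Integration.integral_sum borel_integrable_compact continuous_on_subset[OF cW]) auto
  also have "\<dots> = 0" by (simp add: z)
  finally show ?thesis .
qed

lemma set_integrable_compact_continuous:
  fixes f :: "'b::euclidean_space \<Rightarrow> real"
  assumes "compact S" "continuous_on S f"
  shows "set_integrable lborel S f"
  unfolding set_integrable_def by (intro borel_integrable_compact assms)

lemma set_integral_Times_fst:
  fixes f :: "'a::euclidean_space \<times> 'b::euclidean_space \<Rightarrow> real"
  assumes "set_integrable lborel (A \<times> B) f"
  shows "(LINT p:(A \<times> B)|lborel. f p) = (LINT y:A|lborel. LINT s:B|lborel. f (y, s))"
proof -
  have "(LINT p:(A \<times> B)|lborel. f p) = integral\<^sup>L (lborel \<Otimes>\<^sub>M lborel) (\<lambda>p. indicator (A \<times> B) p *\<^sub>R f p)"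
    by (simp add: set_lebesgue_integral_def lborel_prod)
  also have "\<dots> = (LINT y|lborel. LINT s|lborel. indicator (A \<times> B) (y, s) *\<^sub>R f (y, s))"
    using assms by (subst lborel_pair.integral_fst') (auto simp: set_integrable_def lborel_prod)
  also have "\<dots> = (LINT y:A|lborel. LINT s:B|lborel. f (y, s))"
    by (simp add: set_lebesgue_integral_def indicator_times mult.assoc)
  finally show ?thesis .
qed

lemma set_integral_Times_snd:
  fixes f :: "'a::euclidean_space \<times> 'b::euclidean_space \<Rightarrow> real"
  assumes "set_integrable lborel (A \<times> B) f"
  shows "(LINT p:(A \<times> B)|lborel. f p) = (LINT s:B|lborel. LINT y:A|lborel. f (y, s))"
proof -
  have "(LINT p:(A \<times> B)|lborel. f p) = integral\<^sup>L (lborel \<Otimes>\<^sub>M lborel) (\<lambda>p. indicator (A \<times> B) p *\<^sub>R f p)"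
    by (simp add: set_lebesgue_integral_def lborel_prod)
  also have "\<dots> = (LINT s|lborel. LINT y|lborel. indicator (A \<times> B) (y, s) *\<^sub>R f (y, s))"
    using assms lborel_pair.integral_snd[of "\<lambda>y s. indicator (A \<times> B) (y, s) *\<^sub>R f (y, s)"]
    by (simp add: set_integrable_def lborel_prod case_prod_unfold)
  also have "\<dots> = (LINT s:B|lborel. LINT y:A|lborel. f (y, s))"
  proof -
    have "indicator (A \<times> B) (y, s) *\<^sub>R f (y, s) = indicator B s * (indicator A y * f (y, s))" for y s
      by (simp add: indicator_times)
    thus ?thesis unfolding set_lebesgue_integral_def by (simp only: real_scaleR_def integral_mult_right_zero)
  qed
  finally show ?thesis .
qed

text \<open>The fundamental theorem of calculus on each time line integrates the time derivative of
  \<open>u * phi\<close>. Adding the vanishing spatial identity of each slice turns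
  \<open>ut\<close> into the source and \<open>phit\<close> into the backward heat operator applied
  to \<open>phi\<close>. The mass bound and the representation bound are this identity for two
  choices of \<open>phi\<close>.\<close>

lemma green_space_time:
  fixes u ut phi phit :: "'a::euclidean_space \<Rightarrow> real \<Rightarrow> real"
  assumes u: "C21_on (UNIV \<times> T) u ut g H"
    and phi: "C21_on (UNIV \<times> T) phi phit gphi Hphi"
    and t: "{t1..t2} \<subseteq> T" "t1 \<le> t2"
    and supp: "\<And>y t. R < norm y \<Longrightarrow> t \<in> T \<Longrightarrow> phi y t = 0 \<and> gphi y t = 0 \<and> Hphi y t = (\<lambda>_. 0)"
  shows "(LINT y:cball 0 R|lborel. u y t2 * phi y t2) - (LINT y:cball 0 R|lborel. u y t1 * phi y t1)
    = (LINT p:(cball 0 R \<times> {t1..t2})|lborel. phi (fst p) (snd p) * (ut (fst p) (snd p) - laplacian H (fst p) (snd p))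
        + u (fst p) (snd p) * (phit (fst p) (snd p) + laplacian Hphi (fst p) (snd p)))"
proof -
  let ?K = "cball (0::'a) R" and ?J = "{t1..t2}"
  let ?E = "\<lambda>p. ut (fst p) (snd p) * phi (fst p) (snd p) + u (fst p) (snd p) * phit (fst p) (snd p)"
  let ?L = "\<lambda>p. u (fst p) (snd p) * laplacian Hphi (fst p) (snd p) - phi (fst p) (snd p) * laplacian H (fst p) (snd p)"
  have sub: "?K \<times> ?J \<subseteq> UNIV \<times> T" using t by auto
  have cE: "continuous_on (UNIV \<times> T) ?E" and cL: "continuous_on (UNIV \<times> T) ?L"
    using C21_on_continuous[OF u] C21_on_continuous[OF phi] by (auto intro!: continuous_intros)
  have iE: "set_integrable lborel (?K \<times> ?J) ?E" and iL: "set_integrable lborel (?K \<times> ?J) ?L"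
    by (intro set_integrable_compact_continuous compact_Times continuous_on_subset[OF cE sub] continuous_on_subset[OF cL sub]; simp)+
  have L0: "(LINT p:(?K \<times> ?J)|lborel. ?L p) = 0"
  proof -
    have "(LINT p:(?K \<times> ?J)|lborel. ?L p) = (LINT s:?J|lborel. LINT y:?K|lborel. ?L (y, s))"
      by (rule set_integral_Times_snd[OF iL])
    also have "\<dots> = (LINT s:?J|lborel. 0)"
      using t green_space[OF u phi _ supp, simplified]
      by (intro set_lebesgue_integral_cong) (auto simp: subset_iff)
    finally show ?thesis by simp
  qed
  have "(LINT p:(?K \<times> ?J)|lborel. ?E p) = (LINT y:?K|lborel. LINT s:?J|lborel. ?E (y, s))"
    by (rule set_integral_Times_fst[OF iE])
  also have "\<dots> = (LINT y:?K|lborel. u y t2 * phi y t2 - u y t1 * phi y t1)"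
  proof (intro set_lebesgue_integral_cong allI impI)
    fix y assume "y \<in> ?K"
    have "(LINT s|lborel. indicator ?J s *\<^sub>R (ut y s * phi y s + u y s * phit y s))
        = u y t2 * phi y t2 - u y t1 * phi y t1"
    proof (rule integral_FTC_Icc)
      show "continuous_on ?J (\<lambda>s. ut y s * phi y s + u y s * phit y s)"
      proof -
        have "continuous_on ?J (\<lambda>s. ?E (y, s))"
          using t by (intro continuous_on_compose2[OF cE] continuous_intros) auto
        thus ?thesis by simp
      qed
      show "((\<lambda>s. u y s * phi y s) has_vector_derivative ut y s * phi y s + u y s * phit y s) (at s within ?J)"
        if "t1 \<le> s" "s \<le> t2" for s
      proof -
        have "(y, s) \<in> UNIV \<times> T" using that t by auto
        thus ?thesis
          using DERIV_mult[OF C21_onD(1)[OF u] C21_onD(1)[OF phi]]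
          by (auto simp: has_real_derivative_iff_has_vector_derivative[symmetric] algebra_simps intro: DERIV_subset)
      qed
    qed (rule t)
    thus "(LINT s:?J|lborel. ?E (y, s)) = u y t2 * phi y t2 - u y t1 * phi y t1"
      by (simp add: set_lebesgue_integral_def)
  qed auto
  also have "\<dots> = (LINT y:?K|lborel. u y t2 * phi y t2) - (LINT y:?K|lborel. u y t1 * phi y t1)"
  proof -
    have "continuous_on UNIV (\<lambda>y. u y s * phi y s)" if "s \<in> T" for s
      using C21_on_continuous(1)[OF u, THEN continuous_on_slice, OF that]
        C21_on_continuous(1)[OF phi, THEN continuous_on_slice, OF that] by (intro continuous_intros)
    thus ?thesis using t
      by (intro set_integral_diff set_integrable_compact_continuous continuous_on_subset[of UNIV _ ?K]) (auto simp: subset_iff)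
  qed
  finally have "(LINT y:?K|lborel. u y t2 * phi y t2) - (LINT y:?K|lborel. u y t1 * phi y t1)
     = (LINT p:(?K \<times> ?J)|lborel. ?E p) + (LINT p:(?K \<times> ?J)|lborel. ?L p)" by (simp add: L0)
  also have "\<dots> = (LINT p:(?K \<times> ?J)|lborel. ?E p + ?L p)"
    by (intro set_integral_add(2)[symmetric] iE iL)
  also have "\<dots> = (LINT p:(?K \<times> ?J)|lborel. phi (fst p) (snd p) * (ut (fst p) (snd p) - laplacian H (fst p) (snd p))
        + u (fst p) (snd p) * (phit (fst p) (snd p) + laplacian Hphi (fst p) (snd p)))"
    by (simp add: algebra_simps)
  finally show ?thesis .
qed

subsection \<open>Test functions\<close>

lemma C21_on_mult:
  assumes u: "C21_on S u ut g H" and v: "C21_on S v vt k L"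
  shows "C21_on S (\<lambda>x t. u x t * v x t) (\<lambda>x t. ut x t * v x t + u x t * vt x t)
     (\<lambda>x t. u x t *\<^sub>R k x t + v x t *\<^sub>R g x t)
     (\<lambda>x t h. (u x t *\<^sub>R L x t h + (g x t \<bullet> h) *\<^sub>R k x t) + (v x t *\<^sub>R H x t h + (k x t \<bullet> h) *\<^sub>R g x t))"
    (is "C21_on S ?w ?wt ?G ?HH")
proof -
  note cu = C21_on_continuous[OF u] and cv = C21_on_continuous[OF v]
  have "((\<lambda>s. ?w x s) has_real_derivative ?wt x t) (at t) \<and>
        ((\<lambda>y. ?w y t) has_derivative (\<lambda>h. ?G x t \<bullet> h)) (at x) \<and>
        ((\<lambda>y. ?G y t) has_derivative ?HH x t) (at x)" if p: "(x, t) \<in> S" for x t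
  proof (intro conjI)
    note du = C21_onD[OF u p] and dv = C21_onD[OF v p]
    show "((\<lambda>s. ?w x s) has_real_derivative ?wt x t) (at t)"
      using DERIV_mult[OF du(1) dv(1)] by (simp add: algebra_simps)
    show "((\<lambda>y. ?w y t) has_derivative (\<lambda>h. ?G x t \<bullet> h)) (at x)"
      by (rule has_derivative_eq_rhs[OF has_derivative_mult[OF du(2) dv(2)]])
        (simp add: fun_eq_iff inner_add_left algebra_simps)
    show "((\<lambda>y. ?G y t) has_derivative ?HH x t) (at x)"
      by (rule has_derivative_eq_rhs[OF has_derivative_add[OF has_derivative_scaleR[OF du(2) dv(3)] has_derivative_scaleR[OF dv(2) du(3)]]])
        (simp add: fun_eq_iff)
  qed
  moreover have "continuous_on S (\<lambda>p. ?HH (fst p) (snd p) i \<bullet> j)" if "i \<in> Basis" "j \<in> Basis" for i j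
    unfolding inner_add_left inner_scaleR_left
    by (intro continuous_on_add continuous_on_mult continuous_on_inner continuous_on_const cu cv that)
  moreover have "continuous_on S (\<lambda>p. ?w (fst p) (snd p))" "continuous_on S (\<lambda>p. ?wt (fst p) (snd p))"
      "continuous_on S (\<lambda>p. ?G (fst p) (snd p))"
    using cu cv by (auto intro!: continuous_intros)
  ultimately show ?thesis unfolding C21_on_def by blast
qed

lemma laplacian_mult:
  fixes u v :: "'a::euclidean_space \<Rightarrow> real \<Rightarrow> real"
  shows "laplacian (\<lambda>x t h. (u x t *\<^sub>R L x t h + (g x t \<bullet> h) *\<^sub>R k x t) + (v x t *\<^sub>R H x t h + (k x t \<bullet> h) *\<^sub>R g x t)) x t
     = u x t * laplacian L x t + 2 * (g x t \<bullet> k x t) + v x t * laplacian H x t"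
proof -
  have "(\<Sum>b\<in>Basis. (y \<bullet> b) * (z \<bullet> b)) = y \<bullet> z" for y z :: 'a
    by (rule euclidean_inner[symmetric])
  thus ?thesis unfolding laplacian_def inner_add_left inner_scaleR_left sum.distrib sum_distrib_left[symmetric]
    by (simp add: inner_commute[of "k x t" "g x t"])
qed

text \<open>Profiles are functions of the squared distance rather than the distance, so composition
  stays smooth at the centre and the chain rule gives closed forms for gradient and Hessian.\<close>

lemma C21_on_radial:
  fixes x :: "'a::euclidean_space"
  assumes G: "\<And>w s. s \<in> T \<Longrightarrow> ((\<lambda>w. G w s) has_real_derivative G1 w s) (at w)"
    and G1: "\<And>w s. s \<in> T \<Longrightarrow> ((\<lambda>w. G1 w s) has_real_derivative G2 w s) (at w)"
    and Gs: "\<And>w s. s \<in> T \<Longrightarrow> ((\<lambda>s. G w s) has_real_derivative Gs w s) (at s)"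
    and cont: "continuous_on (UNIV \<times> T) (\<lambda>p. G (fst p) (snd p))"
      "continuous_on (UNIV \<times> T) (\<lambda>p. Gs (fst p) (snd p))"
      "continuous_on (UNIV \<times> T) (\<lambda>p. G1 (fst p) (snd p))"
      "continuous_on (UNIV \<times> T) (\<lambda>p. G2 (fst p) (snd p))"
  shows "C21_on (UNIV \<times> T) (\<lambda>y s. G ((y - x) \<bullet> (y - x)) s) (\<lambda>y s. Gs ((y - x) \<bullet> (y - x)) s)
     (\<lambda>y s. (2 * G1 ((y - x) \<bullet> (y - x)) s) *\<^sub>R (y - x))
     (\<lambda>y s h. (2 * G1 ((y - x) \<bullet> (y - x)) s) *\<^sub>R h + (4 * G2 ((y - x) \<bullet> (y - x)) s * ((y - x) \<bullet> h)) *\<^sub>R (y - x))"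
proof -
  have comp: "((\<lambda>y. F ((y - x) \<bullet> (y - x))) has_derivative (\<lambda>h. F' * (2 * ((y - x) \<bullet> h)))) (at y)"
    if "(F has_real_derivative F') (at ((y - x) \<bullet> (y - x)))" for F :: "real \<Rightarrow> real" and F' y
  proof -
    have i: "((\<lambda>y. (y - x) \<bullet> (y - x)) has_derivative (\<lambda>h. 2 * ((y - x) \<bullet> h))) (at y)"
      by (auto intro!: derivative_eq_intros simp: inner_commute)
    show ?thesis
      using has_derivative_compose[OF i, of F "(*) F'"] that by (simp add: has_field_derivative_def)
  qed
  have c: "continuous_on (UNIV \<times> T) (\<lambda>p. F ((fst p - x) \<bullet> (fst p - x)) (snd p))"
    if "continuous_on (UNIV \<times> T) (\<lambda>p. F (fst p) (snd p))" for F :: "real \<Rightarrow> real \<Rightarrow> real"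
  proof -
    have "continuous_on (UNIV \<times> T) (\<lambda>p. (\<lambda>p. F (fst p) (snd p)) ((fst p - x) \<bullet> (fst p - x), snd p))"
      by (rule continuous_on_compose2[OF that]) (auto intro!: continuous_intros)
    thus ?thesis by simp
  qed
  note cc = cont[THEN c]
  show ?thesis unfolding C21_on_def
  proof (intro conjI allI impI ballI)
    fix y s assume "(y, s) \<in> (UNIV :: 'a set) \<times> T" hence s: "s \<in> T" by auto
    show "((\<lambda>s. G ((y - x) \<bullet> (y - x)) s) has_real_derivative Gs ((y - x) \<bullet> (y - x)) s) (at s)"
      by (rule Gs[OF s])
    show "((\<lambda>y. G ((y - x) \<bullet> (y - x)) s) has_derivative (\<lambda>h. ((2 * G1 ((y - x) \<bullet> (y - x)) s) *\<^sub>R (y - x)) \<bullet> h)) (at y)"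
      by (rule has_derivative_eq_rhs[OF comp[OF G[OF s]]]) (simp add: fun_eq_iff)
    show "((\<lambda>y. (2 * G1 ((y - x) \<bullet> (y - x)) s) *\<^sub>R (y - x)) has_derivative
        (\<lambda>h. (2 * G1 ((y - x) \<bullet> (y - x)) s) *\<^sub>R h + (4 * G2 ((y - x) \<bullet> (y - x)) s * ((y - x) \<bullet> h)) *\<^sub>R (y - x))) (at y)"
      by (rule has_derivative_eq_rhs[OF has_derivative_scaleR[OF has_derivative_mult_right[OF comp[OF G1[OF s]]]
              has_derivative_diff[OF has_derivative_ident has_derivative_const]]])
         (simp add: fun_eq_iff)
  next
    fix i j :: 'a
    show "continuous_on (UNIV \<times> T) (\<lambda>p. ((2 * G1 ((fst p - x) \<bullet> (fst p - x)) (snd p)) *\<^sub>R i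
       + (4 * G2 ((fst p - x) \<bullet> (fst p - x)) (snd p) * ((fst p - x) \<bullet> i)) *\<^sub>R (fst p - x)) \<bullet> j)"
      by (intro continuous_intros cc)
  qed (intro continuous_intros cc)+
qed

lemma laplacian_radial:
  fixes x :: "'a::euclidean_space"
  shows "laplacian (\<lambda>y s h. (2 * G1 ((y - x) \<bullet> (y - x)) s) *\<^sub>R h + (4 * G2 ((y - x) \<bullet> (y - x)) s * ((y - x) \<bullet> h)) *\<^sub>R (y - x)) y s
   = 2 * real DIM('a) * G1 ((y - x) \<bullet> (y - x)) s + 4 * G2 ((y - x) \<bullet> (y - x)) s * ((y - x) \<bullet> (y - x))"
proof -
  have "(\<Sum>b\<in>Basis. c * (z \<bullet> b) * (z \<bullet> b)) = c * (z \<bullet> z)" for c and z :: 'a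
    by (simp add: euclidean_inner[of z z] sum_distrib_left mult.assoc)
  thus ?thesis
    unfolding laplacian_def inner_add_left inner_scaleR_left sum.distrib by (simp add: inner_same_Basis)
qed

section \<open>Powers of positive parts and the test function for the mass\<close>

lemma DERIV_max_power:
  "((\<lambda>s::real. (max 0 s) ^ Suc (Suc k)) has_real_derivative real (Suc (Suc k)) * (max 0 s) ^ Suc k) (at s)"
proof -
  consider "s > 0" | "s < 0" | "s = 0" by linarith
  thus ?thesis
  proof cases
    case 1
    have "((\<lambda>s::real. s ^ Suc (Suc k)) has_real_derivative real (Suc (Suc k)) * (max 0 s) ^ Suc k) (at s)"
      using 1 DERIV_pow[of "Suc (Suc k)" s UNIV] by (simp add: max_def)
    moreover have "eventually (\<lambda>s::real. s ^ Suc (Suc k) = (max 0 s) ^ Suc (Suc k)) (nhds s)"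
      using eventually_nhds_in_open[of "{0<..}" s] 1 by (auto elim: eventually_mono)
    ultimately show ?thesis by (rule DERIV_cong_ev[OF refl _ refl, THEN iffD1, rotated])
  next
    case 2
    have "((\<lambda>s::real. 0) has_real_derivative real (Suc (Suc k)) * (max 0 s) ^ Suc k) (at s)"
      using 2 by (simp add: max_def)
    moreover have "eventually (\<lambda>s::real. 0 = (max 0 s) ^ Suc (Suc k)) (nhds s)"
      using eventually_nhds_in_open[of "{..<0}" s] 2 by (auto elim: eventually_mono simp: max_def)
    ultimately show ?thesis by (rule DERIV_cong_ev[OF refl _ refl, THEN iffD1, rotated])
  next
    case 3
    have "((\<lambda>h::real. (max 0 h) ^ Suc (Suc k) / h) \<longlongrightarrow> 0) (at 0)"
    proof (rule tendsto_0_le[where K=1])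
      show "((\<lambda>h::real. h ^ Suc k) \<longlongrightarrow> 0) (at 0)" by (auto intro!: tendsto_eq_intros)
      have "norm ((max 0 h) ^ Suc (Suc k) / h) \<le> norm (h ^ Suc k) * 1" for h :: real
        by (cases "h > 0") (auto simp: max_def field_simps)
      thus "eventually (\<lambda>h::real. norm ((max 0 h) ^ Suc (Suc k) / h) \<le> norm (h ^ Suc k) * 1) (at 0)" by simp
    qed
    thus ?thesis using 3 by (simp add: has_field_derivative_iff)
  qed
qed

lemma C21_on_subset: "C21_on S u ut g H \<Longrightarrow> T \<subseteq> S \<Longrightarrow> C21_on T u ut g H"
  unfolding C21_on_def by (blast intro: continuous_on_subset)

lemma DERIV_max_square:
  assumes "(f has_real_derivative f') (at x)"
  shows "((\<lambda>x. (max 0 (f x))\<^sup>2) has_real_derivative 2 * max 0 (f x) * f') (at x)"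
  using DERIV_chain2[OF DERIV_max_power[of 0] assms] by (simp add: numeral_2_eq_2)

lemma DERIV_max_cube:
  assumes "(f has_real_derivative f') (at x)"
  shows "((\<lambda>x. (max 0 (f x)) ^ 3) has_real_derivative 3 * (max 0 (f x))\<^sup>2 * f') (at x)"
  using DERIV_chain2[OF DERIV_max_power[of 1] assms] by (simp add: numeral_3_eq_3 numeral_2_eq_2)


text \<open>The function is \<open>exp (n^2 * s) * (max 0 (12 - |y|^2)) ^ 3\<close>. The cube makes
  it C^2 across the edge of its support, and 12 lies between 3^2 and 4^2. The growth in time
  outweighs the negative part of the Laplacian, so the function is a subsolution of the backward
  heat equation. The value on the sphere \<open>norm y = 4\<close> is recorded because the sign of
  the source is given only in the open ball.\<close>

lemma mass_test_function:
  obtains phi phit :: "'a::euclidean_space \<Rightarrow> real \<Rightarrow> real" and gphi Hphi where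
    "C21_on (UNIV \<times> UNIV) phi phit gphi Hphi"
    "\<And>y s. 4 < norm y \<Longrightarrow> phi y s = 0 \<and> gphi y s = 0 \<and> Hphi y s = (\<lambda>_. 0)"
    "\<And>y s. norm y = 4 \<Longrightarrow> phi y s = 0"
    "\<And>y s. 0 \<le> phi y s"
    "\<And>y s. 0 \<le> s \<Longrightarrow> norm y \<le> 3 \<Longrightarrow> 1 \<le> phi y s"
    "\<And>y s. 0 \<le> phit y s + laplacian Hphi y s"
proof -
  define n where "n = real DIM('a)"
  have n: "0 < n" by (simp add: n_def)
  define G where "G w s = exp (n\<^sup>2 * s) * (max 0 (12 - w)) ^ 3" for w s :: real
  define Gs where "Gs w s = n\<^sup>2 * G w s" for w s :: real
  define G1 where "G1 w s = - (exp (n\<^sup>2 * s) * (3 * (max 0 (12 - w))\<^sup>2))" for w s :: real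
  define G2 where "G2 w s = exp (n\<^sup>2 * s) * (6 * max 0 (12 - w))" for w s :: real
  define phi phit :: "'a \<Rightarrow> real \<Rightarrow> real" and gphi Hphi where
    "phi = (\<lambda>y s. G ((y - 0) \<bullet> (y - 0)) s)" and
    "phit = (\<lambda>y s. Gs ((y - 0) \<bullet> (y - 0)) s)" and
    "gphi = (\<lambda>(y::'a) s. (2 * G1 ((y - 0) \<bullet> (y - 0)) s) *\<^sub>R (y - 0))" and
    "Hphi = (\<lambda>(y::'a) s h. (2 * G1 ((y - 0) \<bullet> (y - 0)) s) *\<^sub>R h + (4 * G2 ((y - 0) \<bullet> (y - 0)) s * ((y - 0) \<bullet> h)) *\<^sub>R (y - 0))"
  show ?thesis
  proof
    show "C21_on (UNIV \<times> UNIV) phi phit gphi Hphi"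
      unfolding phi_def phit_def gphi_def Hphi_def
    proof (rule C21_on_radial)
      fix w s :: real
      have d: "((\<lambda>w. 12 - w) has_real_derivative -1) (at w)" by (auto intro!: derivative_eq_intros)
      show "((\<lambda>w. G w s) has_real_derivative G1 w s) (at w)"
        unfolding G_def G1_def using DERIV_cmult[OF DERIV_max_cube[OF d]] by simp
      show "((\<lambda>w. G1 w s) has_real_derivative G2 w s) (at w)"
        unfolding G2_def G1_def using DERIV_cmult[OF DERIV_max_square[OF d], of "- (3 * exp (n\<^sup>2 * s))"]
        by (simp add: algebra_simps)
      show "((\<lambda>s. G w s) has_real_derivative Gs w s) (at s)"
        unfolding G_def Gs_def by (auto intro!: derivative_eq_intros)
    qed (auto simp: G_def G1_def G2_def Gs_def intro!: continuous_intros)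
    have sq: "y \<bullet> y = (norm y)\<^sup>2" for y :: 'a by (simp add: power2_norm_eq_inner)
    show "phi y s = 0 \<and> gphi y s = 0 \<and> Hphi y s = (\<lambda>_. 0)" if "4 < norm y" for y s
    proof -
      have "4\<^sup>2 < (norm y)\<^sup>2" using that by (intro power_strict_mono) auto
      thus ?thesis by (auto simp: phi_def gphi_def Hphi_def G_def G1_def G2_def sq max_def)
    qed
    show "phi y s = 0" if "norm y = 4" for y s
      by (simp add: phi_def G_def sq that)
    show "0 \<le> phi y s" for y s by (simp add: phi_def G_def)
    show "1 \<le> phi y s" if "0 \<le> s" "norm y \<le> 3" for y s
    proof -
      have "(norm y)\<^sup>2 \<le> 3\<^sup>2" using that by (intro power_mono) auto
      hence "1 \<le> max 0 (12 - (norm y)\<^sup>2)" by simp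
      moreover have "1 \<le> exp (n\<^sup>2 * s)" using that by simp
      ultimately show ?thesis
        using mult_mono[of 1 "exp (n\<^sup>2 * s)" 1 "max 0 (12 - (norm y)\<^sup>2) ^ 3"] one_le_power[of "max 0 (12 - (norm y)\<^sup>2)" 3]
        by (simp add: phi_def G_def sq)
    qed
    show "0 \<le> phit y s + laplacian Hphi y s" for y s
    proof -
      define w where "w = y \<bullet> y"
      define v where "v = max 0 (12 - w)"
      have w0: "0 \<le> w" by (simp add: w_def)
      have lap: "laplacian Hphi y s = 2 * n * G1 w s + 4 * G2 w s * w"
        unfolding Hphi_def laplacian_radial n_def by (simp add: w_def)
      have "phit y s + laplacian Hphi y s = exp (n\<^sup>2 * s) * (v * (n\<^sup>2 * v\<^sup>2 - 6 * n * v + 24 * w))"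
        unfolding lap by (simp add: phit_def Gs_def G_def G1_def G2_def w_def[symmetric] v_def[symmetric])
          (simp add: algebra_simps power2_eq_square power3_eq_cube)
      moreover have "0 \<le> v * (n\<^sup>2 * v\<^sup>2 - 6 * n * v + 24 * w)"
      \<comment> \<open>The bracket equals \<open>(n * v - 3)^2 + 24 * w - 9\<close>, which settles
        \<open>w > 1\<close>. For \<open>w \<le> 1\<close> one has \<open>v \<ge> 11\<close>, hence
        \<open>n * v \<ge> 6\<close>, and the first two terms of the bracket are already nonnegative
        together.\<close>
      proof (cases "w \<le> 1")
        case True
        hence v: "v \<ge> 11" by (simp add: v_def)
        have n1: "1 \<le> n" by (simp add: n_def Suc_leI)
        have "6 * (n * v) \<le> (n * v) * (n * v)" using v n1 mult_mono[of 1 n 6 v] by (intro mult_right_mono) auto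
        thus ?thesis using v w0 by (intro mult_nonneg_nonneg) (auto simp: power2_eq_square algebra_simps)
      next
        case False
        have "0 \<le> (n * v - 3)\<^sup>2" by simp
        hence "0 \<le> n\<^sup>2 * v\<^sup>2 - 6 * n * v + 9" by (simp add: power2_eq_square algebra_simps)
        thus ?thesis using False by (intro mult_nonneg_nonneg) (auto simp: v_def)
      qed
      ultimately show ?thesis by simp
    qed
  qed
qed

text \<open>Away from the spatial pole the Gaussian beats every negative power of \<open>t\<close>,
  uniformly as \<open>t\<close> tends to 0. The quotient by \<open>t\<close> is included because it
  governs the gradient of the kernel. The distance 2/5 separates \<open>norm x \<le> 2\<close> from
  the region \<open>norm y \<ge> 12/5\<close> where the cutoff may vary.\<close>

lemma heat_kernel_far_bound:
  obtains C where "0 < C" "\<And>x t. 2/5 \<le> norm (x::'a::euclidean_space) \<Longrightarrow> 0 < t \<Longrightarrow>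
    heat_kernel x t \<le> C \<and> heat_kernel x t / t \<le> C"
proof -
  have *: "\<exists>C>0. \<forall>(x::'a) t. 2/5 \<le> norm x \<longrightarrow> 0 < t \<longrightarrow> t powr (- real N / 2) * exp (- (norm x * norm x) / (4 * t)) \<le> C"
    if N: "1 \<le> N" for N :: nat
  proof (intro exI[of _ "(4 * real N) ^ N * (4/25) powr (- real N / 2)"] conjI allI impI)
    show "0 < (4 * real N) ^ N * (4/25) powr (- real N / 2)" using N by simp
    fix x :: 'a and t :: real assume x: "2/5 \<le> norm x" and t: "0 < t"
    define z where "z = norm x * norm x / t"
    have xx: "4/25 \<le> norm x * norm x" using mult_mono[OF x x] by simp
    have big: "1 \<le> (4 * real N) ^ N" using N by (intro one_le_power) auto
    show "t powr (- real N / 2) * exp (- (norm x * norm x) / (4 * t)) \<le> (4 * real N) ^ N * (4/25) powr (- real N / 2)"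
    proof (cases "1 \<le> z")
      case True
      have "t powr (- real N / 2) = (norm x * norm x) powr (- real N / 2) * z powr (real N / 2)"
        using t xx x by (auto simp: z_def powr_divide powr_minus field_simps)
      hence "t powr (- real N / 2) * exp (- (norm x * norm x) / (4 * t))
          = (norm x * norm x) powr (- real N / 2) * (z powr (real N / 2) * exp (- (z / 4)))"
        using t by (simp add: z_def field_simps)
      also have "\<dots> \<le> (4/25) powr (- real N / 2) * ((4 * real N) ^ N * exp (z / 4) * exp (- (z / 4)))"
        using powr_le_exp[OF True N] xx by (intro mult_mono mult_right_mono powr_mono2') auto
      also have "\<dots> = (4 * real N) ^ N * (4/25) powr (- real N / 2)" by (simp add: exp_minus)
      finally show ?thesis .
    next
      case False
      hence "4/25 \<le> t" using xx t by (simp add: z_def field_simps)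
      hence "t powr (- real N / 2) \<le> (4/25) powr (- real N / 2)" by (intro powr_mono2') auto
      moreover have "exp (- (norm x * norm x) / (4 * t)) \<le> 1" using t by simp
      ultimately have "t powr (- real N / 2) * exp (- (norm x * norm x) / (4 * t)) \<le> (4/25) powr (- real N / 2) * 1"
        by (intro mult_mono) auto
      also have "\<dots> \<le> (4 * real N) ^ N * (4/25) powr (- real N / 2)" using big by simp
      finally show ?thesis .
    qed
  qed
  define N where "N = DIM('a)"
  have N: "1 \<le> N" unfolding N_def by (simp add: Suc_leI)
  obtain C1 where C1: "0 < C1" "\<And>(x::'a) t. 2/5 \<le> norm x \<Longrightarrow> 0 < t \<Longrightarrow> t powr (- real N / 2) * exp (- (norm x * norm x) / (4 * t)) \<le> C1"
    using *[OF N] by blast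
  \<comment> \<open>Dividing by \<open>t\<close> changes the exponent exactly as two extra
    dimensions would, so the same estimate is reused with \<open>N + 2\<close>.\<close>
  obtain C2 where C2: "0 < C2" "\<And>(x::'a) t. 2/5 \<le> norm x \<Longrightarrow> 0 < t \<Longrightarrow> t powr (- real (N + 2) / 2) * exp (- (norm x * norm x) / (4 * t)) \<le> C2"
    using *[of "N + 2"] by auto
  define c where "c = (4 * pi) powr (- real N / 2)"
  have c: "0 < c" by (simp add: c_def)
  show ?thesis
  proof (rule that[of "c * max C1 C2"])
    show "0 < c * max C1 C2" using c C1 by (simp add: less_max_iff_disj)
    fix x :: 'a and t :: real assume x: "2/5 \<le> norm x" and t: "0 < t"
    have hk: "heat_kernel x t = c * (t powr (- real N / 2) * exp (- (norm x * norm x) / (4 * t)))"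
      using t by (simp add: heat_kernel_def N_def c_def powr_mult)
    have "t powr (- real (N + 2) / 2) = t powr (- real N / 2) / t"
    proof -
      have "- real (N + 2) / 2 = - real N / 2 - 1" by (simp add: field_simps)
      thus ?thesis using t by (simp only: powr_diff) simp
    qed
    hence hk2: "heat_kernel x t / t = c * (t powr (- real (N + 2) / 2) * exp (- (norm x * norm x) / (4 * t)))"
      unfolding hk by simp
    show "heat_kernel x t \<le> c * max C1 C2 \<and> heat_kernel x t / t \<le> c * max C1 C2"
      unfolding hk2 unfolding hk using C1(2)[OF x t] C2(2)[OF x t] c by (intro conjI mult_left_mono) auto
  qed
qed

text \<open>The backward heat kernel as a function of the squared distance \<open>w\<close> and the
  earlier time \<open>s\<close>. The power of the time lag is written through \<open>ln\<close>, so
  for \<open>s < t\<close> the whole expression is one exponential that is easy to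
  differentiate.\<close>

definition heat_profile :: "real \<Rightarrow> real \<Rightarrow> real \<Rightarrow> real \<Rightarrow> real" where
  "heat_profile n t w s = exp (- (n / 2) * ln (4 * pi * (t - s)) - w / (4 * (t - s)))"

lemma heat_kernel_eq_profile:
  fixes x y :: "'a::euclidean_space"
  assumes "s < t"
  shows "heat_kernel (x - y) (t - s) = heat_profile (real DIM('a)) t ((y - x) \<bullet> (y - x)) s"
proof -
  have "norm (x - y) * norm (x - y) = (y - x) \<bullet> (y - x)"
    by (metis norm_minus_commute power2_eq_square power2_norm_eq_inner)
  thus ?thesis using assms
    by (simp add: heat_kernel_def heat_profile_def powr_def exp_add[symmetric])
qed

lemma C21_on_heat_profile:
  fixes x :: "'a::euclidean_space" and n t :: real
  defines "G1 \<equiv> \<lambda>w s. - (heat_profile n t w s / (4 * (t - s)))"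
    and "G2 \<equiv> \<lambda>w s. heat_profile n t w s / (16 * (t - s)\<^sup>2)"
    and "Gs \<equiv> \<lambda>w s. heat_profile n t w s * (n / (2 * (t - s)) - w / (4 * (t - s)\<^sup>2))"
  shows "C21_on (UNIV \<times> {..<t}) (\<lambda>y s. heat_profile n t ((y - x) \<bullet> (y - x)) s)
     (\<lambda>y s. Gs ((y - x) \<bullet> (y - x)) s)
     (\<lambda>y s. (2 * G1 ((y - x) \<bullet> (y - x)) s) *\<^sub>R (y - x))
     (\<lambda>y s h. (2 * G1 ((y - x) \<bullet> (y - x)) s) *\<^sub>R h + (4 * G2 ((y - x) \<bullet> (y - x)) s * ((y - x) \<bullet> h)) *\<^sub>R (y - x))"
proof (rule C21_on_radial)
  fix w s assume "s \<in> {..<t}" hence s: "0 < t - s" by simp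
  have d: "((\<lambda>w. heat_profile n t w s) has_real_derivative G1 w s) (at w)" for w
    unfolding heat_profile_def G1_def using s by (auto intro!: derivative_eq_intros)
  show "((\<lambda>w. heat_profile n t w s) has_real_derivative G1 w s) (at w)" by (rule d)
  show "((\<lambda>w. G1 w s) has_real_derivative G2 w s) (at w)"
    unfolding G1_def G2_def
    by (rule DERIV_cong[OF DERIV_minus[OF DERIV_cdivide[OF d]]])
      (use s in \<open>simp add: G1_def power2_eq_square divide_simps, simp add: algebra_simps\<close>)
  show "((\<lambda>s. heat_profile n t w s) has_real_derivative Gs w s) (at s)"
  proof -
    have a: "((\<lambda>s. - (n / 2) * ln (4 * pi * (t - s)) - w / (4 * (t - s))) has_real_derivative
        (n / (2 * (t - s)) - w / (4 * (t - s)\<^sup>2))) (at s)"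
    proof -
      have 1: "((\<lambda>s. ln (4 * pi * (t - s))) has_real_derivative - 1 / (t - s)) (at s)"
        using s by (auto intro!: derivative_eq_intros)
      have 2: "((\<lambda>s. w / (4 * (t - s))) has_real_derivative w / (4 * (t - s)\<^sup>2)) (at s)"
        by (rule DERIV_cong, rule DERIV_divide[OF DERIV_const DERIV_cmult[OF DERIV_diff[OF DERIV_const DERIV_ident]]])
          (use s in \<open>auto simp: power2_eq_square divide_simps algebra_simps\<close>)
      show ?thesis
        by (rule DERIV_cong[OF DERIV_diff[OF DERIV_cmult[OF 1] 2]]) (use s in simp)
    qed
    show ?thesis unfolding heat_profile_def Gs_def
      by (rule DERIV_cong[OF DERIV_chain2[OF DERIV_exp a]]) simp
  qed
next
  have c: "continuous_on (UNIV \<times> {..<t}) (\<lambda>p. heat_profile n t (fst p) (snd p))"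
    unfolding heat_profile_def by (intro continuous_intros) auto
  show "continuous_on (UNIV \<times> {..<t}) (\<lambda>p. heat_profile n t (fst p) (snd p))" by (rule c)
  show "continuous_on (UNIV \<times> {..<t}) (\<lambda>p. G1 (fst p) (snd p))"
    "continuous_on (UNIV \<times> {..<t}) (\<lambda>p. G2 (fst p) (snd p))"
    "continuous_on (UNIV \<times> {..<t}) (\<lambda>p. Gs (fst p) (snd p))"
    unfolding G1_def G2_def Gs_def by (intro continuous_intros c; force)+
qed

text \<open>To be evaluated at \<open>y \<bullet> y\<close>: the transition zone from 6 to 7 lies
  between (12/5)^2 = 5.76 and 3^2. Nesting two cubes of positive parts gives a C^2 transition with
  explicit derivatives.\<close>

definition cutoff :: "real \<Rightarrow> real" where
  "cutoff w = (max 0 (1 - (max 0 (w - 6)) ^ 3)) ^ 3"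

definition cutoff1 :: "real \<Rightarrow> real" where
  "cutoff1 w = - (9 * (max 0 (1 - (max 0 (w - 6)) ^ 3))\<^sup>2 * (max 0 (w - 6))\<^sup>2)"

definition cutoff2 :: "real \<Rightarrow> real" where
  "cutoff2 w = 54 * max 0 (1 - (max 0 (w - 6)) ^ 3) * (max 0 (w - 6)) ^ 4
     - 18 * (max 0 (1 - (max 0 (w - 6)) ^ 3))\<^sup>2 * max 0 (w - 6)"

lemma DERIV_cutoff: "(cutoff has_real_derivative cutoff1 w) (at w)"
  and DERIV_cutoff1: "(cutoff1 has_real_derivative cutoff2 w) (at w)"
proof -
  have d: "((\<lambda>w. w - 6) has_real_derivative 1) (at w)" by (auto intro!: derivative_eq_intros)
  have e: "((\<lambda>w. 1 - (max 0 (w - 6)) ^ 3) has_real_derivative - (3 * (max 0 (w - 6))\<^sup>2)) (at w)"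
    using DERIV_diff[OF DERIV_const DERIV_max_cube[OF d], of 1] by simp
  show "(cutoff has_real_derivative cutoff1 w) (at w)"
    unfolding cutoff_def cutoff1_def
    by (rule DERIV_cong[OF DERIV_max_cube[OF e]]) simp
  have "((\<lambda>w. (- 9) * ((max 0 (1 - (max 0 (w - 6)) ^ 3))\<^sup>2 * (max 0 (w - 6))\<^sup>2)) has_real_derivative cutoff2 w) (at w)"
    by (rule DERIV_cong[OF DERIV_cmult[OF DERIV_mult[OF DERIV_max_square[OF e] DERIV_max_square[OF d]]]])
      (simp add: cutoff2_def algebra_simps power2_eq_square power4_eq_xxxx)
  thus "(cutoff1 has_real_derivative cutoff2 w) (at w)"
    unfolding cutoff1_def by (simp add: mult.assoc)
qed

lemma cutoff_eq_1: "w \<le> 6 \<Longrightarrow> cutoff w = 1 \<and> cutoff1 w = 0 \<and> cutoff2 w = 0"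
  by (simp add: cutoff_def cutoff1_def cutoff2_def)

lemma cutoff_eq_0:
  assumes "7 \<le> w" shows "cutoff w = 0 \<and> cutoff1 w = 0 \<and> cutoff2 w = 0"
proof -
  have "1 \<le> (max 0 (w - 6)) ^ 3" using assms by (intro one_le_power) auto
  thus ?thesis by (simp add: cutoff_def cutoff1_def cutoff2_def)
qed

lemma cutoff_bounds: "0 \<le> cutoff w" "cutoff w \<le> 1"
proof -
  have "0 \<le> (max 0 (w - 6)) ^ 3" by simp
  thus "0 \<le> cutoff w" "cutoff w \<le> 1" unfolding cutoff_def by (auto intro!: power_le_one)
qed

lemma continuous_on_cutoff: "continuous_on S cutoff" "continuous_on S cutoff1" "continuous_on S cutoff2"
  unfolding cutoff_def cutoff1_def cutoff2_def by (intro continuous_intros)+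

lemma cutoff_derivatives_bounded:
  obtains B where "0 < B" "\<And>w. \<bar>cutoff1 w\<bar> \<le> B" "\<And>w. \<bar>cutoff2 w\<bar> \<le> B"
proof -
  have "bounded (cutoff1 ` {6..7})" "bounded (cutoff2 ` {6..7})"
    by (intro compact_imp_bounded compact_continuous_image continuous_on_cutoff; simp)+
  then obtain B1 B2 where B: "\<And>w. w \<in> {6..7} \<Longrightarrow> \<bar>cutoff1 w\<bar> \<le> B1" "\<And>w. w \<in> {6..7} \<Longrightarrow> \<bar>cutoff2 w\<bar> \<le> B2"
    unfolding bounded_iff by (metis imageI real_norm_def)
  have "\<bar>cutoff1 w\<bar> \<le> max 1 (max B1 B2) \<and> \<bar>cutoff2 w\<bar> \<le> max 1 (max B1 B2)" for w
    using B[of w] cutoff_eq_1[of w] cutoff_eq_0[of w] by (cases "w \<le> 6"; cases "7 \<le> w") auto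
  thus ?thesis by (intro that[of "max 1 (max B1 B2)"]) auto
qed

text \<open>The kernel solves the backward heat equation, so for kernel times cutoff the operator
  leaves only \<open>K * laplacian HP\<close> and twice the product of the gradients. Both live
  where the cutoff varies, away from the pole, and are therefore bounded uniformly in
  \<open>x\<close> and \<open>t\<close> although the kernel is singular.\<close>

lemma heat_test_function:
  obtains C where "0 < C" and "\<And>(x::'a::euclidean_space) t. norm x \<le> 2 \<Longrightarrow>
    \<exists>phi phit gphi Hphi. C21_on (UNIV \<times> {..<t}) phi phit gphi Hphi \<and>
      (\<forall>y s. s < t \<longrightarrow> 3 < norm y \<longrightarrow> phi y s = 0 \<and> gphi y s = 0 \<and> Hphi y s = (\<lambda>_. 0)) \<and>
      (\<forall>y s. s < t \<longrightarrow> 0 \<le> phi y s \<and> phi y s \<le> heat_kernel (x - y) (t - s)) \<and>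
      (\<forall>y s. s < t \<longrightarrow> norm y \<le> 12/5 \<longrightarrow> phi y s = heat_kernel (x - y) (t - s)) \<and>
      (\<forall>y s. s < t \<longrightarrow> norm y \<le> 3 \<longrightarrow> \<bar>phit y s + laplacian Hphi y s\<bar> \<le> C)"
proof -
  define n where "n = real DIM('a)"
  have n: "0 < n" by (simp add: n_def)
  obtain C1 where C1: "0 < C1" "\<And>(x::'a) t. 2/5 \<le> norm x \<Longrightarrow> 0 < t \<Longrightarrow> heat_kernel x t \<le> C1 \<and> heat_kernel x t / t \<le> C1"
    using heat_kernel_far_bound[where 'a='a] by blast
  obtain B where B: "0 < B" "\<And>w. \<bar>cutoff1 w\<bar> \<le> B" "\<And>w. \<bar>cutoff2 w\<bar> \<le> B"
    using cutoff_derivatives_bounded by blast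
  \<comment> \<open>Here 36 is \<open>4 * 9\<close> with \<open>y \<bullet> y \<le> 9\<close>, and
    30 is \<open>2 * 15\<close> with \<open>norm (y - x) \<le> 5\<close> and
    \<open>norm y \<le> 3\<close>.\<close>
  define C where "C = C1 * (2 * n * B + 36 * B) + C1 * (30 * B)"
  have C0: "0 < C" using C1 B n by (auto simp: C_def intro!: add_pos_pos mult_pos_pos)
  show ?thesis
  proof (rule that[OF C0])
    fix x :: 'a and t :: real assume x: "norm x \<le> 2"
    let ?W = "\<lambda>y. (y - x) \<bullet> (y - x)" and ?Z = "\<lambda>y::'a. (y - 0) \<bullet> (y - 0)"
    define K where "K y s = heat_profile n t (?W y) s" for y s
    define Kt where "Kt y s = heat_profile n t (?W y) s * (n / (2 * (t - s)) - ?W y / (4 * (t - s)\<^sup>2))" for y s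
    define gK where "gK y s = (2 * - (heat_profile n t (?W y) s / (4 * (t - s)))) *\<^sub>R (y - x)" for y s
    define HK where "HK y s h = (2 * - (heat_profile n t (?W y) s / (4 * (t - s)))) *\<^sub>R h
        + (4 * (heat_profile n t (?W y) s / (16 * (t - s)\<^sup>2)) * ((y - x) \<bullet> h)) *\<^sub>R (y - x)" for y s h
    have CK: "C21_on (UNIV \<times> {..<t}) K Kt gK HK"
      using C21_on_heat_profile[of t n x] unfolding K_def[abs_def] Kt_def[abs_def] gK_def[abs_def] HK_def[abs_def] .
    define P where "P y s = cutoff (?Z y)" for y and s :: real
    define gP where "gP y s = (2 * cutoff1 (?Z y)) *\<^sub>R (y - 0)" for y and s :: real
    define HP where "HP y s h = (2 * cutoff1 (?Z y)) *\<^sub>R h + (4 * cutoff2 (?Z y) * ((y - 0) \<bullet> h)) *\<^sub>R (y - 0)" for y and s :: real and h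
    have CP: "C21_on (UNIV \<times> {..<t}) P (\<lambda>y s. 0) gP HP"
      unfolding P_def[abs_def] gP_def[abs_def] HP_def[abs_def]
    proof (rule C21_on_radial[where G="\<lambda>w s. cutoff w" and ?G1.0="\<lambda>w s. cutoff1 w" and ?G2.0="\<lambda>w s. cutoff2 w" and Gs="\<lambda>w s. 0"])
    qed (auto intro!: DERIV_cutoff DERIV_cutoff1 continuous_on_compose2[OF continuous_on_cutoff(1)[of UNIV]]
        continuous_on_compose2[OF continuous_on_cutoff(2)[of UNIV]] continuous_on_compose2[OF continuous_on_cutoff(3)[of UNIV]] continuous_intros)
    have Keq: "K y s = heat_kernel (x - y) (t - s)" if "s < t" for y s
      using heat_kernel_eq_profile[OF that, of x y] by (simp add: K_def n_def)
    have lapK: "Kt y s + laplacian HK y s = 0" if "s < t" for y s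
    proof -
      have "laplacian HK y s = 2 * n * - (heat_profile n t (?W y) s / (4 * (t - s))) + 4 * (heat_profile n t (?W y) s / (16 * (t - s)\<^sup>2)) * ?W y"
        unfolding HK_def[abs_def] n_def
        using laplacian_radial[of "\<lambda>w s. - (heat_profile (real DIM('a)) t w s / (4 * (t - s)))" x "\<lambda>w s. heat_profile (real DIM('a)) t w s / (16 * (t - s)\<^sup>2)" y s] by simp
      thus ?thesis using that by (simp add: Kt_def field_simps)
    qed
    have lapP: "laplacian HP y s = 2 * n * cutoff1 (y \<bullet> y) + 4 * cutoff2 (y \<bullet> y) * (y \<bullet> y)" for y s
      using laplacian_radial[of "\<lambda>w s. cutoff1 w" "0::'a" "\<lambda>w s. cutoff2 w" y s]
      unfolding HP_def[abs_def] n_def by simp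
    define phi where "phi = (\<lambda>y s. K y s * P y s)"
    define phit where "phit = (\<lambda>y s. Kt y s * P y s + K y s * 0)"
    define gphi where "gphi = (\<lambda>y s. K y s *\<^sub>R gP y s + P y s *\<^sub>R gK y s)"
    define Hphi where "Hphi = (\<lambda>y s h. (K y s *\<^sub>R HP y s h + (gK y s \<bullet> h) *\<^sub>R gP y s) + (P y s *\<^sub>R HK y s h + (gP y s \<bullet> h) *\<^sub>R gK y s))"
    have sq: "y \<bullet> y = (norm y)\<^sup>2" for y :: 'a by (simp add: power2_norm_eq_inner)
    have "C21_on (UNIV \<times> {..<t}) phi phit gphi Hphi"
      unfolding phi_def phit_def gphi_def Hphi_def by (rule C21_on_mult[OF CK CP])
    moreover have "phi y s = 0 \<and> gphi y s = 0 \<and> Hphi y s = (\<lambda>_. 0)" if "3 < norm y" for y s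
    proof -
      have "3\<^sup>2 < (norm y)\<^sup>2" using that by (intro power_strict_mono) auto
      hence "7 \<le> y \<bullet> y" by (simp add: sq)
      from cutoff_eq_0[OF this] show ?thesis
        by (simp add: phi_def gphi_def Hphi_def P_def gP_def HP_def)
    qed
    moreover have "0 \<le> phi y s \<and> phi y s \<le> heat_kernel (x - y) (t - s)" if "s < t" for y s
      using cutoff_bounds unfolding phi_def Keq[OF that] P_def by (auto intro!: mult_left_le)
    moreover have "phi y s = heat_kernel (x - y) (t - s)" if "s < t" "norm y \<le> 12/5" for y s
    proof -
      have "(norm y)\<^sup>2 \<le> (12/5)\<^sup>2" using that by (intro power_mono) auto
      hence "y \<bullet> y \<le> 6" by (simp add: sq power2_eq_square)
      from cutoff_eq_1[OF this] show ?thesis by (simp add: phi_def P_def Keq[OF that(1)])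
    qed
    moreover have "\<bar>phit y s + laplacian Hphi y s\<bar> \<le> C" if s: "s < t" and y: "norm y \<le> 3" for y s
    proof -
      have "laplacian Hphi y s = K y s * laplacian HP y s + 2 * (gK y s \<bullet> gP y s) + P y s * laplacian HK y s"
        unfolding Hphi_def by (rule laplacian_mult)
      hence "phit y s + laplacian Hphi y s = P y s * (Kt y s + laplacian HK y s) + K y s * laplacian HP y s + 2 * (gK y s \<bullet> gP y s)"
        by (simp add: phit_def algebra_simps)
      hence E: "phit y s + laplacian Hphi y s = K y s * laplacian HP y s + 2 * (gK y s \<bullet> gP y s)"
        using lapK[OF s] by simp
      show ?thesis
      proof (cases "y \<bullet> y \<le> 6")
        case True
        from cutoff_eq_1[OF this] show ?thesis using C0 by (simp add: E lapP gP_def)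
      next
        case False
        have "12/5 \<le> norm y"
        proof (rule ccontr)
          assume "\<not> 12/5 \<le> norm y"
          hence "(norm y)\<^sup>2 \<le> (12/5)\<^sup>2" by (intro power_mono) auto
          thus False using False by (simp add: sq power2_eq_square)
        qed
        hence far: "2/5 \<le> norm (x - y)" using x norm_triangle_ineq2[of y x] by (simp add: norm_minus_commute)
        have K0: "0 \<le> K y s" by (simp add: K_def heat_profile_def)
        have K1: "K y s \<le> C1" "K y s / (t - s) \<le> C1" using C1(2)[OF far, of "t - s"] s by (auto simp: Keq)
        have yy: "0 \<le> y \<bullet> y" "y \<bullet> y \<le> 9" using power_mono[OF y, of 2] by (auto simp: sq)
        have "\<bar>laplacian HP y s\<bar> \<le> \<bar>2 * n * cutoff1 (y \<bullet> y)\<bar> + \<bar>4 * cutoff2 (y \<bullet> y) * (y \<bullet> y)\<bar>"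
          unfolding lapP by (rule abs_triangle_ineq)
        also have "\<dots> = 2 * n * \<bar>cutoff1 (y \<bullet> y)\<bar> + 4 * (\<bar>cutoff2 (y \<bullet> y)\<bar> * (y \<bullet> y))"
          using n yy by (simp add: abs_mult)
        also have "\<dots> \<le> 2 * n * B + 4 * (B * 9)"
          using B n yy by (intro add_mono mult_left_mono mult_mono) auto
        finally have l: "\<bar>laplacian HP y s\<bar> \<le> 2 * n * B + 36 * B" by simp
        have a: "\<bar>K y s * laplacian HP y s\<bar> \<le> C1 * (2 * n * B + 36 * B)"
          using K0 K1 l C1 by (simp add: abs_mult) (intro mult_mono, auto)
        have "norm (y - x) \<le> 5" using x y norm_triangle_ineq4[of y x] by linarith
        hence ip: "\<bar>(y - x) \<bullet> y\<bar> \<le> 15" using Cauchy_Schwarz_ineq2[of "y - x" y] y mult_mono[of "norm (y - x)" 5 "norm y" 3]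
          by (simp add: order_trans)
        have "2 * (gK y s \<bullet> gP y s) = - (2 * ((K y s / (t - s)) * (cutoff1 (y \<bullet> y) * ((y - x) \<bullet> y))))"
          using s unfolding gK_def gP_def K_def inner_scaleR_left inner_scaleR_right diff_zero
          by (simp add: divide_simps)
        hence "\<bar>2 * (gK y s \<bullet> gP y s)\<bar> = 2 * ((K y s / (t - s)) * (\<bar>cutoff1 (y \<bullet> y)\<bar> * \<bar>(y - x) \<bullet> y\<bar>))"
          using K0 s by (simp add: abs_mult)
        also have "\<dots> \<le> 2 * (C1 * (B * 15))"
          using K0 K1 C1 B ip s by (intro mult_left_mono mult_mono) auto
        finally have "\<bar>2 * (gK y s \<bullet> gP y s)\<bar> \<le> C1 * (30 * B)" by simp
        with a show ?thesis unfolding E C_def by linarith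
      qed
    qed
    ultimately show "\<exists>phi phit gphi Hphi. C21_on (UNIV \<times> {..<t}) phi phit gphi Hphi \<and>
      (\<forall>y s. s < t \<longrightarrow> 3 < norm y \<longrightarrow> phi y s = 0 \<and> gphi y s = 0 \<and> Hphi y s = (\<lambda>_. 0)) \<and>
      (\<forall>y s. s < t \<longrightarrow> 0 \<le> phi y s \<and> phi y s \<le> heat_kernel (x - y) (t - s)) \<and>
      (\<forall>y s. s < t \<longrightarrow> norm y \<le> 12/5 \<longrightarrow> phi y s = heat_kernel (x - y) (t - s)) \<and>
      (\<forall>y s. s < t \<longrightarrow> norm y \<le> 3 \<longrightarrow> \<bar>phit y s + laplacian Hphi y s\<bar> \<le> C)"
      by blast
  qed
qed

subsection \<open>Mass bound and representation\<close>

lemma borel_measurable_indicator_ennreal: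
  assumes "A \<in> sets borel" "continuous_on A f"
  shows "(\<lambda>x. indicator A x * ennreal (f x)) \<in> borel_measurable borel"
proof -
  have "(\<lambda>x. ennreal (indicator A x *\<^sub>R f x)) \<in> borel_measurable borel"
    using borel_measurable_continuous_on_indicator[OF assms] by measurable
  moreover have "(\<lambda>x. ennreal (indicator A x *\<^sub>R f x)) = (\<lambda>x. indicator A x * ennreal (f x))"
    by (auto simp: fun_eq_iff indicator_def)
  ultimately show ?thesis by simp
qed

lemma ennreal_set_integral:
  fixes f :: "'b::euclidean_space \<Rightarrow> real"
  assumes "set_integrable lborel S f" "\<And>x. x \<in> S \<Longrightarrow> 0 \<le> f x"
  shows "ennreal (LINT x:S|lborel. f x) = (\<integral>\<^sup>+x. indicator S x * ennreal (f x) \<partial>lborel)"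
proof -
  have "(\<integral>\<^sup>+x. ennreal (indicator S x *\<^sub>R f x) \<partial>lborel) = ennreal (LINT x:S|lborel. f x)"
    unfolding set_lebesgue_integral_def using assms
    by (intro nn_integral_eq_integral) (auto simp: set_integrable_def indicator_def)
  moreover have "(\<lambda>x. ennreal (indicator S x *\<^sub>R f x)) = (\<lambda>x. indicator S x * ennreal (f x))"
    by (auto simp: fun_eq_iff indicator_def)
  ultimately show ?thesis by simp
qed

text \<open>Collects what follows from nonnegativity and the lower inequality; the nonlocal upper
  bound and the exponents enter with \<open>heat_power_source\<close>.\<close>

locale heat_supersolution =
  fixes u ut :: "'a::euclidean_space \<Rightarrow> real \<Rightarrow> real"
    and g :: "'a \<Rightarrow> real \<Rightarrow> 'a" and H :: "'a \<Rightarrow> real \<Rightarrow> 'a \<Rightarrow> 'a"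
  assumes nonneg: "\<And>x t. 0 < t \<Longrightarrow> t < 16 \<Longrightarrow> 0 \<le> u x t"
    and C21: "C21_on (UNIV \<times> {0<..<16}) u ut g H"
    and lower: "\<And>x t. x \<in> ball 0 4 \<Longrightarrow> 0 < t \<Longrightarrow> t < 16 \<Longrightarrow> 0 \<le> ut x t - laplacian H x t"
begin

definition src :: "'a \<times> real \<Rightarrow> real" where
  "src p = ut (fst p) (snd p) - laplacian H (fst p) (snd p)"

lemma continuous_on_u: "continuous_on (UNIV \<times> {0<..<16}) (\<lambda>p. u (fst p) (snd p))"
  by (rule C21_on_continuous[OF C21])

lemma continuous_on_src: "continuous_on (UNIV \<times> {0<..<16}) src"
  unfolding src_def by (intro continuous_on_diff C21_on_continuous[OF C21])

lemma src_nonneg: "norm (fst p) < 4 \<Longrightarrow> 0 < snd p \<Longrightarrow> snd p < 16 \<Longrightarrow> 0 \<le> src p"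
  unfolding src_def using lower by simp

text \<open>For a backward subsolution as test function, Green's identity has a nonnegative right
  side. Hence the weighted mass \<open>F\<close> is nondecreasing in time: \<open>F 1\<close> bounds
  every earlier slice, and \<open>F 1 - F s \<le> F 1\<close> bounds the source. The constant
  depends on the slice at time 1 only, so it survives as \<open>s\<close> tends to 0.\<close>

lemma mass_bound:
  obtains M where "0 < M"
    "\<And>s. 0 < s \<Longrightarrow> s \<le> 1 \<Longrightarrow> (\<integral>\<^sup>+y. indicator (cball 0 3) y * ennreal (u y s) \<partial>lborel) \<le> ennreal M"
    "\<And>s. 0 < s \<Longrightarrow> s \<le> 1 \<Longrightarrow> (\<integral>\<^sup>+p. indicator (cball 0 3 \<times> {s..1}) p * ennreal (src p) \<partial>lborel) \<le> ennreal M"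
proof -
  obtain phi phit :: "'a \<Rightarrow> real \<Rightarrow> real" and gphi Hphi where phi:
    "C21_on (UNIV \<times> UNIV) phi phit gphi Hphi"
    "\<And>y s. 4 < norm y \<Longrightarrow> phi y s = 0 \<and> gphi y s = 0 \<and> Hphi y s = (\<lambda>_. 0)"
    "\<And>y s. norm y = 4 \<Longrightarrow> phi y s = 0"
    "\<And>y s. 0 \<le> phi y s"
    "\<And>y s. 0 \<le> s \<Longrightarrow> norm y \<le> 3 \<Longrightarrow> 1 \<le> phi y s"
    "\<And>y s. 0 \<le> phit y s + laplacian Hphi y s"
    using mass_test_function by blast
  have phi1: "C21_on (UNIV \<times> {0<..<16}) phi phit gphi Hphi"
    by (rule C21_on_subset[OF phi(1)]) auto
  define F where "F s = (LINT y:cball 0 4|lborel. u y s * phi y s)" for s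
  define q where "q p = phi (fst p) (snd p) * (ut (fst p) (snd p) - laplacian H (fst p) (snd p))
        + u (fst p) (snd p) * (phit (fst p) (snd p) + laplacian Hphi (fst p) (snd p))" for p
  have qc: "continuous_on (UNIV \<times> {0<..<16}) q"
    unfolding q_def
    by (intro continuous_on_add continuous_on_mult continuous_on_diff C21_on_continuous[OF C21] C21_on_continuous[OF phi1])
  \<comment> \<open>On the sphere \<open>norm y = 4\<close> the sign of \<open>src\<close> is
    unknown, but \<open>phi\<close> vanishes there.\<close>
  have srcphi: "0 \<le> phi y s * src (y, s)" if "y \<in> cball 0 4" "0 < s" "s \<le> 1" for y s
    using that phi(3)[of y s] phi(4)[of y s] src_nonneg[of "(y, s)"] by (cases "norm y = 4") auto
  have q0: "0 \<le> q (y, s)" if "y \<in> cball 0 4" "0 < s" "s \<le> 1" for y s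
    using srcphi[OF that] nonneg[of s y] phi(6)[of y s] that by (simp add: q_def src_def)
  have qint: "set_integrable lborel (cball 0 4 \<times> {s..1}) q" if "0 < s" for s
    by (intro set_integrable_compact_continuous compact_Times continuous_on_subset[OF qc]) (use that in auto)
  have green: "F 1 - F s = (LINT p:(cball 0 4 \<times> {s..1})|lborel. q p)" if "0 < s" "s \<le> 1" for s
    unfolding F_def q_def
    by (rule green_space_time[OF C21 phi1]) (use that phi(2) in auto)
  have cs: "continuous_on (cball 0 4) (\<lambda>y. u y s * phi y s)" if "0 < s" "s \<le> 1" for s
  proof -
    have "s \<in> {0<..<16}" using that by auto
    hence "continuous_on UNIV (\<lambda>y. u y s)" "continuous_on UNIV (\<lambda>y. phi y s)"
      using continuous_on_slice[OF C21_on_continuous(1)[OF C21]] continuous_on_slice[OF C21_on_continuous(1)[OF phi1]] by auto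
    thus ?thesis by (intro continuous_on_mult continuous_on_subset[of UNIV _ "cball 0 4"]) auto
  qed
  have Feq: "ennreal (F s) = (\<integral>\<^sup>+y. indicator (cball 0 4) y * ennreal (u y s * phi y s) \<partial>lborel)" if "0 < s" "s \<le> 1" for s
    unfolding F_def using that nonneg[of s] phi(4)
    by (intro ennreal_set_integral set_integrable_compact_continuous cs) auto
  have F0: "0 \<le> F s" if "0 < s" "s \<le> 1" for s
    unfolding F_def set_lebesgue_integral_def using that nonneg[of s] phi(4)
    by (intro Bochner_Integration.integral_nonneg) auto
  have I0: "0 \<le> (LINT p:(cball 0 4 \<times> {s..1})|lborel. q p)" if "0 < s" "s \<le> 1" for s
    unfolding set_lebesgue_integral_def
  proof (intro Bochner_Integration.integral_nonneg)
    fix p :: "'a \<times> real"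
    show "0 \<le> indicator (cball 0 4 \<times> {s..1}) p *\<^sub>R q p"
      using q0[of "fst p" "snd p"] that by (cases "p \<in> cball 0 4 \<times> {s..1}") auto
  qed
  show ?thesis
  proof (rule that[of "F 1 + 1"])
    show "0 < F 1 + 1" using F0[of 1] by simp
    fix s :: real assume s: "0 < s" "s \<le> 1"
    have "(\<integral>\<^sup>+y. indicator (cball 0 3) y * ennreal (u y s) \<partial>lborel)
        \<le> (\<integral>\<^sup>+y. indicator (cball 0 4) y * ennreal (u y s * phi y s) \<partial>lborel)"
    proof (intro nn_integral_mono)
      fix y :: 'a
      show "indicator (cball 0 3) y * ennreal (u y s) \<le> indicator (cball 0 4) y * ennreal (u y s * phi y s)"
        using phi(5)[of s y] nonneg[of s y] s
        by (cases "y \<in> cball 0 3") (auto simp: mult_le_cancel_left1 intro!: ennreal_leI)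
    qed
    also have "\<dots> \<le> ennreal (F 1 + 1)"
      unfolding Feq[OF s, symmetric] using green[OF s] I0[OF s] by (intro ennreal_leI) simp
    finally show "(\<integral>\<^sup>+y. indicator (cball 0 3) y * ennreal (u y s) \<partial>lborel) \<le> ennreal (F 1 + 1)" .
    have "(\<integral>\<^sup>+p. indicator (cball 0 3 \<times> {s..1}) p * ennreal (src p) \<partial>lborel)
        \<le> (\<integral>\<^sup>+p. indicator (cball 0 4 \<times> {s..1}) p * ennreal (q p) \<partial>lborel)"
    proof (intro nn_integral_mono)
      fix p :: "'a \<times> real"
      show "indicator (cball 0 3 \<times> {s..1}) p * ennreal (src p) \<le> indicator (cball 0 4 \<times> {s..1}) p * ennreal (q p)"
      proof (cases "p \<in> cball 0 3 \<times> {s..1}")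
        case True
        then obtain y r where p: "p = (y, r)" "norm y \<le> 3" "s \<le> r" "r \<le> 1" by auto
        have "src p \<le> phi y r * src p"
          using phi(5)[of r y] src_nonneg[of p] p s mult_right_mono[of 1 "phi y r" "src p"] by simp
        also have "\<dots> \<le> q p"
          using nonneg[of r y] phi(6)[of y r] p s by (simp add: q_def src_def)
        finally show ?thesis using True p by (auto intro!: ennreal_leI)
      qed auto
    qed
    also have "\<dots> = ennreal (LINT p:(cball 0 4 \<times> {s..1})|lborel. q p)"
      using q0 s by (intro ennreal_set_integral[symmetric] qint) auto
    also have "\<dots> \<le> ennreal (F 1 + 1)"
      unfolding green[OF s, symmetric] using F0[OF s] by (intro ennreal_leI) simp
    finally show "(\<integral>\<^sup>+p. indicator (cball 0 3 \<times> {s..1}) p * ennreal (src p) \<partial>lborel) \<le> ennreal (F 1 + 1)" .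
  qed
qed

end

text \<open>By Tonelli, a bound on every slice passes to the slab with the same constant, since the
  time interval has length at most 1.\<close>

lemma nn_integral_Times_le:
  fixes h :: "'a::euclidean_space \<Rightarrow> real \<Rightarrow> real"
  assumes c: "continuous_on (cball 0 3 \<times> {d..e}) (\<lambda>p. h (fst p) (snd p))"
    and bd: "\<And>s. d \<le> s \<Longrightarrow> s \<le> e \<Longrightarrow> (\<integral>\<^sup>+y. indicator (cball 0 3) y * ennreal (h y s) \<partial>lborel) \<le> ennreal M"
    and "d \<le> e" "e \<le> d + 1"
  shows "(\<integral>\<^sup>+p. indicator (cball 0 3 \<times> {d..e}) p * ennreal (h (fst p) (snd p)) \<partial>lborel) \<le> ennreal M"
proof -
  let ?G = "\<lambda>p::'a \<times> real. indicator (cball 0 3 \<times> {d..e}) p * ennreal (h (fst p) (snd p))"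
  have "?G \<in> borel_measurable borel"
    by (intro borel_measurable_indicator_ennreal c borel_closed closed_Times) auto
  hence m: "?G \<in> borel_measurable (lborel \<Otimes>\<^sub>M lborel)" by (simp add: lborel_prod)
  have "(\<integral>\<^sup>+p. ?G p \<partial>lborel) = (\<integral>\<^sup>+s. \<integral>\<^sup>+y. ?G (y, s) \<partial>lborel \<partial>lborel)"
    using lborel_pair.nn_integral_snd[OF m] by (simp add: lborel_prod)
  also have "\<dots> \<le> (\<integral>\<^sup>+s. ennreal M * indicator {d..e} s \<partial>lborel)"
  proof (intro nn_integral_mono)
    fix s :: real
    show "(\<integral>\<^sup>+y. ?G (y, s) \<partial>lborel) \<le> ennreal M * indicator {d..e} s"
      using bd[of s] by (cases "s \<in> {d..e}") (auto simp: indicator_times)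
  qed
  also have "\<dots> = ennreal M * ennreal (e - d)" using assms by (simp add: nn_integral_cmult_indicator)
  also have "\<dots> \<le> ennreal M * 1" using assms by (intro mult_left_mono) (auto simp: ennreal_le_1)
  finally show ?thesis by simp
qed

section \<open>Pointwise bound by potentials of a time slice and of the source\<close>

context heat_supersolution
begin

text \<open>A weak form of the kernel's convergence to a point mass, in which a constant factor
  \<open>c\<close> may be lost. On the ball of radius \<open>sqrt e\<close> the kernel with time lag
  \<open>e\<close> is at least \<open>(4 * pi * e) powr (- n / 2) * exp (- 1 / 4)\<close>, and the
  volume of the ball cancels the power of \<open>e\<close>.\<close>

lemma kernel_average_lower_bound:
  obtains c where "0 < c"
    "\<And>x t d \<delta>. norm x \<le> 2 \<Longrightarrow> 0 < d \<Longrightarrow> d < t \<Longrightarrow> t \<le> 1 \<Longrightarrow> 0 < \<delta> \<Longrightarrow>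
      \<exists>t'. d < t' \<and> t' < t \<and> ennreal (c * (u x t - \<delta>)) \<le>
         (\<integral>\<^sup>+y. indicator (cball 0 (12/5)) y * ennreal (heat_kernel (x - y) (t - t') * u y t') \<partial>lborel)"
proof -
  define N where "N = DIM('a)"
  define c where "c = (4 * pi) powr (- real N / 2) * exp (- 1 / 4) * unit_ball_vol (real N)"
  have c: "0 < c" by (simp add: c_def)
  show ?thesis
  proof (rule that[OF c])
    fix x :: 'a and t d \<delta> :: real
    assume x: "norm x \<le> 2" and d: "0 < d" "d < t" and t: "t \<le> 1" and \<delta>: "0 < \<delta>"
    have "open (UNIV \<times> {0<..<16::real} :: ('a \<times> real) set)" by (intro open_Times) auto
    hence "isCont (\<lambda>p. u (fst p) (snd p)) (x, t)"
      using continuous_on_u d t by (subst (asm) continuous_on_eq_continuous_at) auto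
    then obtain \<eta> where \<eta>: "0 < \<eta>" "\<And>p. dist p (x, t) < \<eta> \<Longrightarrow> dist (u (fst p) (snd p)) (u x t) < \<delta>"
      unfolding continuous_at_eps_delta using \<delta> by (metis fst_conv snd_conv)
    \<comment> \<open>The time lag. The bound 1/10 gives \<open>sqrt e \<le> 2/5\<close>, so the
      ball around \<open>x\<close> stays in \<open>cball 0 (12/5)\<close>, where the cutoff equals
      1; half of \<open>t - d\<close> keeps \<open>t - e\<close> above \<open>d\<close>; the
      remaining part keeps the ball at time \<open>t - e\<close> within the continuity radius
      \<open>\<eta>\<close>.\<close>
    define e where "e = min (min (1/10) ((t - d) / 2)) (min (\<eta> / 2) ((\<eta> / 2)\<^sup>2) / 2)"
    have e: "0 < e" "e \<le> 1/10" "e < t - d" "e < \<eta> / 2" "e < (\<eta> / 2)\<^sup>2"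
      using \<eta> d by (auto simp: e_def min_def field_simps)
    have "sqrt e \<le> sqrt ((2/5)\<^sup>2)" "sqrt e < sqrt ((\<eta> / 2)\<^sup>2)"
      using e by (auto simp only: real_sqrt_le_iff real_sqrt_less_iff power2_eq_square)
    hence se: "0 < sqrt e" "sqrt e \<le> 2/5" "sqrt e < \<eta> / 2"
      using e \<eta>(1) by (auto simp only: real_sqrt_abs abs_of_pos real_sqrt_gt_0_iff half_gt_zero)
    define k where "k = (4 * pi * e) powr (- real N / 2) * exp (- 1 / 4)"
    have kvol: "k * (unit_ball_vol (real N) * sqrt e ^ N) = c"
    proof -
      have "sqrt e ^ N = e powr (real N / 2)"
        using e powr_realpow[OF se(1), of N] powr_powr[of e "1/2" "real N"] by (simp add: powr_half_sqrt)
      moreover have "e powr (- real N / 2) * e powr (real N / 2) = 1"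
        using e by (simp flip: powr_add)
      ultimately show ?thesis unfolding k_def c_def using e by (simp add: powr_mult)
    qed
    have ub: "ennreal (c * (u x t - \<delta>)) \<le>
         (\<integral>\<^sup>+y. indicator (cball 0 (12/5)) y * ennreal (heat_kernel (x - y) (t - (t - e)) * u y (t - e)) \<partial>lborel)"
    proof (cases "u x t - \<delta> \<le> 0")
      case True
      thus ?thesis using c by (simp add: ennreal_neg mult_nonneg_nonpos)
    next
      case False
      have "ennreal (c * (u x t - \<delta>)) = ennreal (k * (u x t - \<delta>)) * emeasure lborel (ball x (sqrt e))"
        using False se by (simp add: emeasure_ball N_def[symmetric] k_def flip: ennreal_mult kvol)
      also have "\<dots> = (\<integral>\<^sup>+y. ennreal (k * (u x t - \<delta>)) * indicator (ball x (sqrt e)) y \<partial>lborel)"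
        by (simp add: nn_integral_cmult_indicator)
      also have "\<dots> \<le> (\<integral>\<^sup>+y. indicator (cball 0 (12/5)) y * ennreal (heat_kernel (x - y) (t - (t - e)) * u y (t - e)) \<partial>lborel)"
      proof (intro nn_integral_mono)
        fix y :: 'a
        show "ennreal (k * (u x t - \<delta>)) * indicator (ball x (sqrt e)) y
           \<le> indicator (cball 0 (12/5)) y * ennreal (heat_kernel (x - y) (t - (t - e)) * u y (t - e))"
        proof (cases "y \<in> ball x (sqrt e)")
          case True
          hence xy: "norm (x - y) < sqrt e" by (simp add: dist_norm)
          have "norm y \<le> norm x + norm (x - y)" by (metis add_diff_cancel_left' add.commute diff_add_cancel norm_minus_commute norm_triangle_ineq)
          hence y: "norm y \<le> 12/5" using x xy se by linarith
          have "norm (x - y) * norm (x - y) \<le> sqrt e * sqrt e" using xy e by (intro mult_mono) auto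
          hence "norm (x - y) * norm (x - y) \<le> e" using e by simp
          hence "k \<le> heat_kernel (x - y) e"
            unfolding k_def heat_kernel_def N_def[symmetric] using e by (auto intro!: mult_left_mono simp: field_simps)
          moreover have "u x t - \<delta> \<le> u y (t - e)"
          proof -
            have "dist (y, t - e) (x, t) \<le> dist y x + dist (t - e) t" 
              using dist_triangle[of "(y, t - e)" "(x, t)" "(x, t - e)"] by (simp add: dist_Pair_Pair)
            also have "\<dots> < \<eta>" using xy se e by (simp add: dist_norm norm_minus_commute)
            finally have "dist (u y (t - e)) (u x t) < \<delta>" using \<eta>(2)[of "(y, t - e)"] by simp
            thus ?thesis by (simp add: dist_real_def)
          qed
          ultimately have "k * (u x t - \<delta>) \<le> heat_kernel (x - y) e * u y (t - e)"
            using False by (intro mult_mono) auto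
          thus ?thesis using True y by (auto intro!: ennreal_leI)
        qed auto
      qed
      finally show ?thesis .
    qed
    show "\<exists>t'. d < t' \<and> t' < t \<and> ennreal (c * (u x t - \<delta>)) \<le>
         (\<integral>\<^sup>+y. indicator (cball 0 (12/5)) y * ennreal (heat_kernel (x - y) (t - t') * u y t') \<partial>lborel)"
      using ub e by (intro exI[of _ "t - e"]) auto
  qed
qed

text \<open>Duhamel's formula from time \<open>d\<close>, as an inequality. Green's identity is used
  up to some \<open>t' < t\<close> because the test function is singular at the pole. The error of
  the cutoff is at most \<open>Ce\<close> times the integral of \<open>u\<close> over a slab of
  length at most 1, hence at most \<open>Ce * M\<close>, with no dependence on
  \<open>d\<close>.\<close>

lemma representation_bound:
  obtains C where "0 < C"
    "\<And>x t d. norm x \<le> 2 \<Longrightarrow> 0 < d \<Longrightarrow> d < t \<Longrightarrow> t \<le> 1 \<Longrightarrow>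
      ennreal (u x t) \<le> ennreal C * (1
        + (\<integral>\<^sup>+y. indicator (cball 0 3) y * ennreal (pnorm ((x, t) - (y, d)) powr (- real DIM('a)) * u y d) \<partial>lborel)
        + (\<integral>\<^sup>+p. indicator (cball 0 3 \<times> {d..<t}) p * ennreal (pnorm ((x, t) - p) powr (- real DIM('a)) * src p) \<partial>lborel))"
proof -
  obtain M where M: "0 < M"
    "\<And>s. 0 < s \<Longrightarrow> s \<le> 1 \<Longrightarrow> (\<integral>\<^sup>+y. indicator (cball 0 3) y * ennreal (u y s) \<partial>lborel) \<le> ennreal M"
    using mass_bound by metis
  obtain Ck where Ck: "0 < Ck" "\<And>(x::'a) t. heat_kernel x t \<le> Ck * pnorm (x, t) powr (- real DIM('a))"
    using heat_kernel_le_pnorm[where 'a='a] by blast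
  obtain Ce where Ce: "0 < Ce" and test: "\<And>(x::'a) t. norm x \<le> 2 \<Longrightarrow>
    \<exists>phi phit gphi Hphi. C21_on (UNIV \<times> {..<t}) phi phit gphi Hphi \<and>
      (\<forall>y s. s < t \<longrightarrow> 3 < norm y \<longrightarrow> phi y s = 0 \<and> gphi y s = 0 \<and> Hphi y s = (\<lambda>_. 0)) \<and>
      (\<forall>y s. s < t \<longrightarrow> 0 \<le> phi y s \<and> phi y s \<le> heat_kernel (x - y) (t - s)) \<and>
      (\<forall>y s. s < t \<longrightarrow> norm y \<le> 12/5 \<longrightarrow> phi y s = heat_kernel (x - y) (t - s)) \<and>
      (\<forall>y s. s < t \<longrightarrow> norm y \<le> 3 \<longrightarrow> \<bar>phit y s + laplacian Hphi y s\<bar> \<le> Ce)"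
    using heat_test_function[where 'a='a] by blast
  obtain c where c: "0 < c" and low: "\<And>x t d \<delta>. norm x \<le> 2 \<Longrightarrow> 0 < d \<Longrightarrow> d < t \<Longrightarrow> t \<le> 1 \<Longrightarrow> 0 < \<delta> \<Longrightarrow>
      \<exists>t'. d < t' \<and> t' < t \<and> ennreal (c * (u x t - \<delta>)) \<le>
         (\<integral>\<^sup>+y. indicator (cball 0 (12/5)) y * ennreal (heat_kernel (x - y) (t - t') * u y t') \<partial>lborel)"
    using kernel_average_lower_bound by blast
  define C where "C = Ck + Ce * M"
  have C: "0 < C" "Ck \<le> C" "Ce * M \<le> C" using Ck Ce M by (auto simp: C_def add_pos_pos)
  show ?thesis
  proof (rule that[of "C / c"])
    show "0 < C / c" using C c by simp
    fix x :: 'a and t d :: real assume x: "norm x \<le> 2" and d: "0 < d" "d < t" and t: "t \<le> 1"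
    define A1 where "A1 = (\<integral>\<^sup>+y. indicator (cball 0 3) y * ennreal (pnorm ((x, t) - (y, d)) powr (- real DIM('a)) * u y d) \<partial>lborel)"
    define A2 where "A2 = (\<integral>\<^sup>+p. indicator (cball 0 3 \<times> {d..<t}) p * ennreal (pnorm ((x, t) - p) powr (- real DIM('a)) * src p) \<partial>lborel)"
    obtain phi phit gphi Hphi where phi0: "C21_on (UNIV \<times> {..<t}) phi phit gphi Hphi"
      and phi1: "\<And>y s. s < t \<Longrightarrow> 3 < norm y \<Longrightarrow> phi y s = 0 \<and> gphi y s = 0 \<and> Hphi y s = (\<lambda>_. 0)"
      and phi2: "\<And>y s. s < t \<Longrightarrow> 0 \<le> phi y s \<and> phi y s \<le> heat_kernel (x - y) (t - s)"
      and phi3: "\<And>y s. s < t \<Longrightarrow> norm y \<le> 12/5 \<Longrightarrow> phi y s = heat_kernel (x - y) (t - s)"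
      and phi4: "\<And>y s. s < t \<Longrightarrow> norm y \<le> 3 \<Longrightarrow> \<bar>phit y s + laplacian Hphi y s\<bar> \<le> Ce"
      using test[OF x, of t] by blast
    have phiC: "C21_on (UNIV \<times> {0<..<t}) phi phit gphi Hphi"
      by (rule C21_on_subset[OF phi0]) auto
    have uC: "C21_on (UNIV \<times> {0<..<t}) u ut g H"
      by (rule C21_on_subset[OF C21]) (use t in auto)
    define F where "F s = (LINT y:cball 0 3|lborel. u y s * phi y s)" for s
    have Feq: "ennreal (F s) = (\<integral>\<^sup>+y. indicator (cball 0 3) y * ennreal (u y s * phi y s) \<partial>lborel)"
      if "0 < s" "s < t" for s
    proof -
      have s: "s \<in> {0<..<t}" using that by auto
      hence "continuous_on UNIV (\<lambda>y. u y s)" "continuous_on UNIV (\<lambda>y. phi y s)"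
        using continuous_on_slice[OF C21_on_continuous(1)[OF uC]] continuous_on_slice[OF C21_on_continuous(1)[OF phiC]] by auto
      hence "continuous_on (cball 0 3) (\<lambda>y. u y s * phi y s)"
        by (intro continuous_on_mult continuous_on_subset[of UNIV _ "cball 0 3"]) auto
      thus ?thesis unfolding F_def using that t nonneg[of s] phi2[of s]
        by (intro ennreal_set_integral set_integrable_compact_continuous) auto
    qed
    have bnd: "phi y s \<le> Ck * pnorm ((x, t) - (y, s)) powr (- real DIM('a))" if "s < t" for y s
      using phi2[OF that, of y] Ck(2)[of "x - y" "t - s"] by simp
    \<comment> \<open>The right side does not contain \<open>t'\<close>, so the time that
      \<open>kernel_average_lower_bound\<close> produces for each \<open>\<delta>\<close> can be
      inserted afterwards.\<close>
    have key: "ennreal (F t') \<le> ennreal C * (1 + A1 + A2)" if t': "d < t'" "t' < t" for t'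
    proof -
      let ?Q = "cball (0::'a) 3 \<times> {d..t'}"
      define q where "q p = phi (fst p) (snd p) * (ut (fst p) (snd p) - laplacian H (fst p) (snd p))
        + u (fst p) (snd p) * (phit (fst p) (snd p) + laplacian Hphi (fst p) (snd p))" for p
      define q' where "q' p = phi (fst p) (snd p) * src p + Ce * u (fst p) (snd p)" for p
      have sub: "?Q \<subseteq> UNIV \<times> {0<..<t}" using d t' by auto
      have qc: "continuous_on (UNIV \<times> {0<..<t}) q"
        unfolding q_def
        by (intro continuous_on_add continuous_on_mult continuous_on_diff C21_on_continuous[OF uC] C21_on_continuous[OF phiC])
      have q'c: "continuous_on (UNIV \<times> {0<..<t}) q'"
        unfolding q'_def src_def
        by (intro continuous_on_add continuous_on_mult continuous_on_diff continuous_on_const C21_on_continuous[OF uC] C21_on_continuous[OF phiC])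
      have qi: "set_integrable lborel ?Q q" and q'i: "set_integrable lborel ?Q q'"
        by (intro set_integrable_compact_continuous compact_Times continuous_on_subset[OF qc sub] continuous_on_subset[OF q'c sub]; simp)+
      have uphi: "0 \<le> u (fst p) (snd p)" "0 \<le> src p" "0 \<le> phi (fst p) (snd p)" if "p \<in> ?Q" for p
        using that d t' t nonneg[of "snd p" "fst p"] src_nonneg[of p] phi2[of "snd p" "fst p"] by auto
      have "F t' - F d = (LINT p:?Q|lborel. q p)"
        unfolding F_def q_def
        by (rule green_space_time[OF uC phiC]) (use d t' phi1 in auto)
      also have "\<dots> \<le> (LINT p:?Q|lborel. q' p)"
      proof (intro set_integral_mono qi q'i)
        fix p assume p: "p \<in> ?Q"
        have "u (fst p) (snd p) * (phit (fst p) (snd p) + laplacian Hphi (fst p) (snd p)) \<le> u (fst p) (snd p) * Ce"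
          using phi4[of "snd p" "fst p"] p t' uphi[OF p] by (intro mult_left_mono) auto
        thus "q p \<le> q' p" by (simp add: q_def q'_def src_def mult.commute)
      qed
      finally have "F t' \<le> F d + (LINT p:?Q|lborel. q' p)" by simp
      hence "ennreal (F t') \<le> ennreal (F d) + ennreal (LINT p:?Q|lborel. q' p)"
      proof -
        have "0 \<le> F d" unfolding F_def set_lebesgue_integral_def using d t nonneg[of d] phi2[of d]
          by (intro Bochner_Integration.integral_nonneg) auto
        moreover have "0 \<le> (LINT p:?Q|lborel. q' p)" unfolding set_lebesgue_integral_def
        proof (intro Bochner_Integration.integral_nonneg)
          fix p show "0 \<le> indicator ?Q p *\<^sub>R q' p"
            using uphi[of p] Ce by (cases "p \<in> ?Q") (auto simp: q'_def)
        qed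
        ultimately show ?thesis using \<open>F t' \<le> _\<close> by (simp add: ennreal_leI flip: ennreal_plus)
      qed
      also have "ennreal (F d) \<le> ennreal Ck * A1"
      proof -
        have m: "(\<lambda>y. indicator (cball 0 3) y * ennreal (pnorm ((x, t) - (y, d)) powr (- real DIM('a)) * u y d)) \<in> borel_measurable borel"
        proof (intro borel_measurable_indicator_ennreal continuous_on_mult)
          have "d \<in> {0<..<t}" using d by auto
          from continuous_on_slice[OF C21_on_continuous(1)[OF uC] this]
          show "continuous_on (cball 0 3) (\<lambda>y. u y d)" by (rule continuous_on_subset) auto
          have "0 < pnorm ((x, t) - (y, d))" for y by (rule pnorm_pos_time) (use d in auto)
          hence "pnorm ((x, t) - (y, d)) \<noteq> 0" for y by (metis less_irrefl)
          thus "continuous_on (cball 0 3) (\<lambda>y. pnorm ((x, t) - (y, d)) powr (- real DIM('a)))"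
            by (intro continuous_intros) auto
        qed auto
        have "ennreal (F d) \<le> (\<integral>\<^sup>+y. ennreal Ck * (indicator (cball 0 3) y * ennreal (pnorm ((x, t) - (y, d)) powr (- real DIM('a)) * u y d)) \<partial>lborel)"
          unfolding Feq[OF d]
        proof (intro nn_integral_mono)
          fix y :: 'a
          have "u y d * phi y d \<le> u y d * (Ck * pnorm ((x, t) - (y, d)) powr (- real DIM('a)))"
            using bnd[OF d(2)] nonneg[of d y] d t by (intro mult_left_mono) auto
          thus "indicator (cball 0 3) y * ennreal (u y d * phi y d)
            \<le> ennreal Ck * (indicator (cball 0 3) y * ennreal (pnorm ((x, t) - (y, d)) powr (- real DIM('a)) * u y d))"
            using Ck nonneg[of d y] d t
            by (auto simp: indicator_def mult_ac simp flip: ennreal_mult intro!: ennreal_leI)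
        qed
        also have "\<dots> = ennreal Ck * A1" unfolding A1_def using m by (intro nn_integral_cmult) simp
        finally show ?thesis .
      qed
      also have "ennreal (LINT p:?Q|lborel. q' p) \<le> ennreal Ck * A2 + ennreal (Ce * M)"
      proof -
        let ?f1 = "\<lambda>p. indicator ?Q p * ennreal (pnorm ((x, t) - p) powr (- real DIM('a)) * src p)"
        let ?f2 = "\<lambda>p. indicator ?Q p * ennreal (u (fst p) (snd p))"
        have m1: "?f1 \<in> borel_measurable borel"
        proof (intro borel_measurable_indicator_ennreal continuous_on_mult)
          show "continuous_on ?Q src" by (rule continuous_on_subset[OF continuous_on_src]) (use sub t in auto)
          have "0 < pnorm ((x, t) - p)" if "p \<in> ?Q" for p by (rule pnorm_pos_time) (use t' that in auto)
          hence "pnorm ((x, t) - p) \<noteq> 0" if "p \<in> ?Q" for p using that by (metis less_irrefl)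
          thus "continuous_on ?Q (\<lambda>p. pnorm ((x, t) - p) powr (- real DIM('a)))"
            by (intro continuous_intros) auto
        qed (intro borel_closed closed_Times; simp)
        have m2: "?f2 \<in> borel_measurable borel"
          by (intro borel_measurable_indicator_ennreal continuous_on_subset[OF C21_on_continuous(1)[OF uC] sub] borel_closed closed_Times) auto
        have "ennreal (LINT p:?Q|lborel. q' p) = (\<integral>\<^sup>+p. indicator ?Q p * ennreal (q' p) \<partial>lborel)"
          using uphi Ce by (intro ennreal_set_integral q'i) (auto simp: q'_def)
        also have "\<dots> \<le> (\<integral>\<^sup>+p. ennreal Ck * ?f1 p + ennreal Ce * ?f2 p \<partial>lborel)"
        proof (intro nn_integral_mono)
          fix p :: "'a \<times> real"
          show "indicator ?Q p * ennreal (q' p) \<le> ennreal Ck * ?f1 p + ennreal Ce * ?f2 p"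
          proof (cases "p \<in> ?Q")
            case True
            have "phi (fst p) (snd p) * src p \<le> Ck * pnorm ((x, t) - p) powr (- real DIM('a)) * src p"
              using bnd[of "snd p" "fst p"] True t' uphi[OF True] by (intro mult_right_mono) auto
            hence "q' p \<le> Ck * (pnorm ((x, t) - p) powr (- real DIM('a)) * src p) + Ce * u (fst p) (snd p)"
              by (simp add: q'_def mult.assoc)
            hence "ennreal (q' p) \<le> ennreal Ck * ennreal (pnorm ((x, t) - p) powr (- real DIM('a)) * src p) + ennreal Ce * ennreal (u (fst p) (snd p))"
              using Ck Ce uphi[OF True] by (simp add: ennreal_leI flip: ennreal_mult ennreal_plus)
            thus ?thesis using True by simp
          qed simp
        qed
        also have "\<dots> = ennreal Ck * (\<integral>\<^sup>+p. ?f1 p \<partial>lborel) + ennreal Ce * (\<integral>\<^sup>+p. ?f2 p \<partial>lborel)"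
          using m1 m2 by (simp add: nn_integral_add nn_integral_cmult)
        also have "\<dots> \<le> ennreal Ck * A2 + ennreal Ce * ennreal M"
        proof (intro add_mono mult_left_mono)
          show "(\<integral>\<^sup>+p. ?f1 p \<partial>lborel) \<le> A2" unfolding A2_def
            using t' by (intro nn_integral_mono mult_right_mono) (auto simp: indicator_def)
          show "(\<integral>\<^sup>+p. ?f2 p \<partial>lborel) \<le> ennreal M"
            using d t t' M(2)
            by (intro nn_integral_Times_le[where h=u] continuous_on_subset[OF C21_on_continuous(1)[OF uC] sub]) auto
        qed auto
        also have "ennreal Ce * ennreal M = ennreal (Ce * M)" using Ce M by (simp add: ennreal_mult)
        finally show ?thesis .
      qed
      also have "ennreal Ck * A1 + (ennreal Ck * A2 + ennreal (Ce * M)) \<le> ennreal C * A1 + (ennreal C * A2 + ennreal C)"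
        using C by (intro add_mono mult_right_mono ennreal_leI) auto
      also have "\<dots> = ennreal C * (1 + A1 + A2)" by (simp add: algebra_simps)
      finally show ?thesis by simp
    qed
    have le: "ennreal (c * (u x t - \<delta>)) \<le> ennreal C * (1 + A1 + A2)" if \<delta>: "0 < \<delta>" for \<delta>
    proof -
      obtain t' where t': "d < t'" "t' < t" "ennreal (c * (u x t - \<delta>)) \<le>
         (\<integral>\<^sup>+y. indicator (cball 0 (12/5)) y * ennreal (heat_kernel (x - y) (t - t') * u y t') \<partial>lborel)"
        using low[OF x d t \<delta>] by blast
      note t'(3)
      also have "(\<integral>\<^sup>+y. indicator (cball 0 (12/5)) y * ennreal (heat_kernel (x - y) (t - t') * u y t') \<partial>lborel)
          \<le> ennreal (F t')"
      proof -
        have "0 < t'" using d t' by simp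
        show ?thesis unfolding Feq[OF \<open>0 < t'\<close> t'(2)]
          using phi3[OF t'(2)] by (intro nn_integral_mono) (auto simp: indicator_def mult.commute)
      qed
      also have "\<dots> \<le> ennreal C * (1 + A1 + A2)" by (rule key[OF t'(1,2)])
      finally show ?thesis .
    qed
    have "ennreal (c * u x t) \<le> ennreal C * (1 + A1 + A2)"
    proof (cases "ennreal C * (1 + A1 + A2) = top")
      case False
      then obtain r where r: "0 \<le> r" "ennreal C * (1 + A1 + A2) = ennreal r" by (metis ennreal_cases)
      have "c * (u x t - \<delta>) \<le> r" if "0 < \<delta>" for \<delta>
        using le[OF that] r by (auto simp: ennreal_le_iff2)
      hence "u x t \<le> r / c + \<delta>" if "0 < \<delta>" for \<delta> using that c by (simp add: field_simps)
      hence "u x t \<le> r / c" by (rule field_le_epsilon)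
      thus ?thesis unfolding r(2) using c by (intro ennreal_leI) (simp add: field_simps)
    qed simp
    hence "ennreal (1 / c) * ennreal (c * u x t) \<le> ennreal (1 / c) * (ennreal C * (1 + A1 + A2))"
      by (rule mult_left_mono) simp
    moreover have "ennreal (1 / c) * ennreal (c * u x t) = ennreal (u x t)"
      using c nonneg[of t x] d t by (simp flip: ennreal_mult)
    moreover have "ennreal (1 / c) * (ennreal C * (1 + A1 + A2)) = ennreal (C / c) * (1 + A1 + A2)"
      using c C by (simp add: mult.assoc[symmetric] flip: ennreal_mult)
    ultimately show "ennreal (u x t) \<le> ennreal (C / c) * (1
        + (\<integral>\<^sup>+y. indicator (cball 0 3) y * ennreal (pnorm ((x, t) - (y, d)) powr (- real DIM('a)) * u y d) \<partial>lborel)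
        + (\<integral>\<^sup>+p. indicator (cball 0 3 \<times> {d..<t}) p * ennreal (pnorm ((x, t) - p) powr (- real DIM('a)) * src p) \<partial>lborel))"
      unfolding A1_def A2_def by simp
  qed
qed

end

subsection \<open>Weighted integrability of powers\<close>

text \<open>The larger of the two bases may be replaced by the smaller one. This turns a product of
  singular kernels with different poles into a sum of kernels with one pole each.\<close>

lemma powr_product_le:
  fixes x y :: real
  assumes "0 \<le> x" "0 \<le> y" "0 \<le> th" "0 \<le> be"
  shows "x powr (- th) * y powr (- be) \<le> x powr (- (th + be)) + y powr (- (th + be))"
proof (cases "x = 0 \<or> y = 0")
  case False
  hence xy: "0 < x" "0 < y" using assms by auto
  have e: "z powr (- th) * z powr (- be) = z powr (- (th + be))" for z :: real
    by (simp flip: powr_add)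
  show ?thesis
  proof (cases "x \<le> y")
    case True
    have "x powr (- th) * y powr (- be) \<le> x powr (- th) * x powr (- be)"
      using True xy assms by (intro mult_left_mono powr_mono2') auto
    thus ?thesis unfolding e by (simp add: add_increasing2)
  next
    case False
    have "x powr (- th) * y powr (- be) \<le> y powr (- th) * y powr (- be)"
      using False xy assms by (intro mult_right_mono powr_mono2') auto
    thus ?thesis unfolding e by (simp add: add_increasing)
  qed
qed auto

text \<open>The point is uniformity in both poles: after \<open>powr_product_le\<close> each summand
  is a translate of one integrable power. Radius 6 exceeds every parabolic distance that occurs, at
  most 3 + 2 in space and 1 in the square root of time. The case \<open>be = 0\<close> covers a
  single kernel.\<close>

lemma nn_integral_two_kernels_le:
  fixes th be :: real
  assumes "0 < th" "0 \<le> be" "th + be < real DIM('a::euclidean_space) + 2"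
  obtains K where "0 < K"
    "\<And>p z :: 'a \<times> real. p \<in> cball 0 3 \<times> {0..1} \<Longrightarrow> z \<in> cball 0 3 \<times> {0..1} \<Longrightarrow>
      (\<integral>\<^sup>+q. indicator (cball 0 2 \<times> {0<..1}) q *
        (ennreal (pnorm (p - q) powr (- th)) * ennreal (pnorm (q - z) powr (- be))) \<partial>lborel) \<le> ennreal K"
proof -
  define b where "b = th + be"
  obtain C where C: "0 < C"
    "\<And>R. 0 < R \<Longrightarrow> (\<integral>\<^sup>+ p. indicator {p :: 'a \<times> real. pnorm p < R} p * ennreal (pnorm p powr (- b)) \<partial>lborel)
       \<le> ennreal (C * R powr (real DIM('a) + 2 - b))"
    using nn_integral_pnorm_powr_le[of b, where 'a='a] assms by (auto simp: b_def)
  define K where "K = C * 6 powr (real DIM('a) + 2 - b)"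
  have one: "(\<integral>\<^sup>+q. indicator {q. pnorm (z - q) < 6} q * ennreal (pnorm (z - q) powr (- b)) \<partial>lborel) \<le> ennreal K"
    for z :: "'a \<times> real"
    unfolding nn_integral_pnorm_shift K_def by (rule C) simp
  have near: "pnorm (p - q) < 6" if "p \<in> cball 0 3 \<times> {0..1}" "q \<in> cball 0 2 \<times> {0<..1}" for p q :: "'a \<times> real"
  proof -
    have "norm (fst p - fst q) \<le> 5" using that norm_triangle_ineq4[of "fst p" "fst q"] by auto
    moreover have "sqrt \<bar>snd p - snd q\<bar> \<le> 1" using that by auto
    ultimately show ?thesis unfolding pnorm_def max_less_iff_conj fst_diff snd_diff by linarith
  qed
  show ?thesis
  proof (rule that[of "2 * K"])
    show "0 < 2 * K" using C by (simp add: K_def)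
    fix p z :: "'a \<times> real" assume p: "p \<in> cball 0 3 \<times> {0..1}" and z: "z \<in> cball 0 3 \<times> {0..1}"
    have "(\<integral>\<^sup>+q. indicator (cball 0 2 \<times> {0<..1}) q *
        (ennreal (pnorm (p - q) powr (- th)) * ennreal (pnorm (q - z) powr (- be))) \<partial>lborel)
       \<le> (\<integral>\<^sup>+q. indicator {q. pnorm (p - q) < 6} q * ennreal (pnorm (p - q) powr (- b))
           + indicator {q. pnorm (z - q) < 6} q * ennreal (pnorm (z - q) powr (- b)) \<partial>lborel)"
    proof (intro nn_integral_mono)
      fix q :: "'a \<times> real"
      show "indicator (cball 0 2 \<times> {0<..1}) q * (ennreal (pnorm (p - q) powr (- th)) * ennreal (pnorm (q - z) powr (- be)))
        \<le> indicator {q. pnorm (p - q) < 6} q * ennreal (pnorm (p - q) powr (- b))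
           + indicator {q. pnorm (z - q) < 6} q * ennreal (pnorm (z - q) powr (- b))"
      proof (cases "q \<in> cball 0 2 \<times> {0<..1}")
        case True
        have "pnorm (p - q) powr (- th) * pnorm (z - q) powr (- be) \<le> pnorm (p - q) powr (- b) + pnorm (z - q) powr (- b)"
          unfolding b_def using assms by (intro powr_product_le) auto
        hence "ennreal (pnorm (p - q) powr (- th)) * ennreal (pnorm (q - z) powr (- be))
            \<le> ennreal (pnorm (p - q) powr (- b)) + ennreal (pnorm (z - q) powr (- b))"
          by (simp add: pnorm_minus_commute[of q z] ennreal_leI flip: ennreal_mult ennreal_plus)
        thus ?thesis using True near[OF p True] near[OF z True] by simp
      qed simp
    qed
    also have "\<dots> = (\<integral>\<^sup>+q. indicator {q. pnorm (p - q) < 6} q * ennreal (pnorm (p - q) powr (- b)) \<partial>lborel)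
           + (\<integral>\<^sup>+q. indicator {q. pnorm (z - q) < 6} q * ennreal (pnorm (z - q) powr (- b)) \<partial>lborel)"
      by (intro nn_integral_add) measurable
    also have "\<dots> \<le> ennreal K + ennreal K" by (intro add_mono one)
    also have "\<dots> = ennreal (2 * K)" using C by (simp add: K_def flip: ennreal_plus)
    finally show "(\<integral>\<^sup>+q. indicator (cball 0 2 \<times> {0<..1}) q *
        (ennreal (pnorm (p - q) powr (- th)) * ennreal (pnorm (q - z) powr (- be))) \<partial>lborel) \<le> ennreal (2 * K)" .
  qed
qed

text \<open>Tonelli: the integral in \<open>q\<close> is taken first, where the bound is uniform
  over the pole. The map \<open>P\<close> places the mass in space-time, as \<open>(y, d)\<close>
  for a time slice and as the identity for the source.\<close>

lemma nn_integral_kernel_potential_le: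
  fixes W :: "'z::euclidean_space \<Rightarrow> ennreal" and P :: "'z \<Rightarrow> 'a::euclidean_space \<times> real"
  assumes [measurable]: "W \<in> borel_measurable borel" "P \<in> borel_measurable borel"
    and K: "\<And>z. z \<in> cball 0 3 \<times> {0..1} \<Longrightarrow>
      (\<integral>\<^sup>+q. indicator (cball 0 2 \<times> {0<..1}) q *
        (ennreal (pnorm (p - q) powr (- th)) * ennreal (pnorm (q - z) powr (- be))) \<partial>lborel) \<le> ennreal K"
    and supp: "\<And>z. W z \<noteq> 0 \<Longrightarrow> P z \<in> cball 0 3 \<times> {0..1}"
  shows "(\<integral>\<^sup>+q. indicator (cball 0 2 \<times> {0<..1}) q * ennreal (pnorm (p - q) powr (- th)) *
      (\<integral>\<^sup>+z. ennreal (pnorm (q - P z) powr (- be)) * W z \<partial>lborel) \<partial>lborel) \<le> ennreal K * (\<integral>\<^sup>+z. W z \<partial>lborel)"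
proof -
  let ?I = "\<lambda>q::'a \<times> real. indicator (cball 0 2 \<times> {0<..1}) q :: ennreal"
  have [measurable]: "?I \<in> borel_measurable borel" by (intro borel_measurable_indicator borel_Times) auto
  have "(\<integral>\<^sup>+q. ?I q * ennreal (pnorm (p - q) powr (- th)) *
      (\<integral>\<^sup>+z. ennreal (pnorm (q - P z) powr (- be)) * W z \<partial>lborel) \<partial>lborel)
    = (\<integral>\<^sup>+q. \<integral>\<^sup>+z. ?I q * ennreal (pnorm (p - q) powr (- th)) *
        (ennreal (pnorm (q - P z) powr (- be)) * W z) \<partial>lborel \<partial>lborel)"
    by (intro nn_integral_cong nn_integral_cmult[symmetric]) measurable
  also have "\<dots> = (\<integral>\<^sup>+z. \<integral>\<^sup>+q. ?I q * ennreal (pnorm (p - q) powr (- th)) *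
        (ennreal (pnorm (q - P z) powr (- be)) * W z) \<partial>lborel \<partial>lborel)"
    by (intro lborel_pair.Fubini'[symmetric]) measurable
  also have "\<dots> = (\<integral>\<^sup>+z. W z * (\<integral>\<^sup>+q. ?I q * (ennreal (pnorm (p - q) powr (- th)) *
        ennreal (pnorm (q - P z) powr (- be))) \<partial>lborel) \<partial>lborel)"
    by (intro nn_integral_cong) (simp add: nn_integral_cmult[symmetric] mult_ac)
  also have "\<dots> \<le> (\<integral>\<^sup>+z. ennreal K * W z \<partial>lborel)"
  proof (intro nn_integral_mono)
    fix z :: 'z
    show "W z * (\<integral>\<^sup>+q. ?I q * (ennreal (pnorm (p - q) powr (- th)) *
        ennreal (pnorm (q - P z) powr (- be))) \<partial>lborel) \<le> ennreal K * W z"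
    proof (cases "W z = 0")
      case False
      thus ?thesis using mult_left_mono[OF K[OF supp[OF False]], of "W z"] by (simp add: mult_ac)
    qed simp
  qed
  also have "\<dots> = ennreal K * (\<integral>\<^sup>+z. W z \<partial>lborel)" by (intro nn_integral_cmult) measurable
  finally show ?thesis .
qed

text \<open>Where \<open>k\<close> exceeds the level \<open>c\<close>, the factor
  \<open>(k / c) powr (l - 1)\<close> is at least 1.\<close>

lemma le_add_powr_mult:
  fixes k c l :: real
  assumes "0 \<le> k" "0 < c" "1 \<le> l"
  shows "k \<le> c + c powr (1 - l) * k powr l"
proof (cases "k \<le> c")
  case True thus ?thesis by (simp add: add_increasing2)
next
  case False
  hence k: "0 < k" using assms by simp
  have "k = k powr (1 - l) * k powr l" using k by (simp flip: powr_add)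
  also have "\<dots> \<le> c powr (1 - l) * k powr l"
    using powr_mono2'[of "1 - l" c k] False assms by (intro mult_right_mono) auto
  finally show ?thesis using assms by simp
qed

lemma nn_integral_potential_split:
  fixes W :: "'z::euclidean_space \<Rightarrow> ennreal" and k :: "'z \<Rightarrow> real"
  assumes [measurable]: "W \<in> borel_measurable borel" "k \<in> borel_measurable borel"
    and "\<And>z. 0 \<le> k z" "0 < c" "1 \<le> l"
  shows "(\<integral>\<^sup>+z. ennreal (k z) * W z \<partial>lborel)
     \<le> ennreal c * (\<integral>\<^sup>+z. W z \<partial>lborel) + ennreal (c powr (1 - l)) * (\<integral>\<^sup>+z. ennreal (k z powr l) * W z \<partial>lborel)"
proof -
  have "(\<integral>\<^sup>+z. ennreal (k z) * W z \<partial>lborel)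
     \<le> (\<integral>\<^sup>+z. ennreal c * W z + ennreal (c powr (1 - l)) * (ennreal (k z powr l) * W z) \<partial>lborel)"
  proof (intro nn_integral_mono)
    fix z
    have "ennreal (k z) \<le> ennreal (c + c powr (1 - l) * k z powr l)"
      using assms by (intro ennreal_leI le_add_powr_mult) auto
    also have "\<dots> = ennreal c + ennreal (c powr (1 - l)) * ennreal (k z powr l)"
      using assms by (simp add: ennreal_mult)
    finally show "ennreal (k z) * W z \<le> ennreal c * W z + ennreal (c powr (1 - l)) * (ennreal (k z powr l) * W z)"
      using mult_right_mono[of "ennreal (k z)" _ "W z"] by (fastforce simp: algebra_simps)
  qed
  also have "\<dots> = ennreal c * (\<integral>\<^sup>+z. W z \<partial>lborel) + ennreal (c powr (1 - l)) * (\<integral>\<^sup>+z. ennreal (k z powr l) * W z \<partial>lborel)"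
    by (subst nn_integral_add) (auto simp: nn_integral_cmult)
  finally show ?thesis .
qed

text \<open>A substitute for Jensen's inequality: the kernel is split at a level proportional
  to \<open>v\<close>, and the lower part is absorbed.\<close>
lemma powr_le_of_potential_split:
  fixes v C M l :: real and A B :: ennreal
  assumes v: "0 \<le> v" and C: "0 < C" and M: "0 < M" and l: "1 \<le> l"
    and vA: "ennreal v \<le> ennreal C * (1 + A)"
    and AB: "\<And>c. 0 < c \<Longrightarrow> A \<le> ennreal c * ennreal M + ennreal (c powr (1 - l)) * B"
  shows "ennreal (v powr l) \<le> ennreal ((4 * C) powr l + 4 * C * (4 * C * M) powr (l - 1)) * (1 + B)"
proof (cases "B = top \<or> v \<le> 4 * C")
  case True
  let ?D = "(4 * C) powr l + 4 * C * (4 * C * M) powr (l - 1)"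
  have D: "0 < ?D" using C M by (simp add: add_pos_nonneg)
  show ?thesis
  proof (cases "B = top")
    case True
    thus ?thesis using D by (simp add: ennreal_mult_top)
  next
    case False
    hence "v \<le> 4 * C" using True by simp
    hence "v powr l \<le> (4 * C) powr l" using v l by (intro powr_mono2) auto
    also have "\<dots> \<le> ?D" using C M by simp
    finally have "ennreal (v powr l) \<le> ennreal ?D * 1" by (simp add: ennreal_leI)
    also have "\<dots> \<le> ennreal ?D * (1 + B)" by (intro mult_left_mono) auto
    finally show ?thesis .
  qed
next
  case False
  then obtain b where b: "0 \<le> b" "B = ennreal b" by (metis ennreal_cases)
  have v4: "4 * C < v" and v0: "0 < v" using False C by auto
  \<comment> \<open>At this level \<open>C * (c * M) = v / 4\<close>, and \<open>C < v / 4\<close>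
    in the present case, so the term with \<open>b\<close> has to carry at least
    \<open>v / 4\<close>.\<close>
  define c where "c = v / (4 * C * M)"
  have c: "0 < c" using v0 C M by (simp add: c_def)
  have "ennreal v \<le> ennreal C * (1 + (ennreal c * ennreal M + ennreal (c powr (1 - l)) * B))"
    using vA AB[OF c] by (meson add_left_mono mult_left_mono order_trans zero_le)
  also have "\<dots> = ennreal (C * (1 + (c * M + c powr (1 - l) * b)))"
    using C M c b by (simp add: ennreal_mult ennreal_plus)
  finally have "v \<le> C * (1 + (c * M + c powr (1 - l) * b))"
    using C M c b by (subst (asm) ennreal_le_iff) (auto intro!: mult_nonneg_nonneg add_nonneg_nonneg)
  moreover have "C * (c * M) = v / 4" using C M by (simp add: c_def)
  moreover have "C * (1 + (c * M + c powr (1 - l) * b)) = C + C * (c * M) + C * (c powr (1 - l) * b)"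
    by (simp add: algebra_simps)
  ultimately have "v / 4 \<le> C * (c powr (1 - l) * b)" using v4 v0 by linarith
  hence "v \<le> 4 * C * (c powr (1 - l) * b)" by simp
  hence "v * v powr (l - 1) \<le> 4 * C * (c powr (1 - l) * b) * v powr (l - 1)"
    by (rule mult_right_mono) simp
  moreover have "v * v powr (l - 1) = v powr l" using v0 by (simp add: powr_diff)
  moreover have "c powr (1 - l) * v powr (l - 1) = (4 * C * M) powr (l - 1)"
  proof -
    have "v powr (l - 1) = c powr (l - 1) * (4 * C * M) powr (l - 1)"
      using C M c by (simp add: c_def powr_mult[symmetric])
    moreover have "c powr (1 - l) * c powr (l - 1) = 1" using c by (simp flip: powr_add)
    ultimately show ?thesis by (simp add: mult.assoc[symmetric])
  qed
  ultimately have "v powr l \<le> 4 * C * (4 * C * M) powr (l - 1) * b"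
    by (simp add: mult_ac)
  also have "\<dots> \<le> ((4 * C) powr l + 4 * C * (4 * C * M) powr (l - 1)) * (1 + b)"
    using b C M by (intro mult_mono) auto
  finally have "ennreal (v powr l) \<le> ennreal (((4 * C) powr l + 4 * C * (4 * C * M) powr (l - 1)) * (1 + b))"
    by (rule ennreal_leI)
  thus ?thesis using b C M by (simp add: ennreal_mult ennreal_plus)
qed

context heat_supersolution
begin

text \<open>Extension by zero, which makes \<open>u\<close> Borel on the whole space; outside the
  strip the values of \<open>u\<close> are arbitrary.\<close>

definition ucut :: "'a \<times> real \<Rightarrow> real" where
  "ucut p = indicator (UNIV \<times> {0<..<16}) p * u (fst p) (snd p)"

lemma borel_measurable_ucut [measurable]: "ucut \<in> borel_measurable borel"
proof -
  have "(UNIV \<times> {0<..<16} :: ('a \<times> real) set) \<in> sets borel" by (intro borel_open open_Times) auto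
  from borel_measurable_continuous_on_indicator[OF this continuous_on_u]
  show ?thesis unfolding ucut_def[abs_def] by simp
qed

lemma ucut_eq: "0 < snd p \<Longrightarrow> snd p < 16 \<Longrightarrow> ucut p = u (fst p) (snd p)"
  by (cases p) (simp add: ucut_def)

text \<open>A Jensen-type inequality for the representation bound: raising to the power
  \<open>l\<close> multiplies the order of the kernel by \<open>l\<close>. The slice and the source
  are split at the same level \<open>c\<close>, so they act as one measure of mass
  \<open>2 * M\<close>.\<close>

lemma powr_potential_bound:
  fixes l :: real
  assumes l: "1 \<le> l"
  obtains C M where "0 < C" "0 < M"
    "\<And>d. 0 < d \<Longrightarrow> d < 1 \<Longrightarrow> (\<integral>\<^sup>+y. indicator (cball 0 3) y * ennreal (u y d) \<partial>lborel) \<le> ennreal M"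
    "\<And>d. 0 < d \<Longrightarrow> d < 1 \<Longrightarrow> (\<integral>\<^sup>+p. indicator (cball 0 3 \<times> {d..1}) p * ennreal (src p) \<partial>lborel) \<le> ennreal M"
    "\<And>q d. q \<in> cball 0 2 \<times> {d<..1} \<Longrightarrow> 0 < d \<Longrightarrow>
      ennreal (u (fst q) (snd q) powr l) \<le> ennreal C * (1 +
         ((\<integral>\<^sup>+y. ennreal (pnorm (q - (y, d)) powr (- (real DIM('a) * l))) * (indicator (cball 0 3) y * ennreal (u y d)) \<partial>lborel)
        + (\<integral>\<^sup>+p. ennreal (pnorm (q - p) powr (- (real DIM('a) * l))) * (indicator (cball 0 3 \<times> {d..1}) p * ennreal (src p)) \<partial>lborel)))"
proof -
  obtain M where M: "0 < M"
    "\<And>s. 0 < s \<Longrightarrow> s \<le> 1 \<Longrightarrow> (\<integral>\<^sup>+y. indicator (cball 0 3) y * ennreal (u y s) \<partial>lborel) \<le> ennreal M"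
    "\<And>s. 0 < s \<Longrightarrow> s \<le> 1 \<Longrightarrow> (\<integral>\<^sup>+p. indicator (cball 0 3 \<times> {s..1}) p * ennreal (src p) \<partial>lborel) \<le> ennreal M"
    using mass_bound by blast
  obtain C where C: "0 < C"
    "\<And>x t d. norm x \<le> 2 \<Longrightarrow> 0 < d \<Longrightarrow> d < t \<Longrightarrow> t \<le> 1 \<Longrightarrow>
      ennreal (u x t) \<le> ennreal C * (1
        + (\<integral>\<^sup>+y. indicator (cball 0 3) y * ennreal (pnorm ((x, t) - (y, d)) powr (- real DIM('a)) * u y d) \<partial>lborel)
        + (\<integral>\<^sup>+p. indicator (cball 0 3 \<times> {d..<t}) p * ennreal (pnorm ((x, t) - p) powr (- real DIM('a)) * src p) \<partial>lborel))"
    using representation_bound by blast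
  define D where "D = (4 * C) powr l + 4 * C * (4 * C * (2 * M)) powr (l - 1)"
  show ?thesis
  proof (rule that[of D M])
    show "0 < D" "0 < M" using C M by (auto simp: D_def add_pos_nonneg)
    show "(\<integral>\<^sup>+y. indicator (cball 0 3) y * ennreal (u y d) \<partial>lborel) \<le> ennreal M" if "0 < d" "d < 1" for d
      using M(2)[of d] that by simp
    show "(\<integral>\<^sup>+p. indicator (cball 0 3 \<times> {d..1}) p * ennreal (src p) \<partial>lborel) \<le> ennreal M" if "0 < d" "d < 1" for d
      using M(3)[of d] that by simp
    fix q :: "'a \<times> real" and d :: real assume q: "q \<in> cball 0 2 \<times> {d<..1}" and d: "0 < d"
    obtain x t where xt: "q = (x, t)" "norm x \<le> 2" "d < t" "t \<le> 1" using q by auto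
    define W1 where "W1 y = indicator (cball 0 3) y * ennreal (u y d)" for y
    define W2 where "W2 p = indicator (cball 0 3 \<times> {d..1}) p * ennreal (src p)" for p
    have [measurable]: "W1 \<in> borel_measurable borel" unfolding W1_def[abs_def]
    proof (intro borel_measurable_indicator_ennreal)
      have "d \<in> {0<..<16}" using d xt by auto
      from continuous_on_slice[OF continuous_on_u this]
      show "continuous_on (cball 0 3) (\<lambda>y. u y d)" by (rule continuous_on_subset) auto
    qed auto
    have [measurable]: "W2 \<in> borel_measurable borel" unfolding W2_def[abs_def]
      by (intro borel_measurable_indicator_ennreal continuous_on_subset[OF continuous_on_src] borel_closed closed_Times)
        (use d in auto)
    let ?n = "real DIM('a)"
    define A1 where "A1 = (\<integral>\<^sup>+y. ennreal (pnorm (q - (y, d)) powr (- ?n)) * W1 y \<partial>lborel)"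
    define A2 where "A2 = (\<integral>\<^sup>+p. ennreal (pnorm (q - p) powr (- ?n)) * W2 p \<partial>lborel)"
    define B1 where "B1 = (\<integral>\<^sup>+y. ennreal (pnorm (q - (y, d)) powr (- (?n * l))) * W1 y \<partial>lborel)"
    define B2 where "B2 = (\<integral>\<^sup>+p. ennreal (pnorm (q - p) powr (- (?n * l))) * W2 p \<partial>lborel)"
    have pp: "(r powr (- ?n)) powr l = r powr (- (?n * l))" for r :: real by (simp add: powr_powr)
    have uA: "ennreal (u x t) \<le> ennreal C * (1 + (A1 + A2))"
    proof -
      have "ennreal (u x t) \<le> ennreal C * (1
        + (\<integral>\<^sup>+y. indicator (cball 0 3) y * ennreal (pnorm ((x, t) - (y, d)) powr (- real DIM('a)) * u y d) \<partial>lborel)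
        + (\<integral>\<^sup>+p. indicator (cball 0 3 \<times> {d..<t}) p * ennreal (pnorm ((x, t) - p) powr (- real DIM('a)) * src p) \<partial>lborel))"
        by (rule C(2)[OF xt(2) d xt(3,4)])
      also have "\<dots> \<le> ennreal C * (1 + A1 + A2)"
      proof (intro mult_left_mono add_mono order_refl)
        show "(\<integral>\<^sup>+y. indicator (cball 0 3) y * ennreal (pnorm ((x, t) - (y, d)) powr (- real DIM('a)) * u y d) \<partial>lborel) \<le> A1"
          unfolding A1_def W1_def xt(1)
          by (intro nn_integral_mono) (simp add: ennreal_mult'' ennreal_mult' mult_ac)
        show "(\<integral>\<^sup>+p. indicator (cball 0 3 \<times> {d..<t}) p * ennreal (pnorm ((x, t) - p) powr (- real DIM('a)) * src p) \<partial>lborel) \<le> A2"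
          unfolding A2_def W2_def xt(1) using xt(4)
          by (intro nn_integral_mono) (auto simp: indicator_def ennreal_mult'' ennreal_mult' mult_ac)
      qed auto
      finally show ?thesis by (simp add: add.assoc)
    qed
    have AB: "A1 + A2 \<le> ennreal c * ennreal (2 * M) + ennreal (c powr (1 - l)) * (B1 + B2)" if c: "0 < c" for c
    proof -
      have "A1 \<le> ennreal c * (\<integral>\<^sup>+z. W1 z \<partial>lborel) + ennreal (c powr (1 - l)) * B1"
        unfolding A1_def B1_def pp[symmetric] using c l by (intro nn_integral_potential_split) auto
      also have "\<dots> \<le> ennreal c * ennreal M + ennreal (c powr (1 - l)) * B1"
        using M(2)[of d] d xt by (intro add_mono mult_left_mono) (auto simp: W1_def)
      finally have 1: "A1 \<le> ennreal c * ennreal M + ennreal (c powr (1 - l)) * B1" .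
      have "A2 \<le> ennreal c * (\<integral>\<^sup>+z. W2 z \<partial>lborel) + ennreal (c powr (1 - l)) * B2"
        unfolding A2_def B2_def pp[symmetric] using c l by (intro nn_integral_potential_split) auto
      also have "\<dots> \<le> ennreal c * ennreal M + ennreal (c powr (1 - l)) * B2"
        using M(3)[of d] d xt by (intro add_mono mult_left_mono) (auto simp: W2_def)
      finally have 2: "A2 \<le> ennreal c * ennreal M + ennreal (c powr (1 - l)) * B2" .
      have "ennreal (2 * M) = ennreal M + ennreal M" using M by (simp flip: ennreal_plus)
      thus ?thesis using add_mono[OF 1 2] by (simp add: algebra_simps)
    qed
    have "ennreal (u x t powr l) \<le> ennreal D * (1 + (B1 + B2))"
      unfolding D_def using nonneg[of t x] d xt C M l uA AB
      by (intro powr_le_of_potential_split[where A="A1 + A2"]) auto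
    thus "ennreal (u (fst q) (snd q) powr l) \<le> ennreal D * (1 +
         ((\<integral>\<^sup>+y. ennreal (pnorm (q - (y, d)) powr (- (real DIM('a) * l))) * (indicator (cball 0 3) y * ennreal (u y d)) \<partial>lborel)
        + (\<integral>\<^sup>+p. ennreal (pnorm (q - p) powr (- (real DIM('a) * l))) * (indicator (cball 0 3 \<times> {d..1}) p * ennreal (src p)) \<partial>lborel)))"
      unfolding B1_def B2_def W1_def W2_def xt(1) by simp
  qed
qed

text \<open>After Tonelli, the weight of order \<open>th\<close> and the kernel of order
  \<open>n * l\<close> meet in one integral over \<open>q\<close>, which is finite because the
  orders add up to less than n + 2. The constant is free of the starting time \<open>d\<close>, and
  monotone convergence then removes \<open>d\<close>.\<close>

lemma weighted_powr_bound:
  fixes th l :: real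
  assumes th: "0 < th" and l: "1 \<le> l" and thl: "th + real DIM('a) * l < real DIM('a) + 2"
  obtains C where "0 < C" "\<And>p. p \<in> cball 0 3 \<times> {0..1} \<Longrightarrow>
     (\<integral>\<^sup>+q. indicator (cball 0 2 \<times> {0<..1}) q * ennreal (pnorm (p - q) powr (- th) * u (fst q) (snd q) powr l) \<partial>lborel) \<le> ennreal C"
proof -
  obtain C M where C: "0 < C" and M: "0 < M"
    "\<And>d. 0 < d \<Longrightarrow> d < 1 \<Longrightarrow> (\<integral>\<^sup>+y. indicator (cball 0 3) y * ennreal (u y d) \<partial>lborel) \<le> ennreal M"
    "\<And>d. 0 < d \<Longrightarrow> d < 1 \<Longrightarrow> (\<integral>\<^sup>+p. indicator (cball 0 3 \<times> {d..1}) p * ennreal (src p) \<partial>lborel) \<le> ennreal M"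
   and pw: "\<And>q d. q \<in> cball 0 2 \<times> {d<..1} \<Longrightarrow> 0 < d \<Longrightarrow>
      ennreal (u (fst q) (snd q) powr l) \<le> ennreal C * (1 +
         ((\<integral>\<^sup>+y. ennreal (pnorm (q - (y, d)) powr (- (real DIM('a) * l))) * (indicator (cball 0 3) y * ennreal (u y d)) \<partial>lborel)
        + (\<integral>\<^sup>+p. ennreal (pnorm (q - p) powr (- (real DIM('a) * l))) * (indicator (cball 0 3 \<times> {d..1}) p * ennreal (src p)) \<partial>lborel)))"
    using powr_potential_bound[OF l] by blast
  define be where "be = real DIM('a) * l"
  have be: "0 \<le> be" "th + be < real DIM('a) + 2" using l thl by (auto simp: be_def)
  obtain K where K: "0 < K"
    "\<And>p z :: 'a \<times> real. p \<in> cball 0 3 \<times> {0..1} \<Longrightarrow> z \<in> cball 0 3 \<times> {0..1} \<Longrightarrow>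
      (\<integral>\<^sup>+q. indicator (cball 0 2 \<times> {0<..1}) q *
        (ennreal (pnorm (p - q) powr (- th)) * ennreal (pnorm (q - z) powr (- be))) \<partial>lborel) \<le> ennreal K"
    using nn_integral_two_kernels_le[OF th be] by blast
  have th0: "th + 0 < real DIM('a) + 2" using be by simp
  obtain K0 where K0: "0 < K0"
    "\<And>p z :: 'a \<times> real. p \<in> cball 0 3 \<times> {0..1} \<Longrightarrow> z \<in> cball 0 3 \<times> {0..1} \<Longrightarrow>
      (\<integral>\<^sup>+q. indicator (cball 0 2 \<times> {0<..1}) q *
        (ennreal (pnorm (p - q) powr (- th)) * ennreal (pnorm (q - z) powr (- 0))) \<partial>lborel) \<le> ennreal K0"
    using nn_integral_two_kernels_le[OF th order_refl th0] by blast
  define D where "D = C * (K0 + (K * M + K * M))"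
  show ?thesis
  proof (rule that[of D])
    show "0 < D" using C K K0 M by (auto simp: D_def intro!: mult_pos_pos add_pos_pos)
    fix p :: "'a \<times> real" assume p: "p \<in> cball 0 3 \<times> {0..1}"
    let ?I = "\<lambda>q::'a \<times> real. indicator (cball 0 2 \<times> {0<..1}) q :: ennreal"
    have [measurable]: "?I \<in> borel_measurable borel" by (intro borel_measurable_indicator borel_Times) auto
    have first: "(\<integral>\<^sup>+q. ?I q * ennreal (pnorm (p - q) powr (- th)) \<partial>lborel) \<le> ennreal K0"
    proof -
      have "(\<integral>\<^sup>+q. ?I q * ennreal (pnorm (p - q) powr (- th)) \<partial>lborel)
         = (\<integral>\<^sup>+q. ?I q * (ennreal (pnorm (p - q) powr (- th)) * ennreal (pnorm (q - p) powr (- 0))) \<partial>lborel)"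
        by (intro nn_integral_cong) (auto simp: pnorm_minus_commute[of p])
      thus ?thesis using K0(2)[OF p p] by simp
    qed
    have main: "(\<integral>\<^sup>+q. indicator (cball 0 2 \<times> {d<..1}) q * ennreal (pnorm (p - q) powr (- th) * ucut q powr l) \<partial>lborel) \<le> ennreal D"
      if d: "0 < d" "d < 1" for d
    proof -
      define W1 where "W1 y = indicator (cball 0 3) y * ennreal (u y d)" for y
      define W2 where "W2 p = indicator (cball 0 3 \<times> {d..1}) p * ennreal (src p)" for p
      have [measurable]: "W1 \<in> borel_measurable borel" unfolding W1_def[abs_def]
      proof (intro borel_measurable_indicator_ennreal)
        have "d \<in> {0<..<16}" using d by auto
        from continuous_on_slice[OF continuous_on_u this]
        show "continuous_on (cball 0 3) (\<lambda>y. u y d)" by (rule continuous_on_subset) auto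
      qed auto
      have [measurable]: "W2 \<in> borel_measurable borel" unfolding W2_def[abs_def]
        by (intro borel_measurable_indicator_ennreal continuous_on_subset[OF continuous_on_src] borel_closed closed_Times)
          (use d in auto)
      define B1 where "B1 q = (\<integral>\<^sup>+y. ennreal (pnorm (q - (y, d)) powr (- be)) * W1 y \<partial>lborel)" for q
      define B2 where "B2 q = (\<integral>\<^sup>+p. ennreal (pnorm (q - p) powr (- be)) * W2 p \<partial>lborel)" for q
      have [measurable]: "B1 \<in> borel_measurable borel" "B2 \<in> borel_measurable borel"
        unfolding B1_def[abs_def] B2_def[abs_def] by measurable
      let ?T = "\<lambda>q. ?I q * ennreal (pnorm (p - q) powr (- th))"
      have "(\<integral>\<^sup>+q. indicator (cball 0 2 \<times> {d<..1}) q * ennreal (pnorm (p - q) powr (- th) * ucut q powr l) \<partial>lborel)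
        \<le> (\<integral>\<^sup>+q. ennreal C * (?T q + (?T q * B1 q + ?T q * B2 q)) \<partial>lborel)"
      proof (intro nn_integral_mono)
        fix q :: "'a \<times> real"
        show "indicator (cball 0 2 \<times> {d<..1}) q * ennreal (pnorm (p - q) powr (- th) * ucut q powr l)
           \<le> ennreal C * (?T q + (?T q * B1 q + ?T q * B2 q))"
        proof (cases "q \<in> cball 0 2 \<times> {d<..1}")
          case True
          have q: "q \<in> cball 0 2 \<times> {0<..1}" and e: "ucut q = u (fst q) (snd q)"
            using True d by (auto intro: ucut_eq)
          have "ennreal (ucut q powr l) \<le> ennreal C * (1 + (B1 q + B2 q))"
            using pw[OF True d(1)] unfolding e B1_def B2_def W1_def W2_def be_def .
          from mult_left_mono[OF this, of "ennreal (pnorm (p - q) powr (- th))"]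
          show ?thesis using True q by (simp add: ennreal_mult algebra_simps)
        qed simp
      qed
      also have "\<dots> = ennreal C * ((\<integral>\<^sup>+q. ?T q \<partial>lborel) + ((\<integral>\<^sup>+q. ?T q * B1 q \<partial>lborel) + (\<integral>\<^sup>+q. ?T q * B2 q \<partial>lborel)))"
        by (simp add: nn_integral_cmult nn_integral_add)
      also have "\<dots> \<le> ennreal C * (ennreal K0 + (ennreal K * ennreal M + ennreal K * ennreal M))"
      proof (intro mult_left_mono add_mono first)
        have "(\<integral>\<^sup>+q. ?T q * B1 q \<partial>lborel) \<le> ennreal K * (\<integral>\<^sup>+z. W1 z \<partial>lborel)"
          unfolding B1_def
          by (rule nn_integral_kernel_potential_le[where P="\<lambda>y. (y, d)", OF _ _ K(2)[OF p]])
            (measurable, use d in \<open>auto simp: W1_def indicator_def split: if_splits\<close>)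
        also have "\<dots> \<le> ennreal K * ennreal M"
          using M(2)[OF d] by (intro mult_left_mono) (auto simp: W1_def)
        finally show "(\<integral>\<^sup>+q. ?T q * B1 q \<partial>lborel) \<le> ennreal K * ennreal M" .
        have "(\<integral>\<^sup>+q. ?T q * B2 q \<partial>lborel) \<le> ennreal K * (\<integral>\<^sup>+z. W2 z \<partial>lborel)"
          unfolding B2_def
          by (rule nn_integral_kernel_potential_le[where P="\<lambda>y. y", OF _ _ K(2)[OF p]])
            (measurable, use d in \<open>auto simp: W2_def indicator_def split: if_splits\<close>)
        also have "\<dots> \<le> ennreal K * ennreal M"
          using M(3)[OF d] by (intro mult_left_mono) (auto simp: W2_def)
        finally show "(\<integral>\<^sup>+q. ?T q * B2 q \<partial>lborel) \<le> ennreal K * ennreal M" .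
      qed auto
      also have "\<dots> = ennreal D" using C K(1) K0(1) M(1) by (simp add: D_def mult_2[symmetric] ennreal_mult ennreal_plus)
      finally show ?thesis .
    qed
    \<comment> \<open>The doubled successor makes the sequence start at 1/2, since
      \<open>main\<close> asks for \<open>d < 1\<close>.\<close>
    define h where "h k = inverse (real (Suc (Suc k)))" for k
    have h: "0 < h k" "h k < 1" for k by (auto simp: h_def field_simps)
    define f where "f k q = indicator (cball 0 2 \<times> {h k<..1}) q * ennreal (pnorm (p - q) powr (- th) * ucut q powr l)" for k q
    have [measurable]: "f k \<in> borel_measurable borel" for k
    proof -
      have [measurable]: "(indicator (cball 0 2 \<times> {h k<..1}) :: 'a \<times> real \<Rightarrow> ennreal) \<in> borel_measurable borel"
        by (intro borel_measurable_indicator borel_Times) auto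
      show ?thesis unfolding f_def[abs_def] by measurable
    qed
    have inc: "incseq f"
    proof (intro incseq_SucI le_funI)
      fix k q
      have "h (Suc k) \<le> h k" by (simp add: h_def field_simps)
      thus "f k q \<le> f (Suc k) q" unfolding f_def by (intro mult_right_mono) (auto simp: indicator_def)
    qed
    have "(\<integral>\<^sup>+q. indicator (cball 0 2 \<times> {0<..1}) q * ennreal (pnorm (p - q) powr (- th) * u (fst q) (snd q) powr l) \<partial>lborel)
       \<le> (\<integral>\<^sup>+q. (SUP k. f k q) \<partial>lborel)"
    proof (intro nn_integral_mono)
      fix q :: "'a \<times> real"
      show "indicator (cball 0 2 \<times> {0<..1}) q * ennreal (pnorm (p - q) powr (- th) * u (fst q) (snd q) powr l) \<le> (SUP k. f k q)"
      proof (cases "q \<in> cball 0 2 \<times> {0<..1}")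
        case True
        hence "0 < snd q" by auto
        then obtain k where k: "inverse (real (Suc k)) < snd q" using reals_Archimedean by blast
        have "h k \<le> inverse (real (Suc k))" by (simp add: h_def field_simps)
        hence "q \<in> cball 0 2 \<times> {h k<..1}" using True k by auto
        moreover have "ucut q = u (fst q) (snd q)" using True by (intro ucut_eq) auto
        ultimately have "indicator (cball 0 2 \<times> {0<..1}) q * ennreal (pnorm (p - q) powr (- th) * u (fst q) (snd q) powr l) = f k q"
          using True by (simp add: f_def)
        thus ?thesis using SUP_upper[of k UNIV "\<lambda>k. f k q"] by simp
      qed simp
    qed
    also have "\<dots> = (SUP k. integral\<^sup>N lborel (f k))"
      by (intro nn_integral_monotone_convergence_SUP inc) measurable
    also have "\<dots> \<le> ennreal D"
      unfolding f_def[abs_def] by (intro SUP_least main h)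
    finally show "(\<integral>\<^sup>+q. indicator (cball 0 2 \<times> {0<..1}) q * ennreal (pnorm (p - q) powr (- th) * u (fst q) (snd q) powr l) \<partial>lborel) \<le> ennreal D" .
  qed
qed

end

subsection \<open>The nonlocal source and the doubling argument\<close>

text \<open>The exponent conditions are multiplied through by \<open>n\<close>, the form in which
  they combine with orders of homogeneity.\<close>

locale heat_power_source = heat_supersolution u ut g H
  for u ut :: "'a::euclidean_space \<Rightarrow> real \<Rightarrow> real"
    and g :: "'a \<Rightarrow> real \<Rightarrow> 'a" and H :: "'a \<Rightarrow> real \<Rightarrow> 'a \<Rightarrow> 'a" +
  fixes n a lam sig :: real
  assumes n_def: "n = real DIM('a)"
    and ha: "0 < a" "a < n + 2"
    and hlam: "n + 2 - a \<le> n * lam" "n * lam < n + 2"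
    and hsig: "0 \<le> sig" "a + n * lam + n * sig < 2 * (n + 2)"
    and L_lam: "set_integrable lborel (UNIV \<times> {0<..<16::real}) (\<lambda>p. \<bar>u (fst p) (snd p)\<bar> powr lam)"
    and upper: "\<And>x t. x \<in> ball 0 4 \<Longrightarrow> 0 < t \<Longrightarrow> t < 16 \<Longrightarrow>
        ennreal (ut x t - laplacian H x t) \<le>
          (\<integral>\<^sup>+ p. indicator (UNIV \<times> {0<..<16}) p *
              ennreal (heat_kernel (x - fst p) (t - snd p) powr (a / n)
                       * u (fst p) (snd p) powr lam) \<partial>lborel)
          * ennreal (rpow (u x t) sig)"
begin

lemma n_pos: "0 < n" unfolding n_def by simp

lemma lam_pos: "0 < lam"
  using hlam(1) ha n_pos by (smt (verit) zero_less_mult_pos)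

text \<open>For \<open>lam < 1\<close>, let \<open>r\<close> be the distance to the pole. Where
  \<open>u \<le> r powr (- n)\<close>, the integrand is at most \<open>r powr (- b)\<close>;
  elsewhere \<open>u powr lam \<le> u * r powr (n - n * lam)\<close>, which reduces to the first
  power of \<open>u\<close> with a weight of order \<open>c = b - n\<close>. The hypothesis
  \<open>n < th + n * lam\<close> makes \<open>c\<close> positive.\<close>

lemma weighted_lam_bound:
  fixes th :: real
  assumes th: "0 < th" "n < th + n * lam" "th + n * lam < n + 2"
  obtains C where "0 < C" "\<And>p. p \<in> cball 0 3 \<times> {0..1} \<Longrightarrow>
     (\<integral>\<^sup>+q. indicator (cball 0 2 \<times> {0<..1}) q * ennreal (pnorm (p - q) powr (- th) * u (fst q) (snd q) powr lam) \<partial>lborel) \<le> ennreal C"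
proof (cases "1 \<le> lam")
  case True
  thus ?thesis using weighted_powr_bound[OF th(1) True] th that unfolding n_def by blast
next
  case False
  define b where "b = th + n * lam"
  define c where "c = b - n"
  have bc: "0 < b" "b + 0 < real DIM('a) + 2" "0 < c" "c + real DIM('a) * 1 < real DIM('a) + 2"
    using th n_pos by (auto simp: b_def c_def n_def)
  obtain K where K: "0 < K"
    "\<And>p z :: 'a \<times> real. p \<in> cball 0 3 \<times> {0..1} \<Longrightarrow> z \<in> cball 0 3 \<times> {0..1} \<Longrightarrow>
      (\<integral>\<^sup>+q. indicator (cball 0 2 \<times> {0<..1}) q *
        (ennreal (pnorm (p - q) powr (- b)) * ennreal (pnorm (q - z) powr (- 0))) \<partial>lborel) \<le> ennreal K"
    using nn_integral_two_kernels_le[OF bc(1) order_refl bc(2)] by blast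
  obtain C where C: "0 < C" "\<And>p. p \<in> cball 0 3 \<times> {0..1} \<Longrightarrow>
     (\<integral>\<^sup>+q. indicator (cball 0 2 \<times> {0<..1}) q * ennreal (pnorm (p - q) powr (- c) * u (fst q) (snd q) powr 1) \<partial>lborel) \<le> ennreal C"
    using weighted_powr_bound[OF bc(3) order_refl bc(4)] by blast
  show ?thesis
  proof (rule that[of "K + C"])
    show "0 < K + C" using K C by simp
    fix p :: "'a \<times> real" assume p: "p \<in> cball 0 3 \<times> {0..1}"
    let ?I = "\<lambda>q::'a \<times> real. indicator (cball 0 2 \<times> {0<..1}) q :: ennreal"
    have [measurable]: "?I \<in> borel_measurable borel" by (intro borel_measurable_indicator borel_Times) auto
    have "(\<integral>\<^sup>+q. ?I q * ennreal (pnorm (p - q) powr (- th) * u (fst q) (snd q) powr lam) \<partial>lborel)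
      \<le> (\<integral>\<^sup>+q. ?I q * (ennreal (pnorm (p - q) powr (- b)) * ennreal (pnorm (q - p) powr (- 0)))
           + ?I q * ennreal (pnorm (p - q) powr (- c) * ucut q powr 1) \<partial>lborel)"
    proof (intro nn_integral_mono)
      fix q :: "'a \<times> real"
      show "?I q * ennreal (pnorm (p - q) powr (- th) * u (fst q) (snd q) powr lam)
        \<le> ?I q * (ennreal (pnorm (p - q) powr (- b)) * ennreal (pnorm (q - p) powr (- 0)))
           + ?I q * ennreal (pnorm (p - q) powr (- c) * ucut q powr 1)"
      proof (cases "q \<in> cball 0 2 \<times> {0<..1}")
        case True
        have e: "ucut q = u (fst q) (snd q)" using True by (intro ucut_eq) auto
        define v where "v = u (fst q) (snd q)"
        define r where "r = pnorm (p - q)"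
        have v: "0 \<le> v" using True nonneg[of "snd q" "fst q"] by (auto simp: v_def)
        have main: "r powr (- th) * v powr lam \<le> r powr (- b) + r powr (- c) * v" if r: "0 < r"
        proof (cases "v \<le> r powr (- n)")
          case True
          have "v powr lam \<le> (r powr (- n)) powr lam" using True v lam_pos by (intro powr_mono2) auto
          hence "r powr (- th) * v powr lam \<le> r powr (- th) * r powr (- (n * lam))"
            by (intro mult_left_mono) (auto simp: powr_powr)
          also have "\<dots> = r powr (- b)" by (simp add: b_def flip: powr_add)
          finally show ?thesis using v by (simp add: add_increasing2)
        next
          case nv: False
          have "0 < r powr (- n)" using r by simp
          hence v0: "0 < v" using nv by linarith
          have "v powr lam = v * v powr (lam - 1)" using v0 by (simp add: powr_diff)
          also have "\<dots> \<le> v * (r powr (- n)) powr (lam - 1)"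
            using nv r v0 \<open>\<not> 1 \<le> lam\<close> by (intro mult_left_mono powr_mono2') auto
          also have "(r powr (- n)) powr (lam - 1) = r powr (n - n * lam)"
            by (simp add: powr_powr algebra_simps)
          finally have "r powr (- th) * v powr lam \<le> r powr (- th) * (v * r powr (n - n * lam))"
            by (intro mult_left_mono) auto
          also have "\<dots> = v * (r powr (- th) * r powr (n - n * lam))" by simp
          also have "\<dots> = v * r powr (- c)" by (simp add: c_def b_def algebra_simps flip: powr_add)
          finally show ?thesis by (simp add: add_increasing mult.commute)
        qed
        show ?thesis
        proof (cases "r = 0")
          case True
          thus ?thesis by (simp add: r_def)
        next
          case False
          hence r: "0 < r" by (simp add: r_def less_le)
          hence "ennreal (r powr (- th) * v powr lam) \<le> ennreal (r powr (- b)) + ennreal (r powr (- c) * v)"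
            using main v by (simp add: ennreal_leI flip: ennreal_plus)
          \<comment> \<open>Since \<open>0 powr 0 = 0\<close>, the dummy kernel equals 1 only away
            from the pole; hence the separate case \<open>r = 0\<close>.\<close>
          moreover have "pnorm (q - p) powr (- 0) = 1" using r by (simp add: r_def pnorm_minus_commute)
          ultimately show ?thesis using True v unfolding e v_def[symmetric] r_def[symmetric] by simp
        qed
      qed simp
    qed
    also have "\<dots> = (\<integral>\<^sup>+q. ?I q * (ennreal (pnorm (p - q) powr (- b)) * ennreal (pnorm (q - p) powr (- 0))) \<partial>lborel)
           + (\<integral>\<^sup>+q. ?I q * ennreal (pnorm (p - q) powr (- c) * ucut q powr 1) \<partial>lborel)"
      by (intro nn_integral_add) measurable
    also have "(\<integral>\<^sup>+q. ?I q * ennreal (pnorm (p - q) powr (- c) * ucut q powr 1) \<partial>lborel)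
       = (\<integral>\<^sup>+q. ?I q * ennreal (pnorm (p - q) powr (- c) * u (fst q) (snd q) powr 1) \<partial>lborel)"
      by (intro nn_integral_cong) (auto simp: indicator_def ucut_eq)
    also have "(\<integral>\<^sup>+q. ?I q * (ennreal (pnorm (p - q) powr (- b)) * ennreal (pnorm (q - p) powr (- 0))) \<partial>lborel)
      + (\<integral>\<^sup>+q. ?I q * ennreal (pnorm (p - q) powr (- c) * u (fst q) (snd q) powr 1) \<partial>lborel) \<le> ennreal K + ennreal C"
      by (intro add_mono K p C)
    also have "\<dots> = ennreal (K + C)" using K C by simp
    finally show "(\<integral>\<^sup>+q. ?I q * ennreal (pnorm (p - q) powr (- th) * u (fst q) (snd q) powr lam) \<partial>lborel) \<le> ennreal (K + C)" .
  qed
qed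

text \<open>Scaling exponent: \<open>u\<close> of size \<open>r powr (- n)\<close> and a kernel of
  size \<open>r powr (- a)\<close> on a parabolic cylinder of volume about
  \<open>r powr (n + 2)\<close> give a nonlocal factor of size
  \<open>r powr (- gam)\<close>.\<close>

definition gam :: real where "gam = a + n * lam - n - 2"

lemma gam_nonneg: "0 \<le> gam" using hlam by (simp add: gam_def)

text \<open>At distance at least \<open>r\<close>, the part \<open>gam + eps\<close> of the order
  \<open>a\<close> is pulled out as a power of \<open>r\<close>, leaving a weight of order
  \<open>th\<close>. For \<open>eps = 0\<close> that weight would be critical,
  \<open>th + n * lam = n + 2\<close>. Points outside \<open>cball 0 2\<close> are at distance at
  least 1/2 and are handled by the global integrability of \<open>u powr lam\<close>.\<close>

lemma kernel_tail_bound: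
  fixes eps :: real
  assumes eps: "0 < eps" "eps < 2" "eps < n + 2 - n * lam"
  obtains C where "0 < C" "\<And>p r. p \<in> cball 0 (3/2) \<times> {0..1/2} \<Longrightarrow> 0 < r \<Longrightarrow> r \<le> 1 \<Longrightarrow>
     (\<integral>\<^sup>+q. indicator {q. 0 < snd q \<and> snd q < snd p \<and> r \<le> pnorm (p - q)} q
        * ennreal (pnorm (p - q) powr (- a) * u (fst q) (snd q) powr lam) \<partial>lborel)
     \<le> ennreal (C * r powr (- (gam + eps)))"
proof -
  define th where "th = n + 2 - n * lam - eps"
  have th: "0 < th" "n < th + n * lam" "th + n * lam < n + 2" using eps by (auto simp: th_def)
  have ath: "a = th + (gam + eps)" by (simp add: th_def gam_def)
  define L where "L = (LINT p:(UNIV \<times> {0<..<16::real})|lborel. \<bar>u (fst p) (snd p)\<bar> powr lam)"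
  have L0: "0 \<le> L" unfolding L_def set_lebesgue_integral_def by (intro Bochner_Integration.integral_nonneg) auto
  have L: "(\<integral>\<^sup>+q. indicator (UNIV \<times> {0<..<16}) q * ennreal (ucut q powr lam) \<partial>lborel) \<le> ennreal L"
  proof -
    have "ennreal L = (\<integral>\<^sup>+q. indicator (UNIV \<times> {0<..<16}) q * ennreal (\<bar>u (fst q) (snd q)\<bar> powr lam) \<partial>lborel)"
      unfolding L_def by (intro ennreal_set_integral L_lam) auto
    also have "\<dots> = (\<integral>\<^sup>+q. indicator (UNIV \<times> {0<..<16}) q * ennreal (ucut q powr lam) \<partial>lborel)"
      using nonneg by (intro nn_integral_cong) (auto simp: indicator_def ucut_eq)
    finally show ?thesis by simp
  qed
  obtain C where C: "0 < C" "\<And>p. p \<in> cball 0 3 \<times> {0..1} \<Longrightarrow>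
     (\<integral>\<^sup>+q. indicator (cball 0 2 \<times> {0<..1}) q * ennreal (pnorm (p - q) powr (- th) * u (fst q) (snd q) powr lam) \<partial>lborel) \<le> ennreal C"
    using weighted_lam_bound[OF th] by blast
  show ?thesis
  proof (rule that[of "C + 2 powr a * L"])
    show "0 < C + 2 powr a * L" using C L0 by (simp add: add_pos_nonneg)
    fix p :: "'a \<times> real" and r :: real
    assume p: "p \<in> cball 0 (3/2) \<times> {0..1/2}" and r: "0 < r" "r \<le> 1"
    let ?S = "{q. 0 < snd q \<and> snd q < snd p \<and> r \<le> pnorm (p - q)}"
    let ?k = "r powr (- (gam + eps))"
    \<comment> \<open>Because \<open>gam\<close> is nonnegative and \<open>r \<le> 1\<close>, the
      singular factor is at least 1 and swallows the bounded contribution of distant points.\<close>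
    have k1: "1 \<le> ?k"
    proof -
      have "1 powr (- (gam + eps)) \<le> ?k"
        using r gam_nonneg eps by (intro powr_mono2') auto
      thus ?thesis by simp
    qed
    let ?I = "\<lambda>q::'a \<times> real. indicator (cball 0 2 \<times> {0<..1}) q :: ennreal"
    let ?J = "\<lambda>q::'a \<times> real. indicator (UNIV \<times> {0<..<16}) q :: ennreal"
    have [measurable]: "?I \<in> borel_measurable borel" by (intro borel_measurable_indicator borel_Times) auto
    have [measurable]: "?J \<in> borel_measurable borel" by (intro borel_measurable_indicator borel_open open_Times) auto
    have "(\<integral>\<^sup>+q. indicator ?S q * ennreal (pnorm (p - q) powr (- a) * u (fst q) (snd q) powr lam) \<partial>lborel)
       \<le> (\<integral>\<^sup>+q. ennreal ?k * (?I q * ennreal (pnorm (p - q) powr (- th) * ucut q powr lam)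
            + ennreal (2 powr a) * (?J q * ennreal (ucut q powr lam))) \<partial>lborel)"
    proof (intro nn_integral_mono)
      fix q :: "'a \<times> real"
      show "indicator ?S q * ennreal (pnorm (p - q) powr (- a) * u (fst q) (snd q) powr lam)
         \<le> ennreal ?k * (?I q * ennreal (pnorm (p - q) powr (- th) * ucut q powr lam)
            + ennreal (2 powr a) * (?J q * ennreal (ucut q powr lam)))"
      proof (cases "q \<in> ?S")
        case True
        hence q: "0 < snd q" "snd q < snd p" "r \<le> pnorm (p - q)" by auto
        have sp: "snd p \<le> 1/2" "norm (fst p) \<le> 3/2" using p by auto
        have e: "ucut q = u (fst q) (snd q)" using q sp by (intro ucut_eq) auto
        define w where "w = ucut q powr lam"
        have w: "0 \<le> w" by (simp add: w_def)
        show ?thesis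
        proof (cases "q \<in> cball 0 2 \<times> {0<..1}")
          case inn: True
          have "pnorm (p - q) powr (- a) = pnorm (p - q) powr (- (gam + eps)) * pnorm (p - q) powr (- th)"
          proof -
            have "- a = - (gam + eps) + - th" using ath by linarith
            thus ?thesis by (simp only: powr_add)
          qed
          also have "\<dots> \<le> ?k * pnorm (p - q) powr (- th)"
            using q r gam_nonneg eps by (intro mult_right_mono powr_mono2') auto
          finally have "pnorm (p - q) powr (- a) * w \<le> ?k * (pnorm (p - q) powr (- th) * w)"
            using w by (simp add: mult_right_mono mult.assoc[symmetric])
          hence "ennreal (pnorm (p - q) powr (- a) * w) \<le> ennreal ?k * ennreal (pnorm (p - q) powr (- th) * w)"
            using w by (simp add: ennreal_leI flip: ennreal_mult)
          also have "\<dots> \<le> ennreal ?k * (?I q * ennreal (pnorm (p - q) powr (- th) * w)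
            + ennreal (2 powr a) * (?J q * ennreal w))"
            using inn by (intro mult_left_mono) auto
          finally show ?thesis using True unfolding w_def e by simp
        next
          case out: False
          hence "2 < norm (fst q)" using q sp by (cases q) auto
          moreover have "norm (fst q) \<le> norm (fst p) + norm (fst p - fst q)"
            by (metis norm_triangle_sub norm_minus_commute)
          ultimately have "1/2 \<le> pnorm (p - q)" using sp by (simp add: pnorm_def)
          hence "pnorm (p - q) powr (- a) \<le> (1/2) powr (- a)" using ha by (intro powr_mono2') auto
          also have "\<dots> = 2 powr a" by (simp add: powr_divide powr_minus)
          also have "\<dots> \<le> ?k * 2 powr a" using k1 by simp
          finally have "pnorm (p - q) powr (- a) * w \<le> ?k * (2 powr a * w)"
            using w by (simp add: mult_right_mono mult.assoc[symmetric])
          hence "ennreal (pnorm (p - q) powr (- a) * w) \<le> ennreal ?k * (ennreal (2 powr a) * ennreal w)"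
            using w by (simp add: ennreal_leI flip: ennreal_mult)
          also have "\<dots> \<le> ennreal ?k * (?I q * ennreal (pnorm (p - q) powr (- th) * w)
            + ennreal (2 powr a) * (?J q * ennreal w))"
            using q sp by (cases q) (auto intro!: mult_left_mono)
          finally show ?thesis using True unfolding w_def e by simp
        qed
      qed simp
    qed
    also have "\<dots> = ennreal ?k * ((\<integral>\<^sup>+q. ?I q * ennreal (pnorm (p - q) powr (- th) * ucut q powr lam) \<partial>lborel)
            + ennreal (2 powr a) * (\<integral>\<^sup>+q. ?J q * ennreal (ucut q powr lam) \<partial>lborel))"
      by (simp add: nn_integral_cmult nn_integral_add)
    also have "(\<integral>\<^sup>+q. ?I q * ennreal (pnorm (p - q) powr (- th) * ucut q powr lam) \<partial>lborel)
       = (\<integral>\<^sup>+q. ?I q * ennreal (pnorm (p - q) powr (- th) * u (fst q) (snd q) powr lam) \<partial>lborel)"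
      by (intro nn_integral_cong) (auto simp: indicator_def ucut_eq)
    also have "ennreal ?k * ((\<integral>\<^sup>+q. ?I q * ennreal (pnorm (p - q) powr (- th) * u (fst q) (snd q) powr lam) \<partial>lborel)
            + ennreal (2 powr a) * (\<integral>\<^sup>+q. ?J q * ennreal (ucut q powr lam) \<partial>lborel))
       \<le> ennreal ?k * (ennreal C + ennreal (2 powr a) * ennreal L)"
      using p by (intro mult_left_mono add_mono C L) auto
    also have "\<dots> = ennreal ((C + 2 powr a * L) * ?k)"
      using C L0 by (simp add: ennreal_mult ennreal_plus mult.commute)
    finally show "(\<integral>\<^sup>+q. indicator ?S q * ennreal (pnorm (p - q) powr (- a) * u (fst q) (snd q) powr lam) \<partial>lborel)
       \<le> ennreal ((C + 2 powr a * L) * ?k)" .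
  qed
qed

text \<open>The nonlocal integral is split at distance \<open>r\<close>. Nearby,
  \<open>u \<le> b\<close> and the kernel alone integrates to a multiple of
  \<open>r powr (n + 2 - a)\<close>; the rest is \<open>kernel_tail_bound\<close>. Control of
  \<open>u\<close> is asked only at earlier times because the kernel vanishes otherwise, and
  \<open>0 powr (a / n) = 0\<close>.\<close>

lemma source_bound:
  fixes eps :: real
  assumes eps: "0 < eps" "eps < 2" "eps < n + 2 - n * lam"
  obtains C where "0 < C" "\<And>p r b. p \<in> cball 0 (3/2) \<times> {0<..1/2} \<Longrightarrow> 0 < r \<Longrightarrow> r \<le> 1 \<Longrightarrow> 0 < b \<Longrightarrow>
     u (fst p) (snd p) \<le> b \<Longrightarrow>
     (\<And>q. 0 < snd q \<Longrightarrow> snd q < snd p \<Longrightarrow> pnorm (p - q) < r \<Longrightarrow> u (fst q) (snd q) \<le> b) \<Longrightarrow>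
     src p \<le> C * (b powr lam * r powr (n + 2 - a) + r powr (- (gam + eps))) * b powr sig"
proof -
  obtain Ck where Ck: "0 < Ck" "\<And>(x::'a) t. heat_kernel x t \<le> Ck * pnorm (x, t) powr (- real DIM('a))"
    using heat_kernel_le_pnorm[where 'a='a] by blast
  define c where "c = Ck powr (a / n)"
  have c: "0 < c" using Ck by (simp add: c_def)
  have hk: "heat_kernel x t powr (a / n) \<le> c * pnorm (x, t) powr (- a)" for x :: 'a and t
  proof -
    have "heat_kernel x t powr (a / n) \<le> (Ck * pnorm (x, t) powr (- n)) powr (a / n)"
      using Ck(2)[of x t] ha n_pos by (intro powr_mono2) (auto simp: n_def)
    also have "\<dots> = c * pnorm (x, t) powr (- a)"
      using Ck(1) n_pos by (simp add: c_def powr_mult powr_powr)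
    finally show ?thesis .
  qed
  obtain C1 where C1: "0 < C1"
    "\<And>R. 0 < R \<Longrightarrow> (\<integral>\<^sup>+ p. indicator {p :: 'a \<times> real. pnorm p < R} p * ennreal (pnorm p powr (- a)) \<partial>lborel)
       \<le> ennreal (C1 * R powr (real DIM('a) + 2 - a))"
    using nn_integral_pnorm_powr_le[of a, where 'a='a] ha by (auto simp: n_def)
  obtain C2 where C2: "0 < C2" "\<And>p r. p \<in> cball 0 (3/2) \<times> {0..1/2} \<Longrightarrow> 0 < r \<Longrightarrow> r \<le> 1 \<Longrightarrow>
     (\<integral>\<^sup>+q. indicator {q. 0 < snd q \<and> snd q < snd p \<and> r \<le> pnorm (p - q)} q
        * ennreal (pnorm (p - q) powr (- a) * u (fst q) (snd q) powr lam) \<partial>lborel)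
     \<le> ennreal (C2 * r powr (- (gam + eps)))"
    using kernel_tail_bound[OF eps] by blast
  define C where "C = c * (C1 + C2)"
  show ?thesis
  proof (rule that[of C])
    show "0 < C" using c C1 C2 by (simp add: C_def)
    fix p :: "'a \<times> real" and r b :: real
    assume p: "p \<in> cball 0 (3/2) \<times> {0<..1/2}" and r: "0 < r" "r \<le> 1" and b: "0 < b"
      and ub: "u (fst p) (snd p) \<le> b"
      and uq: "\<And>q. 0 < snd q \<Longrightarrow> snd q < snd p \<Longrightarrow> pnorm (p - q) < r \<Longrightarrow> u (fst q) (snd q) \<le> b"
    have sp: "0 < snd p" "snd p \<le> 1/2" "norm (fst p) \<le> 3/2" using p by auto
    let ?S = "{q::'a \<times> real. 0 < snd q \<and> snd q < snd p \<and> r \<le> pnorm (p - q)}"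
    let ?B = "{q::'a \<times> real. pnorm (p - q) < r}"
    have S: "?S = {q. 0 < snd q} \<inter> {q. snd q < snd p} \<inter> {q. r \<le> pnorm (p - q)}" by auto
    have [measurable]: "?S \<in> sets borel" unfolding S
      by (intro sets.Int borel_open[OF open_Collect_less] borel_closed[OF closed_Collect_le] continuous_intros)
    have [measurable]: "?B \<in> sets borel"
      by (intro borel_open[OF open_Collect_less] continuous_intros)
    define X where "X = b powr lam * r powr (n + 2 - a) + r powr (- (gam + eps))"
    have X0: "0 \<le> X" by (simp add: X_def)
    define I where "I = (\<integral>\<^sup>+ q. indicator (UNIV \<times> {0<..<16}) q *
              ennreal (heat_kernel (fst p - fst q) (snd p - snd q) powr (a / n) * u (fst q) (snd q) powr lam) \<partial>lborel)"
    have "I \<le> (\<integral>\<^sup>+q. ennreal c * (ennreal (b powr lam) * (indicator ?B q * ennreal (pnorm (p - q) powr (- a)))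
        + indicator ?S q * ennreal (pnorm (p - q) powr (- a) * ucut q powr lam)) \<partial>lborel)"
      unfolding I_def
    proof (intro nn_integral_mono)
      fix q :: "'a \<times> real"
      let ?L = "indicator (UNIV \<times> {0<..<16}) q *
              ennreal (heat_kernel (fst p - fst q) (snd p - snd q) powr (a / n) * u (fst q) (snd q) powr lam)"
      let ?R = "ennreal c * (ennreal (b powr lam) * (indicator ?B q * ennreal (pnorm (p - q) powr (- a)))
        + indicator ?S q * ennreal (pnorm (p - q) powr (- a) * ucut q powr lam))"
      show "?L \<le> ?R"
      proof (cases "0 < snd q \<and> snd q < snd p")
        case False
        hence "?L = 0" by (cases q) (auto simp: heat_kernel_def indicator_def)
        thus ?thesis by (simp only: zero_le)
      next
        case True
        have e: "ucut q = u (fst q) (snd q)" using True sp by (intro ucut_eq) auto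
        have u0: "0 \<le> u (fst q) (snd q)" using True sp by (intro nonneg) auto
        have "heat_kernel (fst p - fst q) (snd p - snd q) powr (a / n) * u (fst q) (snd q) powr lam
           \<le> c * pnorm (p - q) powr (- a) * u (fst q) (snd q) powr lam"
          using hk[of "fst p - fst q" "snd p - snd q"] by (intro mult_right_mono) (auto simp: minus_prod_def)
        hence "?L \<le> ennreal (c * (pnorm (p - q) powr (- a) * u (fst q) (snd q) powr lam))"
          by (auto simp: indicator_def mult.assoc intro!: ennreal_leI)
        also have "\<dots> = ennreal c * ennreal (pnorm (p - q) powr (- a) * u (fst q) (snd q) powr lam)"
          using c by (simp add: ennreal_mult)
        also have "\<dots> \<le> ?R"
        proof (intro mult_left_mono)
          show "ennreal (pnorm (p - q) powr (- a) * u (fst q) (snd q) powr lam)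
             \<le> ennreal (b powr lam) * (indicator ?B q * ennreal (pnorm (p - q) powr (- a)))
              + indicator ?S q * ennreal (pnorm (p - q) powr (- a) * ucut q powr lam)"
          proof (cases "pnorm (p - q) < r")
            case near: True
            have "u (fst q) (snd q) powr lam \<le> b powr lam"
              using uq[of q] True near u0 lam_pos by (intro powr_mono2) auto
            from mult_left_mono[OF this, of "pnorm (p - q) powr (- a)"]
            have "ennreal (pnorm (p - q) powr (- a) * u (fst q) (snd q) powr lam)
               \<le> ennreal (pnorm (p - q) powr (- a) * b powr lam)" by (intro ennreal_leI) simp
            also have "\<dots> = ennreal (b powr lam) * ennreal (pnorm (p - q) powr (- a))"
              by (simp add: ennreal_mult mult.commute)
            finally have "ennreal (pnorm (p - q) powr (- a) * u (fst q) (snd q) powr lam)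
               \<le> ennreal (b powr lam) * ennreal (pnorm (p - q) powr (- a))" .
            thus ?thesis using near by simp
          next
            case False
            thus ?thesis using True by (simp add: e)
          qed
        qed simp
        finally show ?thesis .
      qed
    qed
    also have "\<dots> = ennreal c * (ennreal (b powr lam) * (\<integral>\<^sup>+q. indicator ?B q * ennreal (pnorm (p - q) powr (- a)) \<partial>lborel)
        + (\<integral>\<^sup>+q. indicator ?S q * ennreal (pnorm (p - q) powr (- a) * ucut q powr lam) \<partial>lborel))"
      by (simp add: nn_integral_cmult nn_integral_add)
    also have "(\<integral>\<^sup>+q. indicator ?S q * ennreal (pnorm (p - q) powr (- a) * ucut q powr lam) \<partial>lborel)
       = (\<integral>\<^sup>+q. indicator ?S q * ennreal (pnorm (p - q) powr (- a) * u (fst q) (snd q) powr lam) \<partial>lborel)"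
      using sp by (intro nn_integral_cong) (auto simp: indicator_def ucut_eq)
    also have "ennreal c * (ennreal (b powr lam) * (\<integral>\<^sup>+q. indicator ?B q * ennreal (pnorm (p - q) powr (- a)) \<partial>lborel)
        + (\<integral>\<^sup>+q. indicator ?S q * ennreal (pnorm (p - q) powr (- a) * u (fst q) (snd q) powr lam) \<partial>lborel))
       \<le> ennreal c * (ennreal (b powr lam) * ennreal (C1 * r powr (n + 2 - a)) + ennreal (C2 * r powr (- (gam + eps))))"
    proof (intro mult_left_mono add_mono)
      show "(\<integral>\<^sup>+q. indicator ?B q * ennreal (pnorm (p - q) powr (- a)) \<partial>lborel) \<le> ennreal (C1 * r powr (n + 2 - a))"
        unfolding nn_integral_pnorm_shift n_def by (rule C1(2)[OF r(1)])
      show "(\<integral>\<^sup>+q. indicator ?S q * ennreal (pnorm (p - q) powr (- a) * u (fst q) (snd q) powr lam) \<partial>lborel)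
         \<le> ennreal (C2 * r powr (- (gam + eps)))"
        by (rule C2(2)[OF _ r]) (use p in auto)
    qed auto
    also have "\<dots> = ennreal (c * (b powr lam * (C1 * r powr (n + 2 - a)) + C2 * r powr (- (gam + eps))))"
      using c C1 C2 by (simp add: ennreal_mult ennreal_plus)
    also have "\<dots> \<le> ennreal (C * X)"
    proof (intro ennreal_leI)
      have "b powr lam * (C1 * r powr (n + 2 - a)) + C2 * r powr (- (gam + eps)) \<le> (C1 + C2) * X"
        using C1(1) C2(1) by (simp add: X_def algebra_simps)
      thus "c * (b powr lam * (C1 * r powr (n + 2 - a)) + C2 * r powr (- (gam + eps))) \<le> C * X"
        unfolding C_def mult.assoc using c by (intro mult_left_mono) auto
    qed
    finally have I: "I \<le> ennreal (C * X)" .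
    \<comment> \<open>Positivity of \<open>b\<close> matters for \<open>sig = 0\<close>: then
      \<open>rpow\<close> is 1 even where \<open>u\<close> vanishes, and so is
      \<open>b powr 0\<close>.\<close>
    have rp: "rpow (u (fst p) (snd p)) sig \<le> b powr sig"
      using ub b hsig nonneg[of "snd p" "fst p"] sp by (auto simp: rpow_def intro!: powr_mono2)
    have "ennreal (src p) \<le> I * ennreal (rpow (u (fst p) (snd p)) sig)"
      unfolding src_def I_def by (intro upper) (use sp in auto)
    also have "\<dots> \<le> ennreal (C * X) * ennreal (b powr sig)"
      using I rp by (intro mult_mono ennreal_leI) auto
    also have "\<dots> = ennreal (C * X * b powr sig)"
      using X0 \<open>0 < C\<close> by (simp add: ennreal_mult)
    finally show "src p \<le> C * (b powr lam * r powr (n + 2 - a) + r powr (- (gam + eps))) * b powr sig"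
      unfolding X_def[symmetric] using X0 \<open>0 < C\<close> by (subst (asm) ennreal_le_iff) auto
  qed
qed

text \<open>The representation is started at \<open>t0 - r^2\<close>. The initial slice and the
  source at distance at least \<open>r\<close> see a kernel of size at most
  \<open>r powr (- n)\<close> and carry mass at most \<open>M\<close> each. The source closer than
  \<open>r\<close> is bounded pointwise, and the kernel integrates there to a multiple of
  \<open>r^2\<close>. The bound \<open>b\<close> is required on a cylinder of doubled radius because
  \<open>source_bound\<close> at each nearby point looks a further distance
  \<open>r\<close>.\<close>

lemma local_bound:
  fixes eps :: real
  assumes eps: "0 < eps" "eps < 2" "eps < n + 2 - n * lam"
  obtains C K where "0 < C" "0 < K"
    "\<And>x0 t0 r b. norm x0 \<le> 3/2 \<Longrightarrow> t0 \<le> 1/2 \<Longrightarrow> 0 < r \<Longrightarrow> r \<le> 1 \<Longrightarrow> 0 < b \<Longrightarrow>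
      (\<And>y s. norm (x0 - y) \<le> 2 * r \<Longrightarrow> t0 - 4 * r\<^sup>2 \<le> s \<Longrightarrow> s \<le> t0 \<Longrightarrow> norm y \<le> 3/2 \<and> 0 < s \<and> u y s \<le> b) \<Longrightarrow>
      u x0 t0 \<le> C * (1 + r powr (- n)) + K * r\<^sup>2 * (b powr lam * r powr (n + 2 - a) + r powr (- (gam + eps))) * b powr sig"
proof -
  obtain M where M: "0 < M"
    "\<And>s. 0 < s \<Longrightarrow> s \<le> 1 \<Longrightarrow> (\<integral>\<^sup>+y. indicator (cball 0 3) y * ennreal (u y s) \<partial>lborel) \<le> ennreal M"
    "\<And>s. 0 < s \<Longrightarrow> s \<le> 1 \<Longrightarrow> (\<integral>\<^sup>+p. indicator (cball 0 3 \<times> {s..1}) p * ennreal (src p) \<partial>lborel) \<le> ennreal M"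
    using mass_bound by blast
  obtain Cr where Cr: "0 < Cr"
    "\<And>x t d. norm x \<le> 2 \<Longrightarrow> 0 < d \<Longrightarrow> d < t \<Longrightarrow> t \<le> 1 \<Longrightarrow>
      ennreal (u x t) \<le> ennreal Cr * (1
        + (\<integral>\<^sup>+y. indicator (cball 0 3) y * ennreal (pnorm ((x, t) - (y, d)) powr (- real DIM('a)) * u y d) \<partial>lborel)
        + (\<integral>\<^sup>+p. indicator (cball 0 3 \<times> {d..<t}) p * ennreal (pnorm ((x, t) - p) powr (- real DIM('a)) * src p) \<partial>lborel))"
    using representation_bound by blast
  obtain C1 where C1: "0 < C1"
    "\<And>R. 0 < R \<Longrightarrow> (\<integral>\<^sup>+ p. indicator {p :: 'a \<times> real. pnorm p < R} p * ennreal (pnorm p powr (- n)) \<partial>lborel)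
       \<le> ennreal (C1 * R powr (real DIM('a) + 2 - n))"
    using nn_integral_pnorm_powr_le[of n, where 'a='a] n_pos by (auto simp: n_def)
  obtain Cs where Cs: "0 < Cs" "\<And>p r b. p \<in> cball 0 (3/2) \<times> {0<..1/2} \<Longrightarrow> 0 < r \<Longrightarrow> r \<le> 1 \<Longrightarrow> 0 < b \<Longrightarrow>
     u (fst p) (snd p) \<le> b \<Longrightarrow>
     (\<And>q. 0 < snd q \<Longrightarrow> snd q < snd p \<Longrightarrow> pnorm (p - q) < r \<Longrightarrow> u (fst q) (snd q) \<le> b) \<Longrightarrow>
     src p \<le> Cs * (b powr lam * r powr (n + 2 - a) + r powr (- (gam + eps))) * b powr sig"
    using source_bound[OF eps] by blast
  define C where "C = Cr * (1 + 2 * M)"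
  define K where "K = Cr * (Cs * C1)"
  show ?thesis
  proof (rule that[of C K])
    show "0 < C" "0 < K" using Cr M Cs C1 by (auto simp: C_def K_def)
    fix x0 :: 'a and t0 r b :: real
    assume x0: "norm x0 \<le> 3/2" and t0: "t0 \<le> 1/2" and r: "0 < r" "r \<le> 1" and b: "0 < b"
      and H: "\<And>y s. norm (x0 - y) \<le> 2 * r \<Longrightarrow> t0 - 4 * r\<^sup>2 \<le> s \<Longrightarrow> s \<le> t0 \<Longrightarrow> norm y \<le> 3/2 \<and> 0 < s \<and> u y s \<le> b"
    define d where "d = t0 - r\<^sup>2"
    have r2: "0 < r\<^sup>2" using r by simp
    have d: "0 < d" "d < t0" using H[of x0 d] r r2 by (auto simp: d_def)
    define Y where "Y = (b powr lam * r powr (n + 2 - a) + r powr (- (gam + eps))) * b powr sig"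
    have Y0: "0 \<le> Y" by (simp add: Y_def)
    let ?p0 = "(x0, t0)"
    have sqless: "\<bar>z\<bar> < r\<^sup>2" if "sqrt \<bar>z\<bar> < r" for z
    proof -
      have "sqrt \<bar>z\<bar> < sqrt (r\<^sup>2)" using that r by simp
      thus ?thesis by (simp only: real_sqrt_less_iff)
    qed
    have srcY: "src q \<le> Cs * Y" if q: "pnorm (?p0 - q) < r" "snd q < t0" for q
    proof -
      obtain y s where ys: "q = (y, s)" by (cases q)
      have 1: "norm (x0 - y) < r" "\<bar>t0 - s\<bar> < r\<^sup>2" using q sqless[of "t0 - s"] by (auto simp: ys pnorm_def)
      have h: "norm y \<le> 3/2 \<and> 0 < s \<and> u y s \<le> b" using H[of y s] 1 q r by (auto simp: ys)
      have "u (fst q') (snd q') \<le> b" if q': "0 < snd q'" "snd q' < snd q" "pnorm (q - q') < r" for q'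
      proof -
        obtain y' s' where ys': "q' = (y', s')" by (cases q')
        have 2: "norm (y - y') < r" "\<bar>s - s'\<bar> < r\<^sup>2" using q' sqless[of "s - s'"] by (auto simp: ys ys' pnorm_def)
        have "norm (x0 - y') \<le> norm (x0 - y) + norm (y - y')" using norm_triangle_ineq[of "x0 - y" "y - y'"] by simp
        thus ?thesis using H[of y' s'] 1 2 q q' r by (auto simp: ys ys')
      qed
      hence "src q \<le> Cs * (b powr lam * r powr (n + 2 - a) + r powr (- (gam + eps))) * b powr sig"
        using h q t0 r b by (intro Cs(2)) (auto simp: ys)
      thus ?thesis by (simp add: Y_def mult.assoc)
    qed
    have far: "pnorm z powr (- n) \<le> r powr (- n)" if "r \<le> pnorm z" for z :: "'a \<times> real"
      using that r n_pos by (intro powr_mono2') auto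
    have A1: "(\<integral>\<^sup>+y. indicator (cball 0 3) y * ennreal (pnorm (?p0 - (y, d)) powr (- real DIM('a)) * u y d) \<partial>lborel)
       \<le> ennreal (r powr (- n) * M)"
    proof -
      have m: "(\<lambda>y. indicator (cball 0 3) y * ennreal (u y d)) \<in> borel_measurable borel"
      proof (intro borel_measurable_indicator_ennreal)
        have "d \<in> {0<..<16}" using d t0 by auto
        from continuous_on_slice[OF continuous_on_u this]
        show "continuous_on (cball 0 3) (\<lambda>y. u y d)" by (rule continuous_on_subset) auto
      qed auto
      have "(\<integral>\<^sup>+y. indicator (cball 0 3) y * ennreal (pnorm (?p0 - (y, d)) powr (- real DIM('a)) * u y d) \<partial>lborel)
        \<le> (\<integral>\<^sup>+y. ennreal (r powr (- n)) * (indicator (cball 0 3) y * ennreal (u y d)) \<partial>lborel)"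
      proof (intro nn_integral_mono)
        fix y :: 'a
        have "r \<le> pnorm (?p0 - (y, d))" using r by (simp add: pnorm_def d_def le_max_iff_disj)
        hence "pnorm (?p0 - (y, d)) powr (- n) * u y d \<le> r powr (- n) * u y d"
          using nonneg[of d y] d t0 by (intro mult_right_mono far) auto
        thus "indicator (cball 0 3) y * ennreal (pnorm (?p0 - (y, d)) powr (- real DIM('a)) * u y d)
          \<le> ennreal (r powr (- n)) * (indicator (cball 0 3) y * ennreal (u y d))"
          using nonneg[of d y] d t0
          by (auto simp: indicator_def ennreal_leI n_def[symmetric] simp flip: ennreal_mult)
      qed
      also have "\<dots> = ennreal (r powr (- n)) * (\<integral>\<^sup>+y. indicator (cball 0 3) y * ennreal (u y d) \<partial>lborel)"
        using m by (intro nn_integral_cmult) simp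
      also have "\<dots> \<le> ennreal (r powr (- n)) * ennreal M"
        using M(2)[of d] d t0 by (intro mult_left_mono) auto
      finally show ?thesis using M by (simp add: ennreal_mult)
    qed
    have A2: "(\<integral>\<^sup>+p. indicator (cball 0 3 \<times> {d..<t0}) p * ennreal (pnorm (?p0 - p) powr (- real DIM('a)) * src p) \<partial>lborel)
       \<le> ennreal (r powr (- n) * M) + ennreal (Cs * Y * (C1 * r\<^sup>2))"
    proof -
      let ?B = "{p::'a \<times> real. pnorm (?p0 - p) < r}"
      let ?G = "\<lambda>p. indicator (cball 0 3 \<times> {d..1}) p * ennreal (src p)"
      have [measurable]: "?G \<in> borel_measurable borel"
        by (intro borel_measurable_indicator_ennreal continuous_on_subset[OF continuous_on_src] borel_closed closed_Times)
          (use d in auto)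
      have "(\<integral>\<^sup>+p. indicator (cball 0 3 \<times> {d..<t0}) p * ennreal (pnorm (?p0 - p) powr (- real DIM('a)) * src p) \<partial>lborel)
         \<le> (\<integral>\<^sup>+p. ennreal (r powr (- n)) * ?G p + ennreal (Cs * Y) * (indicator ?B p * ennreal (pnorm (?p0 - p) powr (- n))) \<partial>lborel)"
      proof (intro nn_integral_mono)
        fix p :: "'a \<times> real"
        let ?L = "indicator (cball 0 3 \<times> {d..<t0}) p * ennreal (pnorm (?p0 - p) powr (- real DIM('a)) * src p)"
        show "?L \<le> ennreal (r powr (- n)) * ?G p + ennreal (Cs * Y) * (indicator ?B p * ennreal (pnorm (?p0 - p) powr (- n)))"
        proof (cases "p \<in> cball 0 3 \<times> {d..<t0}")
          case True
          hence L: "?L = ennreal (pnorm (?p0 - p) powr (- n) * src p)" by (simp add: n_def)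
          have p1: "p \<in> cball 0 3 \<times> {d..1}" "snd p < t0" using True t0 by auto
          have s0: "0 \<le> src p" using True d t0 by (intro src_nonneg) auto
          show ?thesis
          proof (cases "pnorm (?p0 - p) < r")
            case near: True
            have "pnorm (?p0 - p) powr (- n) * src p \<le> (Cs * Y) * pnorm (?p0 - p) powr (- n)"
              using mult_right_mono[OF srcY[OF near p1(2)], of "pnorm (?p0 - p) powr (- n)"] by (simp add: mult.commute)
            hence "?L \<le> ennreal (Cs * Y) * ennreal (pnorm (?p0 - p) powr (- n))"
              unfolding L using Cs Y0 by (simp add: ennreal_leI flip: ennreal_mult)
            thus ?thesis using near by (simp add: add_increasing)
          next
            case nf: False
            have "pnorm (?p0 - p) powr (- n) * src p \<le> r powr (- n) * src p"
              using nf s0 by (intro mult_right_mono far) auto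
            hence "?L \<le> ennreal (r powr (- n)) * ennreal (src p)"
              unfolding L using s0 by (simp add: ennreal_leI flip: ennreal_mult)
            thus ?thesis using p1 by (simp add: add_increasing2)
          qed
        qed simp
      qed
      also have "\<dots> = ennreal (r powr (- n)) * (\<integral>\<^sup>+p. ?G p \<partial>lborel)
          + ennreal (Cs * Y) * (\<integral>\<^sup>+p. indicator ?B p * ennreal (pnorm (?p0 - p) powr (- n)) \<partial>lborel)"
        by (simp add: nn_integral_add nn_integral_cmult)
      also have "\<dots> \<le> ennreal (r powr (- n)) * ennreal M + ennreal (Cs * Y) * ennreal (C1 * r\<^sup>2)"
      proof (intro add_mono mult_left_mono)
        show "(\<integral>\<^sup>+p. ?G p \<partial>lborel) \<le> ennreal M" using M(3)[of d] d t0 by simp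
        have "r powr (real DIM('a) + 2 - n) = r\<^sup>2" using r by (simp add: n_def)
        thus "(\<integral>\<^sup>+p. indicator ?B p * ennreal (pnorm (?p0 - p) powr (- n)) \<partial>lborel) \<le> ennreal (C1 * r\<^sup>2)"
          unfolding nn_integral_pnorm_shift using C1(2)[OF r(1)] by simp
      qed auto
      finally show ?thesis using M Cs Y0 C1 by (simp add: ennreal_mult)
    qed
    have "ennreal (u x0 t0) \<le> ennreal Cr * (1 + ennreal (r powr (- n) * M) + (ennreal (r powr (- n) * M) + ennreal (Cs * Y * (C1 * r\<^sup>2))))"
    proof -
      have "ennreal (u x0 t0) \<le> ennreal Cr * (1
        + (\<integral>\<^sup>+y. indicator (cball 0 3) y * ennreal (pnorm (?p0 - (y, d)) powr (- real DIM('a)) * u y d) \<partial>lborel)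
        + (\<integral>\<^sup>+p. indicator (cball 0 3 \<times> {d..<t0}) p * ennreal (pnorm (?p0 - p) powr (- real DIM('a)) * src p) \<partial>lborel))"
        using x0 t0 d by (intro Cr(2)) auto
      also have "\<dots> \<le> ennreal Cr * (1 + ennreal (r powr (- n) * M) + (ennreal (r powr (- n) * M) + ennreal (Cs * Y * (C1 * r\<^sup>2))))"
        by (intro mult_left_mono add_mono A1 A2) auto
      finally show ?thesis .
    qed
    also have "\<dots> = ennreal (Cr * (1 + r powr (- n) * M + (r powr (- n) * M + Cs * Y * (C1 * r\<^sup>2))))"
    proof -
      have "0 \<le> r powr (- n) * M" "0 \<le> Cs * Y * (C1 * r\<^sup>2)" using M Cs C1 Y0 by auto
      thus ?thesis
        by (simp only: ennreal_mult ennreal_plus ennreal_1 add_nonneg_nonneg zero_le_one less_imp_le[OF Cr(1)])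
    qed
    finally have "u x0 t0 \<le> Cr * (1 + r powr (- n) * M + (r powr (- n) * M + Cs * Y * (C1 * r\<^sup>2)))"
    proof (subst (asm) ennreal_le_iff)
      have "0 \<le> r powr (- n) * M" "0 \<le> Cs * Y * (C1 * r\<^sup>2)" using M Cs C1 Y0 by auto
      thus "0 \<le> Cr * (1 + r powr (- n) * M + (r powr (- n) * M + Cs * Y * (C1 * r\<^sup>2)))"
        using M(1) Cs(1) C1(1) Y0 Cr(1) by (intro mult_nonneg_nonneg add_nonneg_nonneg) auto
    qed
    also have "\<dots> \<le> C * (1 + r powr (- n)) + K * r\<^sup>2 * Y"
    proof -
      have "1 + r powr (- n) * M + r powr (- n) * M \<le> (1 + 2 * M) * (1 + r powr (- n))"
        using M(1) by (simp add: algebra_simps)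
      from mult_left_mono[OF this, of Cr] Cr(1) show ?thesis
        by (simp add: C_def K_def algebra_simps)
    qed
    finally show "u x0 t0 \<le> C * (1 + r powr (- n)) + K * r\<^sup>2 * (b powr lam * r powr (n + 2 - a) + r powr (- (gam + eps))) * b powr sig"
      by (simp add: Y_def mult.assoc)
  qed
qed

text \<open>Starting the cylinder at \<open>tau > 0\<close> keeps \<open>u\<close> continuous on a
  compact set, so the weighted maximum is attained; \<open>B\<close> is fixed before
  \<open>tau\<close>, which makes the bound uniform down to time 0.\<close>

lemma doubling_bound:
  obtains B where "0 < B"
    "\<And>tau x t. 0 < tau \<Longrightarrow> tau \<le> t \<Longrightarrow> t \<le> 1/2 \<Longrightarrow> norm x \<le> 3/2 \<Longrightarrow>
       u x t * min (sqrt (t - tau)) (3/2 - norm x) ^ DIM('a) \<le> B"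
proof -
  \<comment> \<open>The three margins guarantee, in this order, \<open>n < th + n * lam\<close> and
    \<open>0 < th\<close> in the tail bound, and \<open>0 < kap\<close>; halving makes all of them
    strict.\<close>
  define e0 where "e0 = min (min 2 (n + 2 - n * lam)) (n + 2 - gam - n * sig)"
  define eps where "eps = e0 / 2"
  have g: "0 < n + 2 - gam - n * sig" using hsig by (simp add: gam_def)
  have "0 < e0" "e0 \<le> 2" "e0 \<le> n + 2 - n * lam" "e0 \<le> n + 2 - gam - n * sig"
    unfolding e0_def using g hlam(2) by auto
  hence eps: "0 < eps" "eps < 2" "eps < n + 2 - n * lam" "eps < n + 2 - gam - n * sig"
    unfolding eps_def by linarith+
  define kap where "kap = n + 2 - gam - eps - n * sig"
  have kap: "0 < kap" using eps by (simp add: kap_def)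
  obtain C K where C: "0 < C" and K: "0 < K" and loc:
    "\<And>x0 t0 r b. norm x0 \<le> 3/2 \<Longrightarrow> t0 \<le> 1/2 \<Longrightarrow> 0 < r \<Longrightarrow> r \<le> 1 \<Longrightarrow> 0 < b \<Longrightarrow>
      (\<And>y s. norm (x0 - y) \<le> 2 * r \<Longrightarrow> t0 - 4 * r\<^sup>2 \<le> s \<Longrightarrow> s \<le> t0 \<Longrightarrow> norm y \<le> 3/2 \<and> 0 < s \<and> u y s \<le> b) \<Longrightarrow>
      u x0 t0 \<le> C * (1 + r powr (- n)) + K * r\<^sup>2 * (b powr lam * r powr (n + 2 - a) + r powr (- (gam + eps))) * b powr sig"
    using local_bound[OF eps(1-3)] by blast
  define N where "N = DIM('a)"
  have nN: "n = real N" and N0: "0 < N" by (simp_all add: n_def N_def)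
  \<comment> \<open>\<open>Q\<close> will be the value of \<open>m * r powr n\<close>. As
    \<open>C * (r powr n + 1) \<le> 2 * C\<close> for \<open>r \<le> 1\<close>, this choice leaves
    exactly 1 to be supplied by the source term.\<close>
  define Q where "Q = 2 * C + 1"
  have Q: "0 < Q" using C by (simp add: Q_def)
  define B0 where "B0 = 2 ^ N * Q"
  have B0: "0 < B0" using Q by (simp add: B0_def)
  define C6 where "C6 = K * (B0 powr lam + 1) * B0 powr sig"
  have C6: "0 < C6" using K B0 by (simp add: C6_def add_pos_pos)
  \<comment> \<open>The source term \<open>C6 * r powr kap\<close> can reach 1 only if
    \<open>r\<close> is at least this threshold, which caps \<open>m\<close>.\<close>
  define rs where "rs = (1 / C6) powr (1 / kap)"
  have rs: "0 < rs" using C6 by (simp add: rs_def)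
  show ?thesis
  \<comment> \<open>The first summand covers \<open>R \<le> 4 * r\<close>, the second the case
    \<open>4 * r < R\<close>, in which \<open>rs \<le> r\<close>.\<close>
  proof (rule that[of "4 ^ N * Q + Q * rs powr (- n)"])
    show "0 < 4 ^ N * Q + Q * rs powr (- n)" using Q rs by (simp add: add_pos_pos)
    fix tau t :: real and x :: 'a
    assume tau: "0 < tau" and t: "tau \<le> t" "t \<le> 1/2" and x: "norm x \<le> 3/2"
    define rho where "rho p = min (sqrt (snd p - tau)) (3/2 - norm (fst p))" for p :: "'a \<times> real"
    define F where "F p = u (fst p) (snd p) * rho p ^ N" for p
    let ?D = "cball (0::'a) (3/2) \<times> {tau..1/2}"
    have "continuous_on ?D F"
      unfolding F_def rho_def
      by (intro continuous_intros continuous_on_subset[OF continuous_on_u]) (use tau in auto)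
    moreover have "compact ?D" by (intro compact_Times) auto
    moreover have "(x, t) \<in> ?D" using x t by auto
    ultimately obtain p0 where p0: "p0 \<in> ?D" "\<And>p. p \<in> ?D \<Longrightarrow> F p \<le> F p0"
      using continuous_attains_sup[of ?D F] by (metis empty_iff)
    obtain x0 t0 where xt: "p0 = (x0, t0)" by (cases p0)
    have x0: "norm x0 \<le> 3/2" and t0: "tau \<le> t0" "t0 \<le> 1/2" using p0(1) by (auto simp: xt)
    define m where "m = u x0 t0"
    define R where "R = rho p0"
    have m0: "0 \<le> m" unfolding m_def using tau t0 by (intro nonneg) auto
    have R0: "0 \<le> R" and Rx: "R \<le> 3/2 - norm x0" and Rt: "R \<le> sqrt (t0 - tau)"
      using x0 t0 by (auto simp: R_def rho_def xt)
    have Rt2: "R\<^sup>2 \<le> t0 - tau"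
    proof -
      have "R\<^sup>2 \<le> (sqrt (t0 - tau))\<^sup>2" using R0 Rt by (intro power_mono) auto
      thus ?thesis using t0 by simp
    qed
    have R1: "R \<le> 1"
    proof (rule ccontr)
      assume "\<not> R \<le> 1"
      hence "1 \<le> R\<^sup>2" by (intro one_le_power) auto
      thus False using Rt2 t0 tau by simp
    qed
    have "u x t * min (sqrt (t - tau)) (3/2 - norm x) ^ N = F (x, t)" by (simp add: F_def rho_def)
    also have "\<dots> \<le> F p0" by (intro p0(2)) (use x t in auto)
    also have "F p0 = m * R ^ N" by (simp add: F_def m_def R_def xt)
    also have "\<dots> \<le> 4 ^ N * Q + Q * rs powr (- n)"
    proof (cases "m * R ^ N = 0")
      case True
      have "0 \<le> 4 ^ N * Q + Q * rs powr (- n)" using Q by simp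
      thus ?thesis by (simp only: True)
    next
      case False
      hence "m \<noteq> 0" "R \<noteq> 0" using N0 by auto
      hence m: "0 < m" and R: "0 < R" using m0 R0 by linarith+
      define r where "r = (Q / m) powr (1 / n)"
      have r: "0 < r" using Q m by (simp add: r_def)
      have rn: "r powr n = Q / m" using Q m n_pos by (simp add: r_def powr_powr)
      have rN: "r ^ N = Q / m" using rn powr_realpow[OF r, of N] by (simp add: nN)
      have rmn: "m = Q * r powr (- n)" using rn m Q by (simp add: powr_minus)
      show ?thesis
      proof (cases "R \<le> 4 * r")
        case True
        have "m * R ^ N \<le> m * (4 * r) ^ N" using True R m by (intro mult_left_mono power_mono) auto
        also have "\<dots> = 4 ^ N * Q" using m by (simp add: power_mult_distrib rN)
        also have "\<dots> \<le> 4 ^ N * Q + Q * rs powr (- n)" using Q by simp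
        finally show ?thesis .
      next
        case far: False
        have r4: "4 * r < R" using far by simp
        have r1: "r \<le> 1" using r4 R1 r by simp
        define b where "b = 2 ^ N * m"
        have b: "0 < b" using m by (simp add: b_def)
        \<comment> \<open>As \<open>4 * r < R\<close>, a move by \<open>2 * r\<close> in space and
          by \<open>4 * r^2 \<le> R^2 / 4\<close> back in time leaves the weight at least
          \<open>R / 2\<close>. Maximality of \<open>F\<close> then costs a factor
          \<open>2 ^ N\<close>.\<close>
        have near: "norm y \<le> 3/2 \<and> 0 < s \<and> u y s \<le> b"
          if y: "norm (x0 - y) \<le> 2 * r" and s: "t0 - 4 * r\<^sup>2 \<le> s" "s \<le> t0" for y s
        proof -
          have "norm y \<le> norm x0 + norm (x0 - y)" by (metis norm_triangle_sub norm_minus_commute)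
          hence ny: "norm y \<le> 3/2 - R / 2" using y Rx r4 by linarith
          have "(4 * r)\<^sup>2 \<le> R\<^sup>2" using r4 r by (intro power_mono) auto
          hence "16 * r\<^sup>2 \<le> R\<^sup>2" by (simp add: power_mult_distrib)
          hence st: "(R / 2)\<^sup>2 \<le> s - tau" using s Rt2 by (simp add: power_divide)
          have "0 \<le> (R / 2)\<^sup>2" by simp
          hence stau: "tau \<le> s" using st by linarith
          have "R / 2 \<le> sqrt (s - tau)" using st by (intro real_le_rsqrt)
          hence rho: "R / 2 \<le> rho (y, s)" using ny by (simp add: rho_def)
          have u0: "0 \<le> u y s" using stau tau s t0 by (intro nonneg) auto
          have "u y s * (R / 2) ^ N \<le> u y s * rho (y, s) ^ N"
            using rho R u0 by (intro mult_left_mono power_mono) auto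
          also have "\<dots> = F (y, s)" by (simp add: F_def)
          also have "\<dots> \<le> F p0" by (intro p0(2)) (use ny R stau s t0 in auto)
          also have "\<dots> = m * R ^ N" by (simp add: F_def m_def R_def xt)
          also have "\<dots> = b * (R / 2) ^ N" by (simp add: b_def power_divide)
          finally have "u y s \<le> b" using R by simp
          thus ?thesis using ny R stau tau by auto
        qed
        have "m \<le> C * (1 + r powr (- n)) + K * r\<^sup>2 * (b powr lam * r powr (n + 2 - a) + r powr (- (gam + eps))) * b powr sig"
          unfolding m_def using near by (intro loc x0 t0(2) r r1 b)
        also have "b = B0 * r powr (- n)" by (simp add: b_def B0_def rmn)
        also have "(B0 * r powr (- n)) powr lam = B0 powr lam * r powr (- (n * lam))"
          using B0 by (simp add: powr_mult powr_powr)
        also have "(B0 * r powr (- n)) powr sig = B0 powr sig * r powr (- (n * sig))"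
          using B0 by (simp add: powr_mult powr_powr)
        finally have mm: "m \<le> C * (1 + r powr (- n)) + K * r\<^sup>2 *
            (B0 powr lam * r powr (- (n * lam)) * r powr (n + 2 - a) + r powr (- (gam + eps))) * (B0 powr sig * r powr (- (n * sig)))" .
        \<comment> \<open>The near part of the nonlocal factor scales like
          \<open>r powr (- gam)\<close>, which for \<open>r \<le> 1\<close> is no worse than the
          bound for the tail.\<close>
        have "r powr (- (n * lam)) * r powr (n + 2 - a) = r powr (- gam)"
          by (simp add: gam_def algebra_simps flip: powr_add)
        also have "\<dots> \<le> r powr (- (gam + eps))"
          using r r1 eps by (intro powr_mono') auto
        finally have "B0 powr lam * r powr (- (n * lam)) * r powr (n + 2 - a) + r powr (- (gam + eps))
            \<le> (B0 powr lam + 1) * r powr (- (gam + eps))"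
          by (simp add: distrib_right mult.assoc mult_left_mono)
        hence "K * r\<^sup>2 * (B0 powr lam * r powr (- (n * lam)) * r powr (n + 2 - a) + r powr (- (gam + eps))) * (B0 powr sig * r powr (- (n * sig)))
            \<le> K * r\<^sup>2 * ((B0 powr lam + 1) * r powr (- (gam + eps))) * (B0 powr sig * r powr (- (n * sig)))"
          using K by (intro mult_right_mono mult_left_mono) auto
        also have "\<dots> = C6 * (r powr 2 * r powr (- (gam + eps)) * r powr (- (n * sig)))"
          using r by (simp add: C6_def mult_ac)
        also have "r powr 2 * r powr (- (gam + eps)) * r powr (- (n * sig)) = r powr (kap - n)"
          by (simp add: kap_def algebra_simps flip: powr_add)
        finally have "m \<le> C * (1 + r powr (- n)) + C6 * r powr (kap - n)" using mm by linarith
        hence "m * r powr n \<le> (C * (1 + r powr (- n)) + C6 * r powr (kap - n)) * r powr n"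
          by (rule mult_right_mono) simp
        also have "\<dots> = C * r powr n + C * (r powr (- n) * r powr n) + C6 * (r powr (kap - n) * r powr n)"
          by (simp add: algebra_simps)
        also have "r powr (- n) * r powr n = 1" using r by (simp flip: powr_add)
        also have "r powr (kap - n) * r powr n = r powr kap" by (simp flip: powr_add)
        finally have "Q \<le> C * r powr n + C * 1 + C6 * r powr kap" using m by (simp add: rn)
        moreover have "r powr n \<le> 1" using r r1 n_pos by (simp add: powr_le1)
        hence "C * r powr n \<le> C" using C by simp
        ultimately have "1 \<le> C6 * r powr kap" unfolding Q_def by linarith
        hence "1 / C6 \<le> r powr kap" using C6 by (simp add: field_simps)
        hence "rs \<le> (r powr kap) powr (1 / kap)"
          unfolding rs_def using C6 kap by (intro powr_mono2) auto
        hence rsr: "rs \<le> r" using r kap by (simp add: powr_powr)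
        have "m * R ^ N \<le> m * 1" using m R R1 by (intro mult_left_mono power_le_one) auto
        also have "\<dots> = Q * r powr (- n)" using rmn by simp
        also have "\<dots> \<le> Q * rs powr (- n)"
          using rsr rs Q n_pos by (intro mult_left_mono powr_mono2') auto
        also have "\<dots> \<le> 4 ^ N * Q + Q * rs powr (- n)" using Q by simp
        finally show ?thesis .
      qed
    qed
    finally show "u x t * min (sqrt (t - tau)) (3/2 - norm x) ^ DIM('a) \<le> 4 ^ N * Q + Q * rs powr (- n)"
      by (simp add: N_def)
  qed
qed

text \<open>With \<open>tau = t / 2\<close> the weight is \<open>sqrt (t / 2)\<close>: for
  \<open>t \<le> 1/4\<close> this stays below the lateral distance, which is at least 1/2 on the
  unit ball.\<close>

lemma blowup_rate:
  obtains B where "0 < B" "\<And>x t. norm x \<le> 1 \<Longrightarrow> 0 < t \<Longrightarrow> t \<le> 1/4 \<Longrightarrow> u x t \<le> B * t powr (- n / 2)"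
proof -
  obtain B where B: "0 < B"
    "\<And>tau x t. 0 < tau \<Longrightarrow> tau \<le> t \<Longrightarrow> t \<le> 1/2 \<Longrightarrow> norm x \<le> 3/2 \<Longrightarrow>
       u x t * min (sqrt (t - tau)) (3/2 - norm x) ^ DIM('a) \<le> B"
    using doubling_bound by blast
  show ?thesis
  proof (rule that[of "B * 2 powr (n / 2)"])
    show "0 < B * 2 powr (n / 2)" using B by simp
    fix x :: 'a and t :: real assume x: "norm x \<le> 1" and t: "0 < t" "t \<le> 1/4"
    have "sqrt (t / 2) \<le> sqrt (1/4)" using t by simp
    also have "sqrt (1/4) = 1/(2::real)" by (simp add: real_sqrt_divide)
    finally have "min (sqrt (t - t / 2)) (3/2 - norm x) = sqrt (t / 2)"
      using x by (simp add: min_def)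
    hence le: "u x t * sqrt (t / 2) ^ DIM('a) \<le> B" using B(2)[of "t / 2" t x] x t by simp
    have "sqrt (t / 2) ^ DIM('a) = (t / 2) powr (n / 2)"
      using t powr_realpow[of "sqrt (t / 2)" "DIM('a)"] powr_powr[of "t / 2" "1/2" n]
      by (simp add: powr_half_sqrt n_def)
    also have "\<dots> = t powr (n / 2) / 2 powr (n / 2)" using t by (simp add: powr_divide)
    finally have "u x t * (t powr (n / 2) / 2 powr (n / 2)) \<le> B" using le by (simp only:)
    thus "u x t \<le> B * 2 powr (n / 2) * t powr (- n / 2)"
      using t by (simp add: powr_minus field_simps)
  qed
qed

end

theorem theorem4p1:
  fixes u ut :: "'a::euclidean_space \<Rightarrow> real \<Rightarrow> real"
    and g :: "'a \<Rightarrow> real \<Rightarrow> 'a" and H :: "'a \<Rightarrow> real \<Rightarrow> 'a \<Rightarrow> 'a"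
    and a lam sig :: real
  defines "n \<equiv> real DIM('a)"
  assumes ha: "0 < a" "a < n + 2"
    and hlam: "(n + 2 - a) / n \<le> lam" "lam < (n + 2) / n"
    and hsig: "0 \<le> sig" "sig < (2 * (n + 2) - a) / n - lam"
    and nonneg: "\<And>x t. 0 < t \<Longrightarrow> t < 16 \<Longrightarrow> 0 \<le> u x t"
    and C21: "C21_on (UNIV \<times> {0<..<16}) u ut g H"
    and L_lam: "set_integrable lborel (UNIV \<times> {0<..<16::real})
                  (\<lambda>p. \<bar>u (fst p) (snd p)\<bar> powr lam)"
    and ineq_lower: "\<And>x t. x \<in> ball 0 4 \<Longrightarrow> 0 < t \<Longrightarrow> t < 16 \<Longrightarrow>
                       0 \<le> ut x t - laplacian H x t"
    and ineq_upper: "\<And>x t. x \<in> ball 0 4 \<Longrightarrow> 0 < t \<Longrightarrow> t < 16 \<Longrightarrow>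
        ennreal (ut x t - laplacian H x t) \<le>
          (\<integral>\<^sup>+ p. indicator (UNIV \<times> {0<..<16}) p *
              ennreal (heat_kernel (x - fst p) (t - snd p) powr (a / n)
                       * u (fst p) (snd p) powr lam) \<partial>lborel)
          * ennreal (rpow (u x t) sig)"
  shows "(\<lambda>t. SUP x\<in>cball 0 1. u x t) \<in> O[at_right 0](\<lambda>t. t powr (- n / 2))"
proof -
  have n: "0 < n" by (simp add: n_def)
  interpret heat_power_source u ut g H n a lam sig
  proof unfold_locales
    show "n = real DIM('a)" by (simp add: n_def)
    show "n + 2 - a \<le> n * lam" "n * lam < n + 2" "a + n * lam + n * sig < 2 * (n + 2)"
      using hlam hsig n by (simp_all add: field_simps)
  qed (fact assms)+
  obtain B where B: "0 < B" "\<And>x t. norm (x::'a) \<le> 1 \<Longrightarrow> 0 < t \<Longrightarrow> t \<le> 1/4 \<Longrightarrow> u x t \<le> B * t powr (- n / 2)"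
    using blowup_rate by blast
  have "\<forall>\<^sub>F t in at_right 0. t \<in> {0<..<1/4::real}"
    by (rule eventually_at_right_real) simp
  hence "\<forall>\<^sub>F t in at_right 0. norm (SUP x\<in>cball 0 1. u x t) \<le> B * norm (t powr (- n / 2))"
  proof eventually_elim
    case (elim t)
    hence t: "0 < t" "t \<le> 1/4" by auto
    have ub: "u x t \<le> B * t powr (- n / 2)" if "x \<in> cball 0 1" for x using B(2)[of x t] that t by simp
    have "(SUP x\<in>cball 0 1. u x t) \<le> B * t powr (- n / 2)"
      by (intro cSUP_least ub) auto
    \<comment> \<open>The value at the origin shows that the supremum is nonnegative, so its norm is
      itself; the pointwise bound supplies the boundedness that a real \<open>SUP\<close>
      requires.\<close>
    moreover have "0 \<le> u 0 t" using t by (intro nonneg) auto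
    moreover have "u 0 t \<le> (SUP x\<in>cball 0 1. u x t)"
      using ub by (intro cSUP_upper bdd_aboveI2[where M="B * t powr (- n / 2)"]) auto
    ultimately show ?case by simp
  qed
  thus ?thesis by (rule bigoI)
qed

end
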